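(* Let $T:\Lambda\to\Lambda$ be an expanding interval map with countably many full branches as described in the context, with $\log|T'|$ having variations uniformly converging to $0$, and let $\phi_i:\Lambda\to\mathbb{R}$ ($i\in\mathbb{N}$) be functions each having variations uniformly converging to $0$. For $\underline{\gamma}=(\gamma_i)_{i\in\mathbb{N}}\in\mathbb{R}^{\mathbb{N}}$ let $$\Lambda_{\underline{\gamma}}=\Big\{x\in\Lambda:\lim_{n\to\infty}\frac1n\sum_{j=0}^{n-1}\phi_i(T^jx)=\gamma_i\ \text{ for all } i\in\mathbb{N}\Big\}.$$ If $\underline{\gamma}\notin Z$, then $\Lambda_{\underline{\gamma}}=\emptyset$. If $\underline{\gamma}\in Z$, then $$\dim\Lambda_{\underline{\gamma}}=\alpha_1(\underline{\gamma})=\alpha_2(\underline{\gamma}),$$ where $$\alpha_1(\underline{\gamma})=\lim_{\varepsilon\to0}\lim_{k\to\infty}\sup_{\mu\in\mathcal{M}(T)}\Big\{\frac{h(\mu)}{\lambda(\mu)}:\Big|\int\phi_i\,d\mu-\gamma_i\Big|<\varepsilon\ \forall i\le k,\ h(\mu)<\infty\Big\}$$ and $\alpha_2(\underline{\gamma})$ is given by the same formula with the supremum taken only over ergodic $\mu\in\mathcal{M}(T)$.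
   Context: Setting. $\{I_i\}_{i=1}^\infty$ is a countably infinite collection of pairwise disjoint nondegenerate subintervals of $[0,1]$. There is a constant $\xi>1$ such that for each $i$, $T_i:\overline{I_i}\to[0,1]$ is a bijective $C^1$ map with $|T_i'|\ge\xi$, which extends to a $C^1$ diffeomorphism from an open neighbourhood of $\overline{I_i}$ to an open neighbourhood of $[0,1]$. Let $\Sigma=\mathbb{N}^{\mathbb{N}}$ (product topology), with left shift $\sigma$, and let $\Pi(\omega)$ be the unique point of $\bigcap_n T_{\omega_1}^{-1}\circ\cdots\circ T_{\omega_n}^{-1}([0,1])$. Put $\Lambda=\Pi(\Sigma)$. Write $[\omega_1,\dots,\omega_n]$ for cylinders in $\Sigma$. Define $T:\Lambda\to\Lambda$ by $T(x)=T_l(x)$ and set $T'(x)=T_l'(x)$, where $l=\min\{j: x\in\Pi([j])\}$. Let $E=\{x\in\Lambda:\#\Pi^{-1}(x)\ge2\}$, an at most countable set. Basic intervals: $C_n(\omega_1,\dots,\omega_n)=T_{\omega_1}^{-1}\circ\cdots\circ T_{\omega_n}^{-1}([0,1])\setminus E$. Variations: $\mathrm{var}_n(\phi)=\sup\{|\phi(x)-\phi(y)|: x,y\in C_n(\omega_1,\dots,\omega_n),\ (\omega_1,\dots,\omega_n)\in\mathbb{N}^n\}$, where for a function $\phi$ defined only on $\Lambda$ one takes $x,y\in C_n(\omega_1,\dots,\omega_n)\cap\Lambda$, while for $\log|T'|$ one takes all $x,y$ in the basic interval, with $T'$ there meaning $T_{\omega_1}'$. $\phi$ has variations uniformly converging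 to $0$ if $\mathrm{var}_1(\phi)<\infty$ and $\mathrm{var}_n(\phi)\to0$. $\mathcal{M}(T)$ is the set of $T$-invariant Borel probability measures on $\Lambda$. Entropy: $h(\mu)=\lim_{n\to\infty}-\frac1n\sum_{(\omega_1,\dots,\omega_n)\in\mathbb{N}^n}\mu(C_n(\omega_1,\dots,\omega_n))\log\mu(C_n(\omega_1,\dots,\omega_n))$. Lyapunov exponent: $\lambda(\mu)=\int\log|T'|\,d\mu$. If $h(\mu)<\infty=\lambda(\mu)$, the ratio $h(\mu)/\lambda(\mu)$ is $0$. $Z_0=\{\underline{\gamma}\in\mathbb{R}^{\mathbb{N}}:\exists\mu\in\mathcal{M}(T)\ \forall i\in\mathbb{N},\ \int\phi_i\,d\mu=\gamma_i\}$, and $Z$ is the closure of $Z_0$ in the topology of pointwise convergence: $\underline{\gamma}\in Z$ iff for every $\varepsilon>0$, $k\in\mathbb{N}$ there is $\mu\in\mathcal{M}(T)$ with $|\int\phi_i\,d\mu-\gamma_i|\le\varepsilon$ for $1\le i\le k$. $\dim$ is Hausdorff dimension (with $\dim\emptyset=0$). *)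

theory Defs
  imports "HOL-Probability.Probability"
begin

section \<open>Hausdorff dimension\<close>

text \<open>The cases \<open>U = {}\<close> and \<open>s = 0\<close> are separated because \<open>0 powr 0 = 0\<close>, whereas the
  zero-dimensional Hausdorff measure counts points.\<close>

definition hausdorff_gauge :: "real \<Rightarrow> 'a::metric_space set \<Rightarrow> ennreal" where
  "hausdorff_gauge s U =
    (if U = {} then 0 else if s = 0 then 1 else ennreal (diameter U powr s))"

text \<open>Boundedness of the covering sets is required since \<^const>\<open>diameter\<close> is only meaningful for
  bounded sets.\<close>

definition hausdorff_premeasure :: "real \<Rightarrow> real \<Rightarrow> 'a::metric_space set \<Rightarrow> ennreal" where
  "hausdorff_premeasure s \<delta> A =
    (INF U \<in> {U :: nat \<Rightarrow> 'a set. A \<subseteq> (\<Union>i. U i) \<and> (\<forall>i. bounded (U i) \<and> diameter (U i) \<le> \<delta>)}.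
      (\<Sum>i. hausdorff_gauge s (U i)))"

definition hausdorff_measure :: "real \<Rightarrow> 'a::metric_space set \<Rightarrow> ennreal" where
  "hausdorff_measure s A = (SUP \<delta> \<in> {0<..}. hausdorff_premeasure s \<delta> A)"

definition hausdorff_dim :: "'a::metric_space set \<Rightarrow> ennreal" where
  "hausdorff_dim A = (INF s \<in> {s. 0 \<le> s \<and> hausdorff_measure s A = 0}. ennreal s)"


section \<open>Expanding interval maps with countably many full branches\<close>

text \<open>Throughout, \<open>I i\<close> are the intervals and \<open>f i\<close> the branches (written \<open>T\<^sub>i\<close> on paper); only the
  values of \<open>f i\<close> on \<open>closure (I i)\<close> matter. Indices start at \<open>0\<close>.\<close>

definition branch_deriv :: "(nat \<Rightarrow> real set) \<Rightarrow> (nat \<Rightarrow> real \<Rightarrow> real) \<Rightarrow> nat \<Rightarrow> real \<Rightarrow> real" where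
  "branch_deriv I f i x = vector_derivative (f i) (at x within closure (I i))"

definition expanding_full_branches ::
    "real \<Rightarrow> (nat \<Rightarrow> real set) \<Rightarrow> (nat \<Rightarrow> real \<Rightarrow> real) \<Rightarrow> bool" where
  "expanding_full_branches \<xi> I f \<longleftrightarrow>
    1 < \<xi> \<and> disjoint_family I \<and>
    (\<forall>i. is_interval (I i) \<and> I i \<subseteq> {0..1} \<and> (\<exists>x\<in>I i. \<exists>y\<in>I i. x < y) \<and>
      bij_betw (f i) (closure (I i)) {0..1} \<and>
      (\<forall>x\<in>closure (I i). f i differentiable (at x within closure (I i))) \<and>
      continuous_on (closure (I i)) (branch_deriv I f i) \<and>
      (\<forall>x\<in>closure (I i). \<xi> \<le> \<bar>branch_deriv I f i x\<bar>) \<and>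
      (\<exists>U V g h. open U \<and> closure (I i) \<subseteq> U \<and> open V \<and> {0..1} \<subseteq> V \<and>
        homeomorphism U V g h \<and> g C1_differentiable_on U \<and> h C1_differentiable_on V \<and>
        (\<forall>x\<in>closure (I i). g x = f i x)))"

text \<open>The set obtained from \<open>[0,1]\<close> by pulling back along the branches in a finite word.\<close>

primrec word_interval :: "(nat \<Rightarrow> real set) \<Rightarrow> (nat \<Rightarrow> real \<Rightarrow> real) \<Rightarrow> nat list \<Rightarrow> real set" where
  "word_interval I f [] = {0..1}"
| "word_interval I f (i # w) = {x \<in> closure (I i). f i x \<in> word_interval I f w}"

definition coding :: "(nat \<Rightarrow> real set) \<Rightarrow> (nat \<Rightarrow> real \<Rightarrow> real) \<Rightarrow> (nat \<Rightarrow> nat) \<Rightarrow> real" where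
  "coding I f \<omega> = (THE x. x \<in> (\<Inter>n. word_interval I f (map \<omega> [0..<n])))"

definition limit_set :: "(nat \<Rightarrow> real set) \<Rightarrow> (nat \<Rightarrow> real \<Rightarrow> real) \<Rightarrow> real set" where
  "limit_set I f = range (coding I f)"

definition first_symbol :: "(nat \<Rightarrow> real set) \<Rightarrow> (nat \<Rightarrow> real \<Rightarrow> real) \<Rightarrow> real \<Rightarrow> nat" where
  "first_symbol I f x = (LEAST j. x \<in> coding I f ` {\<omega>. \<omega> 0 = j})"

definition branch_map :: "(nat \<Rightarrow> real set) \<Rightarrow> (nat \<Rightarrow> real \<Rightarrow> real) \<Rightarrow> real \<Rightarrow> real" where
  "branch_map I f x = f (first_symbol I f x) x"

definition branch_map_deriv :: "(nat \<Rightarrow> real set) \<Rightarrow> (nat \<Rightarrow> real \<Rightarrow> real) \<Rightarrow> real \<Rightarrow> real" where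
  "branch_map_deriv I f x = branch_deriv I f (first_symbol I f x) x"

definition multiply_coded :: "(nat \<Rightarrow> real set) \<Rightarrow> (nat \<Rightarrow> real \<Rightarrow> real) \<Rightarrow> real set" where
  "multiply_coded I f =
    {x \<in> limit_set I f. \<exists>\<omega> \<tau>. \<omega> \<noteq> \<tau> \<and> coding I f \<omega> = x \<and> coding I f \<tau> = x}"

definition basic_interval :: "(nat \<Rightarrow> real set) \<Rightarrow> (nat \<Rightarrow> real \<Rightarrow> real) \<Rightarrow> nat list \<Rightarrow> real set" where
  "basic_interval I f w = word_interval I f w - multiply_coded I f"


section \<open>Variations\<close>

text \<open>The function \<open>\<psi> w\<close> compared on \<open>A w\<close> may depend on the word \<open>w\<close>: for \<open>log |T'|\<close> the
  derivative on a basic interval is that of the branch given by the first letter of the word.\<close>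

definition variation ::
    "(nat list \<Rightarrow> real set) \<Rightarrow> (nat list \<Rightarrow> real \<Rightarrow> real) \<Rightarrow> nat \<Rightarrow> ennreal" where
  "variation A \<psi> n =
    (SUP w \<in> {w. length w = n}. SUP x \<in> A w. SUP y \<in> A w. ennreal \<bar>\<psi> w x - \<psi> w y\<bar>)"

definition variations_vanish ::
    "(nat list \<Rightarrow> real set) \<Rightarrow> (nat list \<Rightarrow> real \<Rightarrow> real) \<Rightarrow> bool" where
  "variations_vanish A \<psi> \<longleftrightarrow> variation A \<psi> 1 < \<infinity> \<and> variation A \<psi> \<longlonglongrightarrow> 0"

definition potential_variations_vanish ::
    "(nat \<Rightarrow> real set) \<Rightarrow> (nat \<Rightarrow> real \<Rightarrow> real) \<Rightarrow> (real \<Rightarrow> real) \<Rightarrow> bool" where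
  "potential_variations_vanish I f \<phi> \<longleftrightarrow>
    variations_vanish (\<lambda>w. basic_interval I f w \<inter> limit_set I f) (\<lambda>w. \<phi>)"

definition log_deriv_variations_vanish ::
    "(nat \<Rightarrow> real set) \<Rightarrow> (nat \<Rightarrow> real \<Rightarrow> real) \<Rightarrow> bool" where
  "log_deriv_variations_vanish I f \<longleftrightarrow>
    variations_vanish (basic_interval I f) (\<lambda>w x. ln \<bar>branch_deriv I f (hd w) x\<bar>)"


section \<open>Invariant measures, entropy and Lyapunov exponent\<close>

definition invariant_measures ::
    "(nat \<Rightarrow> real set) \<Rightarrow> (nat \<Rightarrow> real \<Rightarrow> real) \<Rightarrow> real measure set" where
  "invariant_measures I f =
    {\<mu>. sets \<mu> = sets (restrict_space borel (limit_set I f)) \<and> prob_space \<mu> \<and>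
        branch_map I f \<in> measurable \<mu> \<mu> \<and> distr \<mu> \<mu> (branch_map I f) = \<mu>}"

definition ergodic_measures ::
    "(nat \<Rightarrow> real set) \<Rightarrow> (nat \<Rightarrow> real \<Rightarrow> real) \<Rightarrow> real measure set" where
  "ergodic_measures I f =
    {\<mu> \<in> invariant_measures I f.
      \<forall>A \<in> sets \<mu>. branch_map I f -` A \<inter> space \<mu> = A \<longrightarrow> measure \<mu> A = 0 \<or> measure \<mu> A = 1}"

text \<open>The measures live on the limit set, so the measure of a basic interval means the measure of
  its trace on the limit set. All summands are nonnegative, and \<open>0 * ln 0 = 0\<close>.\<close>

definition partition_entropy ::
    "(nat \<Rightarrow> real set) \<Rightarrow> (nat \<Rightarrow> real \<Rightarrow> real) \<Rightarrow> real measure \<Rightarrow> nat \<Rightarrow> ennreal" where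
  "partition_entropy I f \<mu> n =
    (\<Sum>\<^sub>\<infinity>w \<in> {w. length w = n}.
      (let p = measure \<mu> (basic_interval I f w \<inter> limit_set I f) in ennreal (- (p * ln p))))"

definition entropy_of ::
    "(nat \<Rightarrow> real set) \<Rightarrow> (nat \<Rightarrow> real \<Rightarrow> real) \<Rightarrow> real measure \<Rightarrow> ennreal" where
  "entropy_of I f \<mu> = lim (\<lambda>n. partition_entropy I f \<mu> n / of_nat n)"

text \<open>The integrand is positive because \<open>|T'| \<ge> \<xi> > 1\<close>, so no positive part is lost by
  \<^const>\<open>ennreal\<close>; the value may be infinite.\<close>

definition lyapunov_exponent ::
    "(nat \<Rightarrow> real set) \<Rightarrow> (nat \<Rightarrow> real \<Rightarrow> real) \<Rightarrow> real measure \<Rightarrow> ennreal" where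
  "lyapunov_exponent I f \<mu> = (\<integral>\<^sup>+ x. ennreal (ln \<bar>branch_map_deriv I f x\<bar>) \<partial>\<mu>)"


section \<open>Birkhoff level sets and the two spectra\<close>

definition birkhoff_level_set ::
    "(nat \<Rightarrow> real set) \<Rightarrow> (nat \<Rightarrow> real \<Rightarrow> real) \<Rightarrow> (nat \<Rightarrow> real \<Rightarrow> real) \<Rightarrow> (nat \<Rightarrow> real) \<Rightarrow> real set"
where
  "birkhoff_level_set I f \<phi> \<gamma> =
    {x \<in> limit_set I f.
      \<forall>i. (\<lambda>n. (\<Sum>j<n. \<phi> i ((branch_map I f ^^ j) x)) / real n) \<longlonglongrightarrow> \<gamma> i}"

text \<open>Integrability is stated explicitly wherever an integral has to be close or equal to a real
  number, because the Bochner integral of a non-integrable function is \<open>0\<close> by convention.\<close>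

definition exact_averages ::
    "(nat \<Rightarrow> real set) \<Rightarrow> (nat \<Rightarrow> real \<Rightarrow> real) \<Rightarrow> (nat \<Rightarrow> real \<Rightarrow> real) \<Rightarrow> (nat \<Rightarrow> real) set" where
  "exact_averages I f \<phi> =
    {\<gamma>. \<exists>\<mu> \<in> invariant_measures I f. \<forall>i. integrable \<mu> (\<phi> i) \<and> (\<integral>x. \<phi> i x \<partial>\<mu>) = \<gamma> i}"

text \<open>The topology on \<^typ>\<open>nat \<Rightarrow> real\<close> is the product topology, i.e. pointwise convergence.\<close>

definition approx_averages ::
    "(nat \<Rightarrow> real set) \<Rightarrow> (nat \<Rightarrow> real \<Rightarrow> real) \<Rightarrow> (nat \<Rightarrow> real \<Rightarrow> real) \<Rightarrow> (nat \<Rightarrow> real) set" where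
  "approx_averages I f \<phi> = closure (exact_averages I f \<phi>)"

text \<open>In \<^typ>\<open>ennreal\<close>, dividing a finite entropy by an infinite Lyapunov exponent gives \<open>0\<close>. Both
  limits exist by monotonicity in \<open>k\<close> and in \<open>\<epsilon>\<close>.\<close>

definition dim_spectrum ::
    "(nat \<Rightarrow> real set) \<Rightarrow> (nat \<Rightarrow> real \<Rightarrow> real) \<Rightarrow> (nat \<Rightarrow> real \<Rightarrow> real) \<Rightarrow> real measure set
      \<Rightarrow> (nat \<Rightarrow> real) \<Rightarrow> ennreal" where
  "dim_spectrum I f \<phi> M \<gamma> =
    Lim (at_right 0) (\<lambda>\<epsilon>. lim (\<lambda>k.
      SUP \<mu> \<in> {\<mu> \<in> M.
          (\<forall>i<k. integrable \<mu> (\<phi> i) \<and> \<bar>(\<integral>x. \<phi> i x \<partial>\<mu>) - \<gamma> i\<bar> < \<epsilon>) \<and> entropy_of I f \<mu> < \<infinity>}.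
        entropy_of I f \<mu> / lyapunov_exponent I f \<mu>))"

definition alpha1 ::
    "(nat \<Rightarrow> real set) \<Rightarrow> (nat \<Rightarrow> real \<Rightarrow> real) \<Rightarrow> (nat \<Rightarrow> real \<Rightarrow> real) \<Rightarrow> (nat \<Rightarrow> real) \<Rightarrow> ennreal" where
  "alpha1 I f \<phi> \<gamma> = dim_spectrum I f \<phi> (invariant_measures I f) \<gamma>"

definition alpha2 ::
    "(nat \<Rightarrow> real set) \<Rightarrow> (nat \<Rightarrow> real \<Rightarrow> real) \<Rightarrow> (nat \<Rightarrow> real \<Rightarrow> real) \<Rightarrow> (nat \<Rightarrow> real) \<Rightarrow> ennreal" where
  "alpha2 I f \<phi> \<gamma> = dim_spectrum I f \<phi> (ergodic_measures I f) \<gamma>"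

end

(* Everything is compared with one combinatorial condition on an exponent s: arbitrarily long words w
   with nearly correct Birkhoff averages carry total weight at least 1, where the weight of w is the
   s-th power of the length of its basic interval, up to subexponential distortion.
   - If the condition fails, the covers of the level set by such basic intervals show that its
     dimension is at most s.
   - If it holds, the Bernoulli measure on concatenations of words of a fixed length, with
     probabilities proportional to the weights and averaged over the position in the block, is ergodic
     and satisfies a one-sided Gibbs bound, hence has h / lambda >= s. Concatenating independent
     blocks with slowly improving averages instead gives a measure on the level set itself, to which
     the mass distribution principle applies.
   - If an invariant measure has h > s lambda and nearly correct integrals, then the words that are
     typical for the independent repetition of its n-cylinder distribution verify the condition; no
     ergodicity is needed.
   Points with ambiguous codings eventually map to 0 or 1, so they are countable and wandering. *)

theory Submission
  imports Defs
begin

text \<open>The variations of \<open>log |T'|\<close> tend to 0 but are not assumed summable, so the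
  length of a cylinder is multiplicative only up to a factor \<open>exp (o(n))\<close>. The lower
  weights \<open>weight\<close> carry this loss from the start, which turns concatenation into a
  clean inequality; the loss is paid back at the end by comparing only exponents with a strict gap
  \<open>t < s\<close>. Since words contract by at least \<open>\<xi>\<close> per letter, such a gap
  is worth an exponential factor in the word length and beats every subexponential error. The
  alphabet is infinite: potentials, \<open>log |T'|\<close> and entropies may be unbounded. Hence
  the condition on s asks for finite sets of words, and an invariant measure is first truncated to
  finitely many cylinders of one fixed level. The functions are controlled only off the multiply
  coded points. All estimates are therefore made along the codes in \<open>reg\<close>. Periodic
  codes always belong to \<open>reg\<close> and serve as sample points for words; an ambiguous point
  is compared with them at the price of a constant that depends on the point but not on
  time.\<close>

lemma closure_bounded_interval:
  fixes S :: "real set"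
  assumes S: "is_interval S" "bounded S" and xy: "x \<in> S" "y \<in> S" "x < y"
  shows "closure S = {Inf S..Sup S}" "{Inf S<..<Sup S} \<subseteq> S" "Inf S < Sup S"
proof -
  have bdd: "bdd_above S" "bdd_below S"
    using S(2) bounded_imp_bdd_above bounded_imp_bdd_below by auto
  have lt: "Inf S \<le> x" "y \<le> Sup S"
    using bdd xy by (auto intro: cInf_lower cSup_upper)
  show less: "Inf S < Sup S"
    using lt xy by linarith
  show sub: "{Inf S<..<Sup S} \<subseteq> S"
  proof
    fix z assume z: "z \<in> {Inf S<..<Sup S}"
    obtain p where "p \<in> S" "p < z"
      using z xy bdd by (metis cInf_less_iff empty_iff greaterThanLessThan_iff)
    moreover obtain q where "q \<in> S" "z < q"
      using z xy bdd by (metis less_cSup_iff empty_iff greaterThanLessThan_iff)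
    ultimately show "z \<in> S"
      using S(1) unfolding is_interval_1 by (meson less_imp_le)
  qed
  have "S \<subseteq> {Inf S..Sup S}"
    using bdd by (auto intro: cInf_lower cSup_upper)
  then have "closure S \<subseteq> {Inf S..Sup S}"
    by (simp add: closure_minimal)
  moreover have "{Inf S..Sup S} \<subseteq> closure S"
    using closure_mono[OF sub] less by simp
  ultimately show "closure S = {Inf S..Sup S}" by blast
qed

text \<open>Basic intervals omit the countable set of multiply coded points. Density of what remains
  lets bounds on continuous functions pass to the full closed cylinder.\<close>

lemma countable_complement_dense_Icc:
  fixes a b x e :: real
  assumes "a < b" "countable E" "x \<in> {a..b}" "0 < e"
  shows "\<exists>y \<in> {a..b} - E. \<bar>y - x\<bar> < e"
proof -
  define p q where "p = max a (x - e/2)" and "q = min b (x + e/2)"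
  have "p < q" using assms by (auto simp: p_def q_def)
  then have "\<not> {p..q} \<subseteq> E"
    using uncountable_closed_interval countable_subset assms(2) by blast
  then obtain y where y: "y \<in> {p..q}" "y \<notin> E" by blast
  then have "y \<in> {a..b}" "\<bar>y - x\<bar> < e"
    using assms by (auto simp: p_def q_def abs_if)
  with y show ?thesis by blast
qed

section \<open>Codes, prefixes and moduli of variation\<close>

definition shift_code :: "nat \<Rightarrow> (nat \<Rightarrow> nat) \<Rightarrow> nat \<Rightarrow> nat" where
  "shift_code n \<omega> = (\<lambda>k. \<omega> (n + k))"

definition prefix_of :: "(nat \<Rightarrow> nat) \<Rightarrow> nat \<Rightarrow> nat list" where
  "prefix_of \<omega> n = map \<omega> [0..<n]"

lemma shift_code_0 [simp]: "shift_code 0 \<omega> = \<omega>"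
  by (simp add: shift_code_def)

lemma shift_code_shift_code [simp]: "shift_code m (shift_code n \<omega>) = shift_code (n + m) \<omega>"
  by (simp add: shift_code_def add.assoc)

lemma shift_code_apply: "shift_code n \<omega> k = \<omega> (n + k)"
  by (simp add: shift_code_def)

lemma length_prefix_of [simp]: "length (prefix_of \<omega> n) = n"
  by (simp add: prefix_of_def)

lemma nth_prefix_of [simp]: "k < n \<Longrightarrow> prefix_of \<omega> n ! k = \<omega> k"
  by (simp add: prefix_of_def)

lemma prefix_of_0 [simp]: "prefix_of \<omega> 0 = []"
  by (simp add: prefix_of_def)

lemma prefix_of_add: "prefix_of \<omega> (m + n) = prefix_of \<omega> m @ prefix_of (shift_code m \<omega>) n"
  by (rule nth_equalityI) (auto simp: nth_append shift_code_apply)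

lemma prefix_of_Suc: "prefix_of \<omega> (Suc n) = \<omega> 0 # prefix_of (shift_code 1 \<omega>) n"
  using prefix_of_add[of \<omega> 1 n] by (simp add: prefix_of_def shift_code_apply)

lemma take_prefix_of: "m \<le> n \<Longrightarrow> take m (prefix_of \<omega> n) = prefix_of \<omega> m"
  by (rule nth_equalityI) auto

lemma prefix_of_shift_code: "prefix_of (shift_code m \<omega>) n = drop m (prefix_of \<omega> (m + n))"
  by (simp add: prefix_of_add)

lemma prefix_of_append_iff:
  "prefix_of \<omega> (length (u @ v)) = u @ v \<longleftrightarrow>
     prefix_of \<omega> (length u) = u \<and> prefix_of (shift_code (length u) \<omega>) (length v) = v"
  by (simp add: prefix_of_add)

lemma prefix_of_eq_iff: "prefix_of \<omega> n = prefix_of \<tau> n \<longleftrightarrow> (\<forall>k<n. \<omega> k = \<tau> k)"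
  by (auto simp: prefix_of_def)

text \<open>Only levels from 1 on are controlled, and for the empty word the branch
  \<open>hd []\<close> is unspecified; level 0 is given the harmless value 0.\<close>

definition modulus :: "(nat list \<Rightarrow> real set) \<Rightarrow> (nat list \<Rightarrow> real \<Rightarrow> real) \<Rightarrow> nat \<Rightarrow> real" where
  "modulus A \<psi> n = (if n = 0 then 0 else enn2real (variation A \<psi> n))"

text \<open>Two orbits with a common prefix of length \<open>n\<close> still share
  \<open>n - j\<close> symbols at time \<open>j\<close>, so their differences along a Birkhoff sum
  add up to at most this quantity.\<close>

definition cum_modulus :: "(nat list \<Rightarrow> real set) \<Rightarrow> (nat list \<Rightarrow> real \<Rightarrow> real) \<Rightarrow> nat \<Rightarrow> real" where
  "cum_modulus A \<psi> n = (\<Sum>k=1..n. modulus A \<psi> k)"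

lemma modulus_nonneg: "0 \<le> modulus A \<psi> n"
  by (simp add: modulus_def)

lemma cum_modulus_nonneg: "0 \<le> cum_modulus A \<psi> n"
  by (simp add: cum_modulus_def modulus_nonneg sum_nonneg)

lemma cum_modulus_0 [simp]: "cum_modulus A \<psi> 0 = 0"
  by (simp add: cum_modulus_def)

lemma cum_modulus_Suc: "cum_modulus A \<psi> (Suc n) = cum_modulus A \<psi> n + modulus A \<psi> (Suc n)"
  by (simp add: cum_modulus_def)

text \<open>A longer word compares the same function on a smaller set. The single finiteness
  assumption at level 1 thus makes every later variation finite, so that passing to real numbers
  loses nothing.\<close>

lemma variation_le_1:
  assumes mono: "\<And>w. w \<noteq> [] \<Longrightarrow> A w \<subseteq> A [hd w] \<and> \<psi> w = \<psi> [hd w]" and n: "n \<noteq> 0"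
  shows "variation A \<psi> n \<le> variation A \<psi> 1"
  unfolding variation_def
proof (intro SUP_least)
  fix w x y assume w: "w \<in> {w. length w = n}" and xy: "x \<in> A w" "y \<in> A w"
  have ne: "w \<noteq> []" using w n by auto
  then have "x \<in> A [hd w]" "y \<in> A [hd w]" "\<psi> w = \<psi> [hd w]"
    using mono xy by blast+
  then show "ennreal \<bar>\<psi> w x - \<psi> w y\<bar>
      \<le> (SUP w \<in> {w. length w = 1}. SUP x \<in> A w. SUP y \<in> A w. ennreal \<bar>\<psi> w x - \<psi> w y\<bar>)"
    by (intro SUP_upper2[of "[hd w]"] SUP_upper2[of x] SUP_upper2[of y]) auto
qed

lemma variation_finite:
  assumes mono: "\<And>w. w \<noteq> [] \<Longrightarrow> A w \<subseteq> A [hd w] \<and> \<psi> w = \<psi> [hd w]"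
    and van: "variations_vanish A \<psi>" and n: "n \<noteq> 0"
  shows "variation A \<psi> n < \<infinity>"
  using variation_le_1[of A \<psi>, OF mono n] van
  by (auto simp: variations_vanish_def intro: le_less_trans)

lemma modulus_bound:
  assumes mono: "\<And>w. w \<noteq> [] \<Longrightarrow> A w \<subseteq> A [hd w] \<and> \<psi> w = \<psi> [hd w]"
    and van: "variations_vanish A \<psi>" and w: "w \<noteq> []" and xy: "x \<in> A w" "y \<in> A w"
  shows "\<bar>\<psi> w x - \<psi> w y\<bar> \<le> modulus A \<psi> (length w)"
proof -
  have fin: "variation A \<psi> (length w) < \<infinity>"
    using variation_finite[of A \<psi>, OF mono van] w by simp
  have "ennreal \<bar>\<psi> w x - \<psi> w y\<bar> \<le> variation A \<psi> (length w)"
    unfolding variation_def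
    by (intro SUP_upper2[of w] SUP_upper2[of x] SUP_upper2[of y]) (use xy in auto)
  then show ?thesis
    using fin w by (simp add: modulus_def) (metis enn2real_ennreal enn2real_mono abs_ge_zero)
qed

text \<open>Cesaro averaging: all but finitely many moduli are at most \<open>\<delta>\<close>, and
  the others sum to a constant. A bound for every \<open>n\<close> can be inserted directly into
  exponents.\<close>

lemma cum_modulus_sublinear:
  assumes mono: "\<And>w. w \<noteq> [] \<Longrightarrow> A w \<subseteq> A [hd w] \<and> \<psi> w = \<psi> [hd w]"
    and van: "variations_vanish A \<psi>" and d: "0 < \<delta>"
  shows "\<exists>K\<ge>0. \<forall>n. cum_modulus A \<psi> n \<le> K + \<delta> * real n"
proof -
  have "(\<lambda>n. enn2real (variation A \<psi> n)) \<longlonglongrightarrow> enn2real 0"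
    using van by (intro tendsto_enn2real) (auto simp: variations_vanish_def)
  then have "eventually (\<lambda>n. enn2real (variation A \<psi> n) < \<delta>) sequentially"
    using order_tendstoD(2)[of _ "enn2real 0" sequentially \<delta>] d by simp
  then obtain N where N: "\<And>n. n \<ge> N \<Longrightarrow> modulus A \<psi> n \<le> \<delta>"
    unfolding eventually_sequentially by (metis modulus_def less_imp_le d)
  have "cum_modulus A \<psi> n \<le> cum_modulus A \<psi> N + \<delta> * real n" for n
  proof (induction n)
    case 0
    show ?case by (simp add: cum_modulus_nonneg)
  next
    case (Suc n)
    show ?case
    proof (cases "Suc n \<ge> N")
      case True
      then show ?thesis using Suc N[OF True] d
        by (simp add: cum_modulus_Suc algebra_simps)
    next
      case False
      then have "cum_modulus A \<psi> (Suc n) \<le> cum_modulus A \<psi> N"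
        unfolding cum_modulus_def by (intro sum_mono2) (auto simp: modulus_nonneg)
      moreover have "0 \<le> \<delta> * real (Suc n)" using d by simp
      ultimately show ?thesis by linarith
    qed
  qed
  then show ?thesis using cum_modulus_nonneg by blast
qed

section \<open>Branches, cylinders and their lengths\<close>

locale expanding_system =
  fixes \<xi> :: real and I :: "nat \<Rightarrow> real set" and f :: "nat \<Rightarrow> real \<Rightarrow> real"
  assumes full_branches: "expanding_full_branches \<xi> I f"
    and log_deriv: "log_deriv_variations_vanish I f"
begin

abbreviation D :: "nat \<Rightarrow> real \<Rightarrow> real" where "D \<equiv> branch_deriv I f"
abbreviation W :: "nat list \<Rightarrow> real set" where "W \<equiv> word_interval I f"
abbreviation cod :: "(nat \<Rightarrow> nat) \<Rightarrow> real" where "cod \<equiv> coding I f"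
abbreviation T :: "real \<Rightarrow> real" where "T \<equiv> branch_map I f"
abbreviation \<Lambda> :: "real set" where "\<Lambda> \<equiv> limit_set I f"

definition lo :: "nat \<Rightarrow> real" where "lo i = Inf (I i)"
definition hi :: "nat \<Rightarrow> real" where "hi i = Sup (I i)"

lemma \<xi>_gt_1: "1 < \<xi>"
  using full_branches by (simp add: expanding_full_branches_def)

lemma ln_\<xi>_pos: "0 < ln \<xi>"
  using \<xi>_gt_1 by simp

lemma branch_interval:
  shows closure_I: "closure (I i) = {lo i..hi i}"
    and interior_I: "{lo i<..<hi i} \<subseteq> I i"
    and lo_less_hi: "lo i < hi i"
    and lo_nonneg: "0 \<le> lo i" and hi_le_1: "hi i \<le> 1"
proof -
  have *: "is_interval (I i)" "I i \<subseteq> {0..1}" "\<exists>x\<in>I i. \<exists>y\<in>I i. x < y"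
    using full_branches by (auto simp: expanding_full_branches_def)
  have bd: "bounded (I i)"
    using *(2) bounded_subset bounded_closed_interval by blast
  obtain x y where xy: "x \<in> I i" "y \<in> I i" "x < y" using *(3) by blast
  note c = closure_bounded_interval[OF *(1) bd xy]
  show "closure (I i) = {lo i..hi i}" "{lo i<..<hi i} \<subseteq> I i" and lt: "lo i < hi i"
    using c by (auto simp: lo_def hi_def)
  have "closure (I i) \<subseteq> {0..1}"
    using *(2) by (simp add: closure_minimal)
  then have "{lo i..hi i} \<subseteq> {0..1}"
    using c by (simp add: lo_def hi_def)
  then show "0 \<le> lo i" "hi i \<le> 1" using lt by auto
qed

lemma branch_bij: "bij_betw (f i) {lo i..hi i} {0..1}"
  and branch_deriv_ge: "x \<in> {lo i..hi i} \<Longrightarrow> \<xi> \<le> \<bar>D i x\<bar>"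
  and branch_deriv_cont: "continuous_on {lo i..hi i} (D i)"
  using full_branches by (auto simp: expanding_full_branches_def closure_I)

lemma branch_deriv_pos: "x \<in> {lo i..hi i} \<Longrightarrow> 0 < \<bar>D i x\<bar>"
  using branch_deriv_ge[of x i] \<xi>_gt_1 by linarith

lemma branch_has_deriv:
  assumes "x \<in> {lo i..hi i}"
  shows "(f i has_real_derivative D i x) (at x within {lo i..hi i})"
proof -
  have "f i differentiable (at x within {lo i..hi i})"
    using full_branches assms by (auto simp: expanding_full_branches_def closure_I)
  then show ?thesis
    unfolding branch_deriv_def closure_I has_real_derivative_iff_has_vector_derivative
    using vector_derivative_works by blast
qed

lemma branch_cont: "continuous_on {lo i..hi i} (f i)"
  using branch_has_deriv by (meson DERIV_continuous_on)

text \<open>Branches may preserve or reverse orientation, so the mean value theorem is put into a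
  form with absolute values and an unoriented segment.\<close>

lemma branch_mvt:
  assumes "x \<in> {lo i..hi i}" "y \<in> {lo i..hi i}"
  shows "\<exists>z \<in> closed_segment x y. \<bar>f i x - f i y\<bar> = \<bar>D i z\<bar> * \<bar>x - y\<bar>"
proof -
  have *: "\<exists>z \<in> {x<..<y}. f i y - f i x = D i z * (y - x)"
    if "x \<in> {lo i..hi i}" "y \<in> {lo i..hi i}" "x < y" for x y
  proof -
    have "(f i has_derivative (*) (D i z)) (at z within {x..y})" if "x \<le> z" "z \<le> y" for z
      using branch_has_deriv[of z i] \<open>x \<in> _\<close> \<open>y \<in> _\<close> that unfolding has_field_derivative_def
      by (intro has_derivative_subset[of _ _ _ "{lo i..hi i}" "{x..y}"]) auto
    then show ?thesis using mvt_simple[OF \<open>x < y\<close>, of "f i" "\<lambda>z. (*) (D i z)"] by blast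
  qed
  consider "x < y" | "x = y" | "y < x" by linarith
  then show ?thesis
  proof cases
    case 1
    then obtain z where "z \<in> {x<..<y}" "f i y - f i x = D i z * (y - x)"
      using * assms by blast
    then show ?thesis
      using 1 by (intro bexI[of _ z]) (auto simp: closed_segment_eq_real_ivl abs_mult abs_minus_commute[of "f i x"])
  next
    case 2 then show ?thesis by auto
  next
    case 3
    then obtain z where "z \<in> {y<..<x}" "f i x - f i y = D i z * (x - y)"
      using * assms by blast
    then show ?thesis
      using 3 by (intro bexI[of _ z]) (auto simp: closed_segment_eq_real_ivl abs_mult)
  qed
qed

text \<open>A continuous injective map carries a segment onto the segment between the images of its
  ends, and here that image is the whole unit interval.\<close>

lemma branch_endpoints: "f i (lo i) \<in> {0, 1}" "f i (hi i) \<in> {0, 1}"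
proof -
  have inj: "inj_on (f i) {lo i..hi i}" and im: "f i ` {lo i..hi i} = {0..1}"
    using branch_bij by (auto simp: bij_betw_def)
  have seg: "closed_segment (lo i) (hi i) = {lo i..hi i}"
    using lo_less_hi[of i] by (simp add: closed_segment_eq_real_ivl)
  have "f i ` closed_segment (lo i) (hi i) = closed_segment (f i (lo i)) (f i (hi i))"
    using branch_cont inj by (intro continuous_injective_image_segment_1) (auto simp: seg)
  then have e: "{0..1} = closed_segment (f i (lo i)) (f i (hi i))"
    using im seg by simp
  have "{f i (lo i), f i (hi i)} = {0, 1}"
  proof (cases "f i (lo i) \<le> f i (hi i)")
    case True
    then have "{0..1} = {f i (lo i)..f i (hi i)}"
      using e by (simp add: closed_segment_eq_real_ivl)
    then show ?thesis by (subst (asm) Icc_eq_Icc) auto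
  next
    case False
    then have "{0..1} = {f i (hi i)..f i (lo i)}"
      using e by (simp add: closed_segment_eq_real_ivl)
    then show ?thesis by (subst (asm) Icc_eq_Icc) auto
  qed
  then show "f i (lo i) \<in> {0, 1}" "f i (hi i) \<in> {0, 1}"
    by blast+
qed

text \<open>Inside the unit interval, 0 or 1 can only be an end of a branch interval. Thus
  \<open>{0, 1}\<close> absorbs orbits, which is the basis for handling ambiguous codings.\<close>

lemma unit_endpoint_maps:
  assumes "x \<in> {lo i..hi i}" "x \<in> {0, 1}"
  shows "f i x \<in> {0, 1}"
proof -
  have "x = lo i \<or> x = hi i"
    using assms lo_nonneg[of i] hi_le_1[of i] lo_less_hi[of i] by auto
  then show ?thesis using branch_endpoints by blast
qed

text \<open>The open cores of the two intervals lie in the disjoint sets \<open>I a\<close> and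
  \<open>I b\<close>, so a common point is the right end of one interval and the left end of the
  other. Having a nondegenerate interval on either side, it is neither 0 nor 1.\<close>

lemma shared_point:
  assumes "a \<noteq> b" "x \<in> {lo a..hi a}" "x \<in> {lo b..hi b}"
  shows "f a x \<in> {0, 1}" "x \<notin> {0, 1}"
proof -
  have dis: "I a \<inter> I b = {}"
    using full_branches assms(1) by (auto simp: expanding_full_branches_def disjoint_family_on_def)
  have "max (lo a) (lo b) \<ge> min (hi a) (hi b)"
  proof (rule ccontr)
    assume "\<not> ?thesis"
    then have "max (lo a) (lo b) < min (hi a) (hi b)" by (simp only: not_le)
    from dense[OF this] obtain m where "max (lo a) (lo b) < m" "m < min (hi a) (hi b)"
      by blast
    then have "m \<in> I a" "m \<in> I b"
      using interior_I[of a] interior_I[of b] by auto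
    then show False using dis by blast
  qed
  then have "(x = lo a \<and> x = hi b) \<or> (x = lo b \<and> x = hi a)"
    using assms(2,3) lo_less_hi[of a] lo_less_hi[of b] by (auto simp: max_def min_def split: if_splits)
  then show "f a x \<in> {0, 1}" "x \<notin> {0, 1}"
    using branch_endpoints[of a] lo_less_hi[of a] lo_less_hi[of b]
      lo_nonneg[of a] lo_nonneg[of b] hi_le_1[of a] hi_le_1[of b] by auto
qed

definition inverse_branch :: "nat \<Rightarrow> real \<Rightarrow> real" where
  "inverse_branch i = inv_into {lo i..hi i} (f i)"

primrec wmap :: "nat list \<Rightarrow> real \<Rightarrow> real" where
  "wmap [] y = y"
| "wmap (i # w) y = inverse_branch i (wmap w y)"

lemma inverse_branch_in: "y \<in> {0..1} \<Longrightarrow> inverse_branch i y \<in> {lo i..hi i}"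
  unfolding inverse_branch_def using branch_bij[of i] by (metis bij_betw_def inv_into_into)

lemma branch_inverse_branch: "y \<in> {0..1} \<Longrightarrow> f i (inverse_branch i y) = y"
  unfolding inverse_branch_def using branch_bij[of i] by (metis bij_betw_def f_inv_into_f)

lemma inverse_branch_branch: "x \<in> {lo i..hi i} \<Longrightarrow> inverse_branch i (f i x) = x"
  unfolding inverse_branch_def using branch_bij[of i] by (metis bij_betw_def inv_into_f_f)

lemma branch_interval_unit: "x \<in> {lo i..hi i} \<Longrightarrow> x \<in> {0..1}"
  using lo_nonneg[of i] hi_le_1[of i] by auto

lemma inverse_branch_cont: "continuous_on {0..1} (inverse_branch i)"
proof -
  have "continuous_on (f i ` {lo i..hi i}) (inverse_branch i)"
    by (rule continuous_on_inv[OF branch_cont]) (auto simp: inverse_branch_branch)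
  then show ?thesis using branch_bij[of i] by (simp add: bij_betw_def)
qed

lemma wmap_unit: "y \<in> {0..1} \<Longrightarrow> wmap w y \<in> {0..1}"
proof (induction w)
  case (Cons i w)
  then show ?case
    using inverse_branch_in[THEN branch_interval_unit] unfolding wmap.simps by blast
qed simp

lemma wmap_append: "wmap (u @ v) y = wmap u (wmap v y)"
  by (induction u) auto

lemma wmap_inj: "x \<in> {0..1} \<Longrightarrow> y \<in> {0..1} \<Longrightarrow> wmap w x = wmap w y \<Longrightarrow> x = y"
proof (induction w)
  case (Cons i w)
  then have "wmap w x = wmap w y"
    using branch_inverse_branch wmap_unit by (metis wmap.simps(2))
  then show ?case using Cons by blast
qed simp

lemma wmap_cont: "continuous_on {0..1} (wmap w)"
proof (induction w)
  case (Cons i w)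
  have "continuous_on {0..1} (inverse_branch i \<circ> wmap w)"
    using wmap_unit by (intro continuous_on_compose Cons continuous_on_subset[OF inverse_branch_cont]) auto
  then show ?case by (simp add: comp_def)
qed (simp add: continuous_on_id)

lemma W_Cons: "W (i # w) = {x \<in> {lo i..hi i}. f i x \<in> W w}"
  by (simp add: closure_I)

declare word_interval.simps(2) [simp del]

lemma W_eq_image: "W w = wmap w ` {0..1}"
proof (induction w)
  case (Cons i w)
  show ?case
  proof (intro equalityI subsetI)
    fix x assume "x \<in> W (i # w)"
    then have x: "x \<in> {lo i..hi i}" "f i x \<in> W w" by (auto simp: W_Cons)
    then obtain y where "y \<in> {0..1}" "f i x = wmap w y" using Cons by auto
    then show "x \<in> wmap (i # w) ` {0..1}"
      using inverse_branch_branch[OF x(1)] by (metis image_eqI wmap.simps(2))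
  next
    fix x assume "x \<in> wmap (i # w) ` {0..1}"
    then obtain y where y: "y \<in> {0..1}" "x = inverse_branch i (wmap w y)" by auto
    then show "x \<in> W (i # w)"
      using Cons wmap_unit[OF y(1), of w] inverse_branch_in branch_inverse_branch
      by (auto simp: W_Cons)
  qed
qed auto

lemma W_append: "W (u @ v) = wmap u ` W v"
  unfolding W_eq_image by (auto simp: wmap_append image_image)

lemma W_append_subset: "W (u @ v) \<subseteq> W u"
  unfolding W_append unfolding W_eq_image[of u] using W_eq_image[of v] wmap_unit by fastforce

lemma unit_segment: "closed_segment 0 1 = {0..1::real}" "open_segment 0 1 = {0<..<1::real}"
  by (auto simp: closed_segment_eq_real_ivl open_segment_eq_real_ivl)

text \<open>As \<open>wmap w\<close> may reverse orientation, the cylinder is described by an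
  unoriented segment between the images of 0 and 1.\<close>

lemma W_segment: "W w = closed_segment (wmap w 0) (wmap w 1)"
proof -
  have "wmap w ` closed_segment 0 1 = closed_segment (wmap w 0) (wmap w 1)"
    using wmap_cont wmap_inj
    by (intro continuous_injective_image_segment_1) (auto simp: unit_segment inj_on_def)
  then show ?thesis by (simp add: W_eq_image unit_segment)
qed

text \<open>Closed cylinders of different words may share an end; their interiors do not meet and
  still carry the full length, as the packing count in \<open>interval_mass\<close>
  requires.\<close>

definition Wint :: "nat list \<Rightarrow> real set" where
  "Wint w = open_segment (wmap w 0) (wmap w 1)"

lemma Wint_image: "Wint w = wmap w ` {0<..<1}"
proof -
  have "wmap w ` open_segment 0 1 = open_segment (wmap w 0) (wmap w 1)"
    using wmap_cont wmap_inj
    by (intro continuous_injective_image_open_segment_1) (auto simp: unit_segment inj_on_def)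
  then show ?thesis by (simp add: Wint_def unit_segment)
qed

lemma Wint_subset: "Wint w \<subseteq> W w"
  unfolding Wint_def W_segment by (rule segment_open_subset_closed)

lemma inverse_branch_interior: "y \<in> {0<..<1} \<Longrightarrow> inverse_branch i y \<in> {0<..<1}"
proof -
  assume y: "y \<in> {0<..<1}"
  then have in1: "inverse_branch i y \<in> {lo i..hi i}" "f i (inverse_branch i y) = y"
    using inverse_branch_in branch_inverse_branch by auto
  then have "inverse_branch i y \<notin> {0,1}"
    using unit_endpoint_maps[OF in1(1)] y by auto
  then show ?thesis using branch_interval_unit[OF in1(1)] by auto
qed

lemma Wint_unit: "Wint w \<subseteq> {0<..<1}"
proof -
  have "wmap w y \<in> {0<..<1}" if "y \<in> {0<..<1}" for y
    using that
  proof (induction w)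
    case (Cons i w)
    then show ?case using inverse_branch_interior unfolding wmap.simps by blast
  qed simp
  then show ?thesis unfolding Wint_image by blast
qed

text \<open>A common point would be shared by two branch intervals, hence sent to
  \<open>{0, 1}\<close> by the first branch, whereas interiors of cylinders are sent into the open
  unit interval.\<close>

lemma Wint_Cons_disjoint:
  assumes "a \<noteq> b"
  shows "Wint (a # u) \<inter> Wint (b # v) = {}"
proof -
  have *: "x \<in> {lo c..hi c} \<and> f c x \<in> {0<..<1}" if "x \<in> Wint (c # t)" for x c t
  proof -
    obtain y where y: "y \<in> {0<..<1}" "x = inverse_branch c (wmap t y)"
      using \<open>x \<in> Wint (c # t)\<close> by (auto simp: Wint_image)
    have "wmap t y \<in> {0<..<1}" using y(1) Wint_unit[of t] unfolding Wint_image by blast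
    then show ?thesis using y inverse_branch_in[of "wmap t y" c] branch_inverse_branch[of "wmap t y" c]
      by auto
  qed
  show ?thesis
  proof (intro equals0I)
    fix x assume "x \<in> Wint (a # u) \<inter> Wint (b # v)"
    then have "x \<in> {lo a..hi a}" "x \<in> {lo b..hi b}" "f a x \<in> {0<..<1}"
      using *[of x a u] *[of x b v] by blast+
    then show False using shared_point(1)[OF assms, of x] by auto
  qed
qed

lemma Wint_disjoint:
  assumes "a \<noteq> b"
  shows "Wint (p @ a # u) \<inter> Wint (p @ b # v) = {}"
proof -
  have "Wint (p @ t) = wmap p ` Wint t" for t
    unfolding Wint_image by (auto simp: wmap_append image_image)
  moreover have "inj_on (wmap p) {0<..<1}"
    using wmap_inj by (auto simp: inj_on_def)
  ultimately show ?thesis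
    using Wint_Cons_disjoint[OF assms, of u v] Wint_unit[of "a#u"] Wint_unit[of "b#v"]
    by (metis image_empty inj_on_image_Int)
qed

definition r :: "nat list \<Rightarrow> real" where
  "r w = \<bar>wmap w 1 - wmap w 0\<bar>"

lemma r_pos: "0 < r w"
  using wmap_inj[of 1 0 w] by (auto simp: r_def)

lemma r_Nil [simp]: "r [] = 1"
  by (simp add: r_def)

lemma W_dist: "x \<in> W w \<Longrightarrow> y \<in> W w \<Longrightarrow> \<bar>x - y\<bar> \<le> r w"
  unfolding W_segment r_def by (auto simp: closed_segment_eq_real_ivl split: if_splits)

lemma W_diameter: "bounded (W w)" "diameter (W w) = r w" "W w \<noteq> {}"
proof -
  have "W w = {min (wmap w 0) (wmap w 1)..max (wmap w 0) (wmap w 1)}"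
    by (auto simp: W_segment closed_segment_eq_real_ivl)
  then show "bounded (W w)" "diameter (W w) = r w" "W w \<noteq> {}"
    by (auto simp: r_def diameter_closed_interval)
qed

lemma measure_Wint: "emeasure lborel (Wint w) = ennreal (r w)" "Wint w \<in> sets borel"
  unfolding Wint_def r_def by (auto simp: open_segment_eq_real_ivl)

lemma inverse_branch_contract:
  assumes "x \<in> {0..1}" "y \<in> {0..1}"
  shows "\<xi> * \<bar>inverse_branch i x - inverse_branch i y\<bar> \<le> \<bar>x - y\<bar>"
proof -
  let ?p = "inverse_branch i x" and ?q = "inverse_branch i y"
  have pq: "?p \<in> {lo i..hi i}" "?q \<in> {lo i..hi i}"
    using assms inverse_branch_in by blast+
  obtain z where z: "z \<in> closed_segment ?p ?q" "\<bar>f i ?p - f i ?q\<bar> = \<bar>D i z\<bar> * \<bar>?p - ?q\<bar>"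
    using branch_mvt[OF pq] by blast
  have "z \<in> {lo i..hi i}"
    using z(1) pq by (auto simp: closed_segment_eq_real_ivl split: if_splits)
  then have "\<xi> * \<bar>?p - ?q\<bar> \<le> \<bar>D i z\<bar> * \<bar>?p - ?q\<bar>"
    by (intro mult_right_mono branch_deriv_ge) auto
  then show ?thesis using z(2) branch_inverse_branch assms by simp
qed

lemma wmap_contract:
  assumes "x \<in> {0..1}" "y \<in> {0..1}"
  shows "\<xi> ^ length w * \<bar>wmap w x - wmap w y\<bar> \<le> \<bar>x - y\<bar>"
proof (induction w)
  case (Cons i w)
  have "\<xi> ^ length (i # w) * \<bar>wmap (i # w) x - wmap (i # w) y\<bar>
      = \<xi> ^ length w * (\<xi> * \<bar>inverse_branch i (wmap w x) - inverse_branch i (wmap w y)\<bar>)"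
    by (simp add: mult_ac)
  also have "\<dots> \<le> \<xi> ^ length w * \<bar>wmap w x - wmap w y\<bar>"
    using \<xi>_gt_1 wmap_unit assms by (intro mult_left_mono inverse_branch_contract) auto
  also have "\<dots> \<le> \<bar>x - y\<bar>" by (rule Cons)
  finally show ?case .
qed simp

lemma r_append_le: "r (u @ v) \<le> r v" "r (u @ v) \<le> r u" "\<xi> ^ length u * r (u @ v) \<le> r v"
proof -
  have *: "wmap v 1 \<in> {0..1}" "wmap v 0 \<in> {0..1}" using wmap_unit by auto
  show c: "\<xi> ^ length u * r (u @ v) \<le> r v"
    using wmap_contract[OF *] by (simp add: r_def wmap_append)
  have "1 * r (u @ v) \<le> \<xi> ^ length u * r (u @ v)"
    using \<xi>_gt_1 r_pos[of "u @ v"] by (intro mult_right_mono) auto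
  then show "r (u @ v) \<le> r v" using c by simp
  have "wmap u (wmap v 1) \<in> W u" "wmap u (wmap v 0) \<in> W u"
    using * by (auto simp: W_eq_image)
  then show "r (u @ v) \<le> r u"
    using W_dist unfolding r_def[of "u @ v"] wmap_append by blast
qed

lemma r_le_power: "\<xi> ^ length w * r w \<le> 1"
  using r_append_le(3)[of w "[]"] by simp

lemma r_le_1: "r w \<le> 1"
  using r_append_le(1)[of w "[]"] by simp

lemma ln_r_le: "ln (r w) \<le> - (real (length w) * ln \<xi>)"
proof -
  have "ln (\<xi> ^ length w * r w) \<le> ln 1"
    using r_le_power[of w] r_pos[of w] \<xi>_gt_1 by (subst ln_le_cancel_iff) auto
  then show ?thesis
    using r_pos[of w] \<xi>_gt_1 by (simp add: ln_mult ln_realpow)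
qed

subsection \<open>The coding map\<close>

lemma W_prefix_mono: "m \<le> n \<Longrightarrow> W (prefix_of \<omega> n) \<subseteq> W (prefix_of \<omega> m)"
  using W_append_subset[of "prefix_of \<omega> m" "prefix_of (shift_code m \<omega>) (n - m)"] prefix_of_add[of \<omega> m "n - m"]
  by simp

text \<open>Existence is compactness of the nested cylinders, and uniqueness holds because their
  lengths are at most \<open>\<xi>\<close> to the power \<open>- n\<close>.\<close>

lemma coding_exists_unique: "\<exists>!x. \<forall>n. x \<in> W (prefix_of \<omega> n)"
proof -
  have "\<exists>x. x \<in> (\<Inter>n. W (prefix_of \<omega> n))"
  proof -
    have "(\<Inter>n. W (prefix_of \<omega> n)) \<noteq> {}"
      by (rule compact_nest)
        (auto simp: W_segment W_prefix_mono[unfolded W_segment])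
    then show ?thesis by blast
  qed
  moreover have "x = y" if "\<forall>n. x \<in> W (prefix_of \<omega> n)" "\<forall>n. y \<in> W (prefix_of \<omega> n)" for x y
  proof (rule ccontr)
    assume "x \<noteq> y"
    then obtain n where n: "1 / \<bar>x - y\<bar> < \<xi> ^ n"
      using real_arch_pow[OF \<xi>_gt_1] by blast
    have "\<bar>x - y\<bar> \<le> r (prefix_of \<omega> n)" using W_dist that by blast
    then have "\<xi> ^ n * \<bar>x - y\<bar> \<le> \<xi> ^ n * r (prefix_of \<omega> n)"
      using \<xi>_gt_1 by (intro mult_left_mono) auto
    also have "\<dots> \<le> 1" using r_le_power[of "prefix_of \<omega> n"] by simp
    finally show False using n \<open>x \<noteq> y\<close> by (simp add: field_simps)
  qed
  ultimately show ?thesis by blast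
qed

lemma cod_in_W: "cod \<omega> \<in> W (prefix_of \<omega> n)"
  and cod_eqI: "(\<And>n. x \<in> W (prefix_of \<omega> n)) \<Longrightarrow> cod \<omega> = x"
proof -
  have eq: "cod \<omega> = (THE x. \<forall>n. x \<in> W (prefix_of \<omega> n))"
    by (simp add: coding_def prefix_of_def)
  show "cod \<omega> \<in> W (prefix_of \<omega> n)"
    unfolding eq using theI'[OF coding_exists_unique, of \<omega>] by blast
  show "cod \<omega> = x" if "\<And>n. x \<in> W (prefix_of \<omega> n)"
    unfolding eq using coding_exists_unique[of \<omega>] that by (intro the1_equality) auto
qed

lemma cod_unit: "cod \<omega> \<in> {0..1}"
  using cod_in_W[of \<omega> 0] by simp

lemma cod_branch: "cod \<omega> \<in> {lo (\<omega> 0)..hi (\<omega> 0)}" "f (\<omega> 0) (cod \<omega>) = cod (shift_code 1 \<omega>)"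
proof -
  have "cod \<omega> \<in> W (\<omega> 0 # prefix_of (shift_code 1 \<omega>) n)" for n
    using cod_in_W[of \<omega> "Suc n"] by (simp add: prefix_of_Suc)
  then have *: "cod \<omega> \<in> {lo (\<omega> 0)..hi (\<omega> 0)}" "\<And>n. f (\<omega> 0) (cod \<omega>) \<in> W (prefix_of (shift_code 1 \<omega>) n)"
    by (auto simp: W_Cons)
  show "cod \<omega> \<in> {lo (\<omega> 0)..hi (\<omega> 0)}" "f (\<omega> 0) (cod \<omega>) = cod (shift_code 1 \<omega>)"
    using * by (auto intro: cod_eqI[symmetric])
qed

lemma cod_wmap: "cod \<omega> = wmap (prefix_of \<omega> n) (cod (shift_code n \<omega>))"
proof (induction n arbitrary: \<omega>)
  case (Suc n)
  have "cod \<omega> = inverse_branch (\<omega> 0) (cod (shift_code 1 \<omega>))"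
    using cod_branch[of \<omega>] inverse_branch_branch by metis
  then show ?case using Suc[of "shift_code 1 \<omega>"] by (simp add: prefix_of_Suc)
qed simp

lemma cod_in_limit_set [simp]: "cod \<omega> \<in> \<Lambda>"
  by (simp add: limit_set_def)

definition end_codes :: "(nat \<Rightarrow> nat) set" where
  "end_codes = {\<omega>. cod \<omega> \<in> {0, 1}}"

lemma end_codes_shift: "\<omega> \<in> end_codes \<Longrightarrow> shift_code n \<omega> \<in> end_codes"
proof (induction n)
  case (Suc n)
  then have "cod (shift_code n \<omega>) \<in> {0, 1}" unfolding end_codes_def by blast
  then have "f (shift_code n \<omega> 0) (cod (shift_code n \<omega>)) \<in> {0, 1}"
    using unit_endpoint_maps cod_branch(1) by blast
  then show ?case using cod_branch(2)[of "shift_code n \<omega>"] by (simp add: end_codes_def)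
qed simp

text \<open>The codes of the points whose itinerary is unambiguous.\<close>

definition reg :: "(nat \<Rightarrow> nat) set" where
  "reg = {\<omega>. \<omega> \<in> end_codes \<or> (\<forall>n. shift_code n \<omega> \<notin> end_codes)}"

lemma reg_shift: "\<omega> \<in> reg \<Longrightarrow> shift_code n \<omega> \<in> reg"
  by (auto simp: reg_def end_codes_shift)

lemma end_codes_reg: "end_codes \<subseteq> reg"
  by (auto simp: reg_def)

text \<open>A second branch interval through the point would make it a shared point: not in
  \<open>{0, 1}\<close>, yet mapped into \<open>{0, 1}\<close>. Both alternatives in
  \<open>reg\<close> forbid this, so the points 0 and 1 themselves may be kept among the regular
  ones.\<close>

lemma reg_first:
  assumes "\<omega> \<in> reg" "cod \<omega> \<in> {lo b..hi b}"
  shows "b = \<omega> 0"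
proof (rule ccontr)
  assume "b \<noteq> \<omega> 0"
  then have *: "f (\<omega> 0) (cod \<omega>) \<in> {0, 1}" "cod \<omega> \<notin> {0, 1}"
    using shared_point[of "\<omega> 0" b "cod \<omega>"] cod_branch(1) assms(2) by auto
  then have "shift_code 1 \<omega> \<in> end_codes" "\<omega> \<notin> end_codes"
    using cod_branch(2)[of \<omega>] by (auto simp: end_codes_def)
  then show False using assms(1) by (auto simp: reg_def)
qed

text \<open>For regular codes the geometry of closed cylinders becomes combinatorics of prefixes;
  uniqueness of the code, the action of \<open>T\<close> and measurability all rest on this.\<close>

lemma reg_in_W_iff:
  assumes "\<omega> \<in> reg"
  shows "cod \<omega> \<in> W w \<longleftrightarrow> prefix_of \<omega> (length w) = w"
proof
  show "cod \<omega> \<in> W w" if "prefix_of \<omega> (length w) = w"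
    using cod_in_W[of \<omega> "length w"] that by simp
  show "cod \<omega> \<in> W w \<Longrightarrow> prefix_of \<omega> (length w) = w"
    using assms
  proof (induction w arbitrary: \<omega>)
    case (Cons b w)
    then have *: "cod \<omega> \<in> {lo b..hi b}" "f b (cod \<omega>) \<in> W w" by (auto simp: W_Cons)
    then have b: "b = \<omega> 0" using reg_first Cons.prems by blast
    then have "cod (shift_code 1 \<omega>) \<in> W w" using * cod_branch(2)[of \<omega>] by simp
    then have "prefix_of (shift_code 1 \<omega>) (length w) = w" using Cons reg_shift by blast
    then show ?case using b by (simp add: prefix_of_Suc)
  qed simp
qed

lemma reg_unique:
  assumes "\<omega> \<in> reg" "cod \<tau> = cod \<omega>"
  shows "\<tau> = \<omega>"
proof
  fix k
  have "prefix_of \<omega> (Suc k) = prefix_of \<tau> (Suc k)"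
    using reg_in_W_iff[OF assms(1), of "prefix_of \<tau> (Suc k)"] cod_in_W[of \<tau> "Suc k"] assms(2) by simp
  then show "\<tau> k = \<omega> k" by (simp add: prefix_of_eq_iff)
qed

lemma reg_first_symbol: "\<omega> \<in> reg \<Longrightarrow> first_symbol I f (cod \<omega>) = \<omega> 0"
proof -
  assume w: "\<omega> \<in> reg"
  have "cod \<omega> \<in> cod ` {\<tau>. \<tau> 0 = j} \<longleftrightarrow> j = \<omega> 0" for j
    using reg_unique[OF w] by (auto simp: image_iff)
  then show ?thesis unfolding first_symbol_def by (simp add: Least_equality)
qed

lemma reg_T: "\<omega> \<in> reg \<Longrightarrow> T (cod \<omega>) = cod (shift_code 1 \<omega>)"
  using reg_first_symbol[of \<omega>] cod_branch(2)[of \<omega>] by (simp add: branch_map_def)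

lemma reg_T_pow: "\<omega> \<in> reg \<Longrightarrow> (T ^^ n) (cod \<omega>) = cod (shift_code n \<omega>)"
proof (induction n)
  case (Suc n)
  then show ?case using reg_T[OF reg_shift[of \<omega> n]] by simp
qed simp

lemma reg_not_multiply_coded: "\<omega> \<in> reg \<Longrightarrow> cod \<omega> \<notin> multiply_coded I f"
  unfolding multiply_coded_def using reg_unique by blast

lemma reg_in_basic_iff:
  "\<omega> \<in> reg \<Longrightarrow> cod \<omega> \<in> basic_interval I f w \<longleftrightarrow> prefix_of \<omega> (length w) = w"
  unfolding basic_interval_def using reg_in_W_iff reg_not_multiply_coded by blast

text \<open>Regular codes are determined by their points, so 0 and 1 have at most one code
  each.\<close>

lemma countable_end_codes: "countable end_codes"
proof -
  have "inj_on cod end_codes" using reg_unique end_codes_reg by (auto simp: inj_on_def)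
  moreover have "countable (cod ` end_codes)"
    by (rule countable_subset[of _ "{0,1}"]) (auto simp: end_codes_def)
  ultimately show ?thesis by (rule countable_image_inj_on[rotated])
qed

text \<open>An irregular code is a finite word followed by an end code, and \<open>F\<close> glues
  these two pieces together again.\<close>

lemma countable_not_reg: "countable (- reg)"
proof -
  define F where "F = (\<lambda>(w::nat list, \<tau>::nat \<Rightarrow> nat) k. if k < length w then w ! k else \<tau> (k - length w))"
  have "- reg \<subseteq> F ` (UNIV \<times> end_codes)"
  proof
    fix \<omega> assume "\<omega> \<in> - reg"
    then obtain n where n: "shift_code n \<omega> \<in> end_codes" by (auto simp: reg_def)
    have "\<omega> = F (prefix_of \<omega> n, shift_code n \<omega>)"
      by (auto simp: F_def fun_eq_iff shift_code_apply)
    then show "\<omega> \<in> F ` (UNIV \<times> end_codes)" using n by blast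
  qed
  then show ?thesis
    by (rule countable_subset) (auto intro: countable_end_codes)
qed

lemma multiply_coded_subset: "multiply_coded I f \<subseteq> cod ` (- reg)"
  using reg_not_multiply_coded by (auto simp: multiply_coded_def limit_set_def)

lemma countable_multiply_coded: "countable (multiply_coded I f)"
  using multiply_coded_subset countable_not_reg by (meson countable_image countable_subset)

text \<open>The code that \<open>T\<close> itself selects by always taking the smallest possible
  first symbol. It exists at ambiguous points too, where it need not be regular.\<close>

definition itinerary :: "real \<Rightarrow> nat \<Rightarrow> nat" where
  "itinerary x n = first_symbol I f ((T ^^ n) x)"

lemma first_symbol_code:
  assumes "x \<in> \<Lambda>"
  shows "\<exists>\<omega>. cod \<omega> = x \<and> \<omega> 0 = first_symbol I f x \<and> T x = cod (shift_code 1 \<omega>)"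
proof -
  have "\<exists>j. x \<in> cod ` {\<omega>. \<omega> 0 = j}" using assms by (auto simp: limit_set_def)
  then have "x \<in> cod ` {\<omega>. \<omega> 0 = first_symbol I f x}"
    unfolding first_symbol_def by (rule LeastI_ex)
  then obtain \<omega> where "cod \<omega> = x" "\<omega> 0 = first_symbol I f x" by auto
  moreover from this have "T x = cod (shift_code 1 \<omega>)"
    using cod_branch(2)[of \<omega>] by (simp add: branch_map_def)
  ultimately show ?thesis by blast
qed

lemma T_limit_set: "x \<in> \<Lambda> \<Longrightarrow> T x \<in> \<Lambda>"
  using first_symbol_code by (metis cod_in_limit_set)

lemma T_pow_limit_set: "x \<in> \<Lambda> \<Longrightarrow> (T ^^ n) x \<in> \<Lambda>"
  by (induction n) (auto simp: T_limit_set)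

text \<open>At each time the smallest symbol may come from a different code of the current point, so
  no single code can be followed. Being admissible for one step is enough, since membership in
  cylinders is checked letter by letter.\<close>

lemma cod_itinerary:
  assumes "x \<in> \<Lambda>"
  shows "cod (itinerary x) = x"
proof -
  have "x \<in> W (prefix_of (itinerary x) n)" for n
    using assms
  proof (induction n arbitrary: x)
    case 0
    then show ?case using cod_unit by (auto simp: limit_set_def)
  next
    case (Suc n)
    obtain \<omega> where w: "cod \<omega> = x" "\<omega> 0 = first_symbol I f x" "T x = cod (shift_code 1 \<omega>)"
      using first_symbol_code Suc.prems by blast
    have "shift_code 1 (itinerary x) = itinerary (T x)"
      by (auto simp: fun_eq_iff itinerary_def funpow_swap1 shift_code_apply)
    then have "T x \<in> W (prefix_of (shift_code 1 (itinerary x)) n)"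
      using Suc T_limit_set by simp
    moreover have "x \<in> {lo (itinerary x 0)..hi (itinerary x 0)}" "f (itinerary x 0) x = T x"
      using cod_branch[of \<omega>] w by (auto simp: itinerary_def)
    ultimately show ?case by (simp add: prefix_of_Suc W_Cons)
  qed
  then show ?thesis by (rule cod_eqI)
qed

lemma shift_code_itinerary: "shift_code n (itinerary x) = itinerary ((T ^^ n) x)"
  by (auto simp: fun_eq_iff itinerary_def funpow_add shift_code_apply add.commute[of n])

lemma itinerary_cod: "\<omega> \<in> reg \<Longrightarrow> itinerary (cod \<omega>) = \<omega>"
  using reg_unique cod_itinerary by simp

text \<open>If a code is irregular, one of its shifts is an end code, and end codes are
  regular.\<close>

lemma eventually_reg: "\<exists>m. shift_code m \<omega> \<in> reg"
proof (cases "\<omega> \<in> reg")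
  case True
  then show ?thesis by (intro exI[of _ 0]) simp
next
  case False
  then show ?thesis using end_codes_reg by (auto simp: reg_def)
qed

subsection \<open>Distortion\<close>

text \<open>The logarithmic distortion accumulated over a word; it may be unbounded in the length of
  the word, but it grows sublinearly.\<close>

abbreviation V :: "nat \<Rightarrow> real" where
  "V \<equiv> cum_modulus (basic_interval I f) (\<lambda>w x. ln \<bar>D (hd w) x\<bar>)"

lemma W_hd: "w \<noteq> [] \<Longrightarrow> W w \<subseteq> W [hd w]"
  using W_append_subset[of "[hd w]" "tl w"] by simp

lemma V_sublinear: "0 < \<delta> \<Longrightarrow> \<exists>K\<ge>0. \<forall>n. V n \<le> K + \<delta> * real n"
  using log_deriv W_hd by (intro cum_modulus_sublinear)
    (auto simp: log_deriv_variations_vanish_def basic_interval_def)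

lemma V_nonneg: "0 \<le> V n"
  by (rule cum_modulus_nonneg)

text \<open>The assumption compares derivatives only off the multiply coded points, while mean value
  points and ends of cylinders may be multiply coded. Continuity of the derivative on the closed
  cylinder fills the gap.\<close>

lemma log_deriv_modulus:
  assumes w: "w \<noteq> []" and xy: "x \<in> W w" "y \<in> W w"
  shows "\<bar>ln \<bar>D (hd w) x\<bar> - ln \<bar>D (hd w) y\<bar>\<bar>
    \<le> modulus (basic_interval I f) (\<lambda>w x. ln \<bar>D (hd w) x\<bar>) (length w)" (is "_ \<le> ?m")
proof -
  let ?B = "basic_interval I f w" and ?g = "\<lambda>x. ln \<bar>D (hd w) x\<bar>"
  have bound: "\<bar>?g x - ?g y\<bar> \<le> ?m" if "x \<in> ?B" "y \<in> ?B" for x y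
    using modulus_bound[of "basic_interval I f" "\<lambda>w x. ln \<bar>D (hd w) x\<bar>" w x y]
      log_deriv W_hd that w
    by (auto simp: log_deriv_variations_vanish_def basic_interval_def)
  obtain a b where ab: "W w = {a..b}" "a < b"
    using W_segment[of w] r_pos[of w] by (auto simp: closed_segment_eq_real_ivl r_def split: if_splits)
  have clB: "closure ?B = W w"
  proof
    show "closure ?B \<subseteq> W w"
      by (rule closure_minimal) (auto simp: basic_interval_def ab)
    show "W w \<subseteq> closure ?B"
      unfolding closure_approachable basic_interval_def ab(1)
      using countable_complement_dense_Icc[OF ab(2) countable_multiply_coded]
      by (auto simp: dist_real_def closure_approachable)
  qed
  have sub: "W w \<subseteq> {lo (hd w)..hi (hd w)}"
    using W_hd[OF w] by (auto simp: W_Cons)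
  have cont: "continuous_on (W w) ?g"
    using branch_deriv_cont[of "hd w"] branch_deriv_pos sub
    by (intro continuous_intros continuous_on_subset[OF branch_deriv_cont]) force+
  have c1: "continuous_on (closure ?B) (\<lambda>u. \<bar>?g u - ?g v\<bar>)" for v
    unfolding clB by (intro continuous_on_rabs continuous_on_diff cont continuous_on_const)
  have c2: "continuous_on (closure ?B) (\<lambda>v. \<bar>?g x - ?g v\<bar>)"
    unfolding clB by (intro continuous_on_rabs continuous_on_diff cont continuous_on_const)
  have xy': "x \<in> closure ?B" "y \<in> closure ?B" using xy clB by simp_all
  \<comment> \<open>The bound is extended to the closure in one variable at a time.\<close>
  have "\<bar>?g x - ?g v\<bar> \<le> ?m" if "v \<in> ?B" for v
    using continuous_le_on_closure[OF c1 xy'(1)] bound[OF _ that] by blast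
  then show ?thesis
    using continuous_le_on_closure[OF c2 xy'(2)] by blast
qed

text \<open>This is the logarithm of the absolute derivative of the branch composition along
  \<open>w\<close>, taken at \<open>wmap w z\<close>. It uses the letters of the word rather than
  \<open>T\<close>, so \<open>z\<close> may be any point of the unit interval.\<close>

primrec log_deriv_sum :: "nat list \<Rightarrow> real \<Rightarrow> real" where
  "log_deriv_sum [] z = 0"
| "log_deriv_sum (i # w) z = ln \<bar>D i (wmap (i # w) z)\<bar> + log_deriv_sum w z"

text \<open>One application of the mean value theorem per letter. The mean value point and the image
  of \<open>z\<close> lie in the same cylinder of the remaining word, so replacing one by the other
  costs the modulus at its length; the costs add up to \<open>V\<close>.\<close>

lemma distortion:
  assumes "x \<in> {0..1}" "y \<in> {0..1}" "x \<noteq> y" "z \<in> {0..1}"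
  shows "\<bar>ln \<bar>wmap w x - wmap w y\<bar> - ln \<bar>x - y\<bar> + log_deriv_sum w z\<bar> \<le> V (length w)"
proof (induction w)
  case (Cons i w)
  let ?p = "wmap w x" and ?q = "wmap w y"
  let ?gp = "inverse_branch i ?p" and ?gq = "inverse_branch i ?q"
  have un: "?p \<in> {0..1}" "?q \<in> {0..1}" using assms wmap_unit by auto
  have ne: "?p \<noteq> ?q" using wmap_inj assms by blast
  have gin: "?gp \<in> {lo i..hi i}" "?gq \<in> {lo i..hi i}" using un inverse_branch_in by blast+
  have gne: "?gp \<noteq> ?gq" using wmap_inj[of x y "i # w"] assms by auto
  obtain c where c: "c \<in> closed_segment ?gp ?gq" "\<bar>f i ?gp - f i ?gq\<bar> = \<bar>D i c\<bar> * \<bar>?gp - ?gq\<bar>"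
    using branch_mvt[OF gin] by blast
  have gW: "?gp \<in> W (i # w)" "?gq \<in> W (i # w)" "wmap (i # w) z \<in> W (i # w)"
    using assms by (auto simp: W_eq_image)
  have cW: "c \<in> W (i # w)"
    using c(1) gW unfolding W_segment
    by (meson closed_segment_subset convex_closed_segment subsetD)
  have cpos: "0 < \<bar>D i c\<bar>"
    using cW branch_deriv_pos[of c i] by (auto simp: W_Cons)
  have "\<bar>?p - ?q\<bar> = \<bar>D i c\<bar> * \<bar>?gp - ?gq\<bar>"
    using c(2) branch_inverse_branch un by simp
  then have "ln \<bar>?p - ?q\<bar> = ln \<bar>D i c\<bar> + ln \<bar>?gp - ?gq\<bar>"
    using cpos gne by (simp add: ln_mult)
  moreover have "\<bar>ln \<bar>D i c\<bar> - ln \<bar>D i (wmap (i # w) z)\<bar>\<bar>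
      \<le> modulus (basic_interval I f) (\<lambda>w x. ln \<bar>D (hd w) x\<bar>) (Suc (length w))"
    using log_deriv_modulus[of "i # w" c "wmap (i # w) z"] cW gW by simp
  ultimately show ?case
    using Cons by (simp add: cum_modulus_Suc abs_le_iff)
qed simp

lemma ln_r_log_deriv_sum: "z \<in> {0..1} \<Longrightarrow> \<bar>ln (r w) + log_deriv_sum w z\<bar> \<le> V (length w)"
  using distortion[of 1 0 z w] by (simp add: r_def)

text \<open>The factor \<open>exp (- 2 * V)\<close> absorbs the distortion, so that the cylinder of a concatenation is at
  least as long as the product of the weights of its parts.\<close>

definition weight :: "nat list \<Rightarrow> real" where
  "weight w = r w * exp (- 2 * V (length w))"

lemma weight_pos: "0 < weight w"
  by (simp add: weight_def r_pos)

text \<open>Distortion is applied to the ends of \<open>W v\<close> and to the ends of the unit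
  interval with the same reference point 0. The derivative sums cancel and two errors
  \<open>V\<close> remain, which is the origin of the factor 2 in \<open>weight\<close>.\<close>

lemma r_append_ge: "weight u * r v \<le> r (u @ v)"
proof -
  have "\<bar>ln (r (u @ v)) - ln (r v) + log_deriv_sum u 0\<bar> \<le> V (length u)"
    using distortion[of "wmap v 1" "wmap v 0" 0 u] wmap_unit[of 1 v] wmap_unit[of 0 v] wmap_inj[of 1 0 v]
    by (auto simp: r_def wmap_append)
  moreover have "\<bar>ln (r u) + log_deriv_sum u 0\<bar> \<le> V (length u)"
    by (rule ln_r_log_deriv_sum) simp
  ultimately have "ln (r u) - 2 * V (length u) + ln (r v) \<le> ln (r (u @ v))"
    by linarith
  moreover have "ln (weight u * r v) = ln (r u) - 2 * V (length u) + ln (r v)"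
    using r_pos[of u] r_pos[of v] by (simp add: weight_def ln_mult)
  ultimately show ?thesis
    using r_pos[of v] r_pos[of "u @ v"] weight_pos[of u] by (simp flip: ln_le_cancel_iff)
qed

lemma r_concat_ge: "(\<Prod>w\<leftarrow>ws. weight w) \<le> r (concat ws)"
proof (induction ws)
  case (Cons w ws)
  have "weight w * (\<Prod>w\<leftarrow>ws. weight w) \<le> weight w * r (concat ws)"
    using Cons weight_pos[of w] by (intro mult_left_mono) auto
  also have "\<dots> \<le> r (w @ concat ws)" by (rule r_append_ge)
  finally show ?case by simp
qed simp

end

lemma cum_modulus_mono: "m \<le> n \<Longrightarrow> cum_modulus A \<psi> m \<le> cum_modulus A \<psi> n"
  unfolding cum_modulus_def by (intro sum_mono2) (auto simp: modulus_nonneg)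

text \<open>Averaging over one period is unaffected by a shift; this yields invariance in
  \<open>average_measure\<close>.\<close>

lemma sum_cyclic_shift:
  fixes g :: "nat \<Rightarrow> 'a::comm_monoid_add"
  assumes "g n = g 0"
  shows "(\<Sum>j<n. g (1 + j)) = (\<Sum>j<n. g j)"
proof (cases n)
  case (Suc k)
  have "(\<Sum>j<Suc k. g j) = g 0 + (\<Sum>j<k. g (Suc j))" by (rule sum.lessThan_Suc_shift)
  then show ?thesis using Suc assms by (simp add: add.commute)
qed simp

context expanding_system
begin

subsection \<open>Birkhoff sums along codes\<close>

abbreviation pot_osc :: "(real \<Rightarrow> real) \<Rightarrow> nat \<Rightarrow> real" where
  "pot_osc \<phi> \<equiv> cum_modulus (\<lambda>w. basic_interval I f w \<inter> \<Lambda>) (\<lambda>w. \<phi>)"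

text \<open>Sums are taken along codes, since those split exactly at the boundaries of concatenated
  words; along an itinerary this is the Birkhoff sum of \<open>T\<close>.\<close>

definition birkhoff_sum :: "(real \<Rightarrow> real) \<Rightarrow> nat \<Rightarrow> (nat \<Rightarrow> nat) \<Rightarrow> real" where
  "birkhoff_sum \<phi> n \<omega> = (\<Sum>j<n. \<phi> (cod (shift_code j \<omega>)))"

lemma birkhoff_sum_0 [simp]: "birkhoff_sum \<phi> 0 \<omega> = 0"
  by (simp add: birkhoff_sum_def)

lemma birkhoff_sum_add: "birkhoff_sum \<phi> (m + n) \<omega> = birkhoff_sum \<phi> m \<omega> + birkhoff_sum \<phi> n (shift_code m \<omega>)"
  by (induction n) (auto simp: birkhoff_sum_def)

lemma birkhoff_sum_Suc: "birkhoff_sum \<phi> (Suc n) \<omega> = \<phi> (cod \<omega>) + birkhoff_sum \<phi> n (shift_code 1 \<omega>)"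
  using birkhoff_sum_add[of \<phi> 1 n \<omega>] by (simp add: birkhoff_sum_def)

lemma cod_shift_code_itinerary: "x \<in> \<Lambda> \<Longrightarrow> cod (shift_code j (itinerary x)) = (T ^^ j) x"
  by (simp add: shift_code_itinerary cod_itinerary T_pow_limit_set)

lemma birkhoff_sum_itinerary: "x \<in> \<Lambda> \<Longrightarrow> birkhoff_sum \<phi> n (itinerary x) = (\<Sum>j<n. \<phi> ((T ^^ j) x))"
  by (simp add: birkhoff_sum_def cod_shift_code_itinerary)

lemma basic_hd: "w \<noteq> [] \<Longrightarrow> basic_interval I f w \<inter> \<Lambda> \<subseteq> basic_interval I f [hd w] \<inter> \<Lambda>"
  using W_hd by (auto simp: basic_interval_def)

lemma pot_osc_sublinear:
  "potential_variations_vanish I f \<phi> \<Longrightarrow> 0 < \<delta> \<Longrightarrow> \<exists>K\<ge>0. \<forall>n. pot_osc \<phi> n \<le> K + \<delta> * real n"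
  using basic_hd by (intro cum_modulus_sublinear) (auto simp: potential_variations_vanish_def)

lemma potential_close:
  assumes "potential_variations_vanish I f \<phi>" "\<omega> \<in> reg" "\<tau> \<in> reg"
    and "prefix_of \<omega> n = prefix_of \<tau> n" "n \<noteq> 0"
  shows "\<bar>\<phi> (cod \<omega>) - \<phi> (cod \<tau>)\<bar>
    \<le> modulus (\<lambda>w. basic_interval I f w \<inter> \<Lambda>) (\<lambda>w. \<phi>) n"
proof -
  let ?A = "\<lambda>w. basic_interval I f w \<inter> \<Lambda>"
  have "cod \<omega> \<in> ?A (prefix_of \<omega> n)" "cod \<tau> \<in> ?A (prefix_of \<omega> n)"
    using assms reg_in_basic_iff by auto
  moreover have "prefix_of \<omega> n \<noteq> []" using assms(5) by (metis length_prefix_of list.size(3))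
  ultimately show ?thesis
    using modulus_bound[of ?A "\<lambda>w. \<phi>" "prefix_of \<omega> n" "cod \<omega>" "cod \<tau>"] basic_hd assms(1)
    by (auto simp: potential_variations_vanish_def)
qed

lemma birkhoff_sum_close:
  assumes "potential_variations_vanish I f \<phi>" "\<omega> \<in> reg" "\<tau> \<in> reg"
    and "prefix_of \<omega> n = prefix_of \<tau> n"
  shows "\<bar>birkhoff_sum \<phi> n \<omega> - birkhoff_sum \<phi> n \<tau>\<bar> \<le> pot_osc \<phi> n"
  using assms(2-)
proof (induction n arbitrary: \<omega> \<tau>)
  case (Suc n)
  have "prefix_of (shift_code 1 \<omega>) n = prefix_of (shift_code 1 \<tau>) n"
    using Suc.prems(3) by (simp add: prefix_of_Suc)
  then have "\<bar>birkhoff_sum \<phi> n (shift_code 1 \<omega>) - birkhoff_sum \<phi> n (shift_code 1 \<tau>)\<bar> \<le> pot_osc \<phi> n"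
    using Suc reg_shift by blast
  moreover have "\<bar>\<phi> (cod \<omega>) - \<phi> (cod \<tau>)\<bar>
    \<le> modulus (\<lambda>w. basic_interval I f w \<inter> \<Lambda>) (\<lambda>w. \<phi>) (Suc n)"
    using potential_close[OF assms(1) Suc.prems] by simp
  ultimately show ?case by (simp add: birkhoff_sum_Suc cum_modulus_Suc)
qed simp

definition periodic_code :: "nat list \<Rightarrow> nat \<Rightarrow> nat" where
  "periodic_code w k = w ! (k mod length w)"

lemma prefix_periodic_code: "w \<noteq> [] \<Longrightarrow> prefix_of (periodic_code w) (length w) = w"
  by (rule nth_equalityI) (auto simp: periodic_code_def)

lemma shift_periodic_code: "shift_code (m * length w) (periodic_code w) = periodic_code w"
  by (auto simp: fun_eq_iff shift_code_apply periodic_code_def add.commute)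

text \<open>If some shift were an end code, so would be the later shift by a multiple of the period,
  which is the code itself. Every nonempty word thus has a canonical regular sample point.\<close>

lemma periodic_code_reg: "w \<noteq> [] \<Longrightarrow> periodic_code w \<in> reg"
proof -
  assume w: "w \<noteq> []"
  have "periodic_code w \<in> end_codes" if "shift_code n (periodic_code w) \<in> end_codes" for n
  proof -
    have "n \<le> n * length w" using w by (cases w) auto
    then have "shift_code (n * length w) (periodic_code w) \<in> end_codes"
      using end_codes_shift[OF that, of "n * length w - n"] by simp
    then show ?thesis by (simp add: shift_periodic_code)
  qed
  then show ?thesis by (auto simp: reg_def)
qed

text \<open>A potential may be unbounded over the infinite alphabet, but on a first level cylinder
  it stays within its first variation of the value at the point coded by a constant
  sequence.\<close>

definition letter_bound :: "(real \<Rightarrow> real) \<Rightarrow> nat \<Rightarrow> real" where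
  "letter_bound \<phi> a = \<bar>\<phi> (cod (periodic_code [a]))\<bar> + pot_osc \<phi> 1"

lemma letter_bound:
  assumes "potential_variations_vanish I f \<phi>" "\<omega> \<in> reg"
  shows "\<bar>\<phi> (cod \<omega>)\<bar> \<le> letter_bound \<phi> (\<omega> 0)"
proof -
  have "prefix_of \<omega> 1 = prefix_of (periodic_code [\<omega> 0]) 1"
    by (simp add: prefix_of_def periodic_code_def)
  then have "\<bar>\<phi> (cod \<omega>) - \<phi> (cod (periodic_code [\<omega> 0]))\<bar> \<le> pot_osc \<phi> 1"
    using potential_close[OF assms periodic_code_reg[of "[\<omega> 0]"], of 1] by (simp add: cum_modulus_def)
  then show ?thesis by (simp add: letter_bound_def)
qed

lemma letter_bound_nonneg: "0 \<le> letter_bound \<phi> a"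
  by (simp add: letter_bound_def cum_modulus_nonneg)

lemma birkhoff_sum_letter_bound:
  assumes "potential_variations_vanish I f \<phi>" "\<omega> \<in> reg"
  shows "\<bar>birkhoff_sum \<phi> n \<omega>\<bar> \<le> (\<Sum>a\<leftarrow>prefix_of \<omega> n. letter_bound \<phi> a)"
  using assms(2)
proof (induction n arbitrary: \<omega>)
  case (Suc n)
  show ?case
    using Suc.IH[OF reg_shift[OF Suc.prems, of 1]] letter_bound[OF assms(1) Suc.prems]
    by (simp add: birkhoff_sum_Suc prefix_of_Suc)
qed simp

text \<open>An ambiguous point cannot be compared through variations, which ignore multiply coded
  points. Its itinerary becomes regular after some time \<open>m\<close>; the first \<open>m\<close>
  terms cost a constant depending on the point only, and the rest is covered by
  \<open>birkhoff_sum_close\<close>.\<close>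

lemma birkhoff_sum_itinerary_close:
  assumes "potential_variations_vanish I f \<phi>" "x \<in> \<Lambda>"
  shows "\<exists>C. \<forall>n. \<forall>\<tau>\<in>reg. prefix_of \<tau> n = prefix_of (itinerary x) n \<longrightarrow>
    \<bar>birkhoff_sum \<phi> n \<tau> - birkhoff_sum \<phi> n (itinerary x)\<bar> \<le> C + pot_osc \<phi> n"
proof -
  define \<omega> where "\<omega> = itinerary x"
  obtain m where m: "shift_code m \<omega> \<in> reg" using eventually_reg by blast
  \<comment> \<open>Until time \<open>m\<close> the competing code has the same letters, so the
    letter bounds control its terms, and the terms along the orbit of \<open>x\<close> are simply
    added.\<close>
  define C where "C = (\<Sum>j<m. letter_bound \<phi> (\<omega> j) + \<bar>\<phi> (cod (shift_code j \<omega>))\<bar>)"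
  have head: "\<bar>birkhoff_sum \<phi> k \<tau> - birkhoff_sum \<phi> k \<omega>\<bar> \<le> C"
    if "k \<le> m" "\<tau> \<in> reg" "prefix_of \<tau> k = prefix_of \<omega> k" for k \<tau>
  proof -
    have "\<bar>birkhoff_sum \<phi> k \<tau> - birkhoff_sum \<phi> k \<omega>\<bar> \<le> (\<Sum>j<k. \<bar>\<phi> (cod (shift_code j \<tau>)) - \<phi> (cod (shift_code j \<omega>))\<bar>)"
      unfolding birkhoff_sum_def sum_subtractf[symmetric] by (rule sum_abs)
    also have "\<dots> \<le> (\<Sum>j<k. letter_bound \<phi> (\<omega> j) + \<bar>\<phi> (cod (shift_code j \<omega>))\<bar>)"
    proof (rule sum_mono)
      fix j assume j: "j \<in> {..<k}"
      have "\<bar>\<phi> (cod (shift_code j \<tau>))\<bar> \<le> letter_bound \<phi> (\<tau> j)"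
        using letter_bound[OF assms(1) reg_shift[OF that(2), of j]] by (simp add: shift_code_apply)
      moreover have "\<tau> j = \<omega> j" using that(3) j by (simp add: prefix_of_eq_iff)
      ultimately show "\<bar>\<phi> (cod (shift_code j \<tau>)) - \<phi> (cod (shift_code j \<omega>))\<bar>
          \<le> letter_bound \<phi> (\<omega> j) + \<bar>\<phi> (cod (shift_code j \<omega>))\<bar>"
        by simp
    qed
    also have "\<dots> \<le> C" unfolding C_def
      using that(1) by (intro sum_mono2) (auto intro!: add_nonneg_nonneg letter_bound_nonneg)
    finally show ?thesis .
  qed
  have "\<bar>birkhoff_sum \<phi> n \<tau> - birkhoff_sum \<phi> n \<omega>\<bar> \<le> C + pot_osc \<phi> n"
    if t: "\<tau> \<in> reg" "prefix_of \<tau> n = prefix_of \<omega> n" for n \<tau>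
  proof (cases "n \<le> m")
    case True
    then show ?thesis using head[OF True t] cum_modulus_nonneg[of _ _ n] by (smt (verit))
  next
    case False
    then have n: "n = m + (n - m)" by simp
    have p: "prefix_of \<tau> m = prefix_of \<omega> m" "prefix_of (shift_code m \<tau>) (n - m) = prefix_of (shift_code m \<omega>) (n - m)"
      using t(2) by (subst (asm) (1 2) n, simp add: prefix_of_add)+
    have "\<bar>birkhoff_sum \<phi> m \<tau> - birkhoff_sum \<phi> m \<omega>\<bar> \<le> C" using head t(1) p(1) by blast
    moreover have "\<bar>birkhoff_sum \<phi> (n - m) (shift_code m \<tau>) - birkhoff_sum \<phi> (n - m) (shift_code m \<omega>)\<bar> \<le> pot_osc \<phi> (n - m)"
      using birkhoff_sum_close[OF assms(1) reg_shift[OF t(1)] m p(2)] .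
    moreover have "pot_osc \<phi> (n - m) \<le> pot_osc \<phi> n" by (rule cum_modulus_mono) simp
    moreover have "birkhoff_sum \<phi> n \<sigma> = birkhoff_sum \<phi> m \<sigma> + birkhoff_sum \<phi> (n - m) (shift_code m \<sigma>)" for \<sigma>
      using birkhoff_sum_add[of \<phi> m "n - m" \<sigma>] n by simp
    ultimately show ?thesis by (simp add: abs_le_iff)
  qed
  then show ?thesis unfolding \<omega>_def by blast
qed

definition log_expansion :: "real \<Rightarrow> real" where
  "log_expansion x = ln \<bar>branch_map_deriv I f x\<bar>"

lemma log_expansion_reg: "\<omega> \<in> reg \<Longrightarrow> log_expansion (cod \<omega>) = ln \<bar>D (\<omega> 0) (cod \<omega>)\<bar>"
  by (simp add: log_expansion_def branch_map_deriv_def reg_first_symbol)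

lemma log_expansion_ge: "x \<in> \<Lambda> \<Longrightarrow> ln \<xi> \<le> log_expansion x"
proof -
  assume "x \<in> \<Lambda>"
  then obtain \<omega> where "cod \<omega> = x" "\<omega> 0 = first_symbol I f x" using first_symbol_code by blast
  then have "\<xi> \<le> \<bar>branch_map_deriv I f x\<bar>"
    using branch_deriv_ge cod_branch(1)[of \<omega>] by (simp add: branch_map_deriv_def)
  then show ?thesis unfolding log_expansion_def using \<xi>_gt_1 by (subst ln_le_cancel_iff) auto
qed

lemma birkhoff_sum_log_expansion:
  "\<omega> \<in> reg \<Longrightarrow> birkhoff_sum log_expansion n \<omega> = log_deriv_sum (prefix_of \<omega> n) (cod (shift_code n \<omega>))"
proof (induction n arbitrary: \<omega>)
  case (Suc n)
  have "wmap (prefix_of \<omega> (Suc n)) (cod (shift_code (Suc n) \<omega>)) = cod \<omega>"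
    using cod_wmap by metis
  then show ?case
    using Suc.IH[OF reg_shift[OF Suc.prems, of 1]] log_expansion_reg[OF Suc.prems]
    by (simp add: birkhoff_sum_Suc prefix_of_Suc)
qed simp

text \<open>The dictionary between cylinder lengths and Lyapunov exponents: \<open>- ln r\<close> is
  a Birkhoff sum of \<open>log |T'|\<close> up to a sublinear error.\<close>

lemma birkhoff_sum_log_expansion_r: "\<omega> \<in> reg \<Longrightarrow> \<bar>ln (r (prefix_of \<omega> n)) + birkhoff_sum log_expansion n \<omega>\<bar> \<le> V n"
  using ln_r_log_deriv_sum[OF cod_unit, of "prefix_of \<omega> n" "shift_code n \<omega>"] by (simp add: birkhoff_sum_log_expansion)

subsection \<open>Measurability\<close>

abbreviation BL :: "real measure" where "BL \<equiv> restrict_space borel \<Lambda>"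
abbreviation R :: "real set" where "R \<equiv> cod ` reg"

lemma space_BL [simp]: "space BL = \<Lambda>"
  by (simp add: space_restrict_space)

lemma R_subset: "R \<subseteq> \<Lambda>"
  by auto

lemma countable_not_R: "countable (\<Lambda> - R)"
  by (rule countable_subset[of _ "cod ` (- reg)"])
    (use countable_not_reg in \<open>auto simp: limit_set_def\<close>)

lemma sets_BL_countable: "countable C \<Longrightarrow> C \<subseteq> \<Lambda> \<Longrightarrow> C \<in> sets BL"
  unfolding sets_restrict_space
  by (rule image_eqI[of _ _ C]) (auto intro: sets.countable)

lemma singleton_BL: "x \<in> \<Lambda> \<Longrightarrow> {x} \<in> sets BL"
  by (rule sets_BL_countable) auto

lemma R_sets: "R \<in> sets BL"
proof -
  have "R = space BL - (\<Lambda> - R)" using R_subset by auto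
  then show ?thesis using sets_BL_countable[OF countable_not_R] by (metis Diff_subset sets.compl_sets)
qed

lemma W_sets_BL: "W w \<inter> \<Lambda> \<in> sets BL"
  unfolding sets_restrict_space W_segment by (rule image_eqI[of _ _ "closed_segment (wmap w 0) (wmap w 1)"]) auto

text \<open>Subsets of the countable set \<open>\<Lambda> - R\<close> are Borel, so measurability
  may be checked on \<open>R\<close>, where cylinders of itineraries are traces of closed
  intervals.\<close>

lemma sets_BL_mod_R:
  assumes "A \<subseteq> \<Lambda>" "B \<in> sets BL" "A \<inter> R = B \<inter> R"
  shows "A \<in> sets BL"
proof -
  have "A = (B \<inter> R) \<union> (A - R)" using assms by blast
  moreover have "A - R \<in> sets BL"
    using assms(1) countable_not_R by (intro sets_BL_countable) (auto elim: countable_subset[rotated])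
  ultimately show ?thesis using assms(2) R_sets by (metis sets.Int sets.Un)
qed

lemma R_itinerary: "x \<in> R \<Longrightarrow> itinerary x \<in> reg \<and> cod (itinerary x) = x"
  using itinerary_cod by auto

lemma not_R_itinerary: "x \<in> \<Lambda> \<Longrightarrow> x \<notin> R \<Longrightarrow> itinerary x \<notin> reg"
  using cod_itinerary by (metis imageI)

lemma itinerary_word_measurable:
  "(\<lambda>x. prefix_of (itinerary x) n) \<in> measurable BL (count_space UNIV)"
  unfolding measurable_count_space_eq2_countable
proof (intro conjI ballI)
  fix w :: "nat list"
  show "(\<lambda>x. prefix_of (itinerary x) n) -` {w} \<inter> space BL \<in> sets BL"
  proof (cases "length w = n")
    case True
    show ?thesis
      by (rule sets_BL_mod_R[OF _ W_sets_BL[of w]])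
        (use True in \<open>auto simp: itinerary_cod reg_in_W_iff\<close>)
  next
    case False
    then have "(\<lambda>x. prefix_of (itinerary x) n) -` {w} \<inter> space BL = {}"
      by auto
    then show ?thesis by simp
  qed
qed auto

lemma first_symbol_measurable: "first_symbol I f \<in> measurable BL (count_space UNIV)"
proof -
  have "(\<lambda>x. hd (prefix_of (itinerary x) 1)) \<in> measurable BL (count_space UNIV)"
    by (rule measurable_compose[OF itinerary_word_measurable]) simp
  moreover have "hd (prefix_of (itinerary x) 1) = first_symbol I f x" for x
    by (simp add: prefix_of_def itinerary_def)
  ultimately show ?thesis by simp
qed

lemma first_symbol_in: "x \<in> \<Lambda> \<Longrightarrow> x \<in> {lo (first_symbol I f x)..hi (first_symbol I f x)}"
  using first_symbol_code cod_branch(1) by metis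

text \<open>Each branch is continuous on its own closed interval. Cutting it off there gives one
  Borel function per letter, and the first symbol selects among countably many of them.\<close>

lemma letterwise_measurable:
  assumes "\<And>a. continuous_on {lo a..hi a} (g a)"
  shows "(\<lambda>x. g (first_symbol I f x) x :: real) \<in> borel_measurable BL"
proof -
  let ?h = "\<lambda>a x. indicator {lo a..hi a} x *\<^sub>R g a x"
  have "?h a \<in> borel_measurable BL" for a
    by (intro measurable_restrict_space1 borel_measurable_continuous_on_indicator assms) auto
  from measurable_compose_countable'[where f = ?h, OF this first_symbol_measurable]
  have m1: "(\<lambda>x. ?h (first_symbol I f x) x) \<in> borel_measurable BL" by simp
  have eq: "?h (first_symbol I f x) x = g (first_symbol I f x) x" if "x \<in> space BL" for x
    using first_symbol_in[of x] that by (simp add: indicator_def)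
  have "(\<lambda>x. ?h (first_symbol I f x) x) \<in> borel_measurable BL
      \<longleftrightarrow> (\<lambda>x. g (first_symbol I f x) x) \<in> borel_measurable BL"
    by (rule measurable_cong) (rule eq)
  then show ?thesis using m1 by blast
qed

lemma T_measurable: "T \<in> measurable BL BL"
proof (rule measurable_restrict_space2)
  show "T \<in> space BL \<rightarrow> \<Lambda>" using T_limit_set by auto
  show "T \<in> borel_measurable BL"
    unfolding branch_map_def by (rule letterwise_measurable[OF branch_cont])
qed

lemma T_pow_measurable: "T ^^ n \<in> measurable BL BL"
proof (induction n)
  case (Suc n)
  then show ?case using measurable_comp[OF Suc T_measurable] by (simp add: comp_def)
qed (simp add: id_def)

lemma log_expansion_measurable: "log_expansion \<in> borel_measurable BL"
proof -
  have "branch_map_deriv I f \<in> borel_measurable BL"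
    unfolding branch_map_deriv_def by (rule letterwise_measurable[OF branch_deriv_cont])
  then show ?thesis unfolding log_expansion_def by measurable
qed

text \<open>Borel measurability follows from vanishing variations. On \<open>R\<close> a potential
  is the pointwise limit of functions of the first \<open>n\<close> symbols, obtained by sampling at
  periodic points; elsewhere only countably many values are changed.\<close>

lemma potential_measurable:
  assumes "potential_variations_vanish I f \<phi>"
  shows "\<phi> \<in> borel_measurable BL"
proof -
  define g where "g n x = (if x \<in> R then \<phi> (cod (periodic_code (prefix_of (itinerary x) n))) else 0)" for n x
  have RR: "{x \<in> space BL. x \<in> R} = R" using R_subset by auto
  have "g n \<in> borel_measurable BL" for n
    unfolding g_def
    by (intro measurable_If measurable_const measurable_compose[OF itinerary_word_measurable])
      (use R_sets RR in auto)
  moreover have "(\<lambda>n. g n x) \<longlonglongrightarrow> (if x \<in> R then \<phi> x else 0)" for x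
  proof (cases "x \<in> R")
    case True
    let ?m = "modulus (\<lambda>w. basic_interval I f w \<inter> \<Lambda>) (\<lambda>w. \<phi>)"
    have m: "?m \<longlonglongrightarrow> 0"
    proof -
      have "(\<lambda>n. enn2real (variation (\<lambda>w. basic_interval I f w \<inter> \<Lambda>) (\<lambda>w. \<phi>) n)) \<longlonglongrightarrow> enn2real 0"
        using assms by (intro tendsto_enn2real)
          (auto simp: potential_variations_vanish_def variations_vanish_def)
      then have "(\<lambda>n. enn2real (variation (\<lambda>w. basic_interval I f w \<inter> \<Lambda>) (\<lambda>w. \<phi>) n)) \<longlonglongrightarrow> 0"
        by simp
      then show ?thesis
        by (rule Lim_transform_eventually)
          (auto simp: modulus_def eventually_sequentially intro!: exI[of _ 1])
    qed
    have "\<bar>g n x - \<phi> x\<bar> \<le> ?m n" if "n \<ge> 1" for n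
    proof -
      have ne: "prefix_of (itinerary x) n \<noteq> []" using that by (metis length_prefix_of list.size(3) not_one_le_zero)
      have "prefix_of (periodic_code (prefix_of (itinerary x) n)) n = prefix_of (itinerary x) n"
        using prefix_periodic_code[OF ne] by simp
      then show ?thesis
        using potential_close[OF assms periodic_code_reg[OF ne], of "itinerary x" n] R_itinerary[OF True] True that
        by (simp add: g_def)
    qed
    then have "(\<lambda>n. g n x - \<phi> x) \<longlonglongrightarrow> 0"
      by (intro Lim_null_comparison[OF _ m]) (auto simp: eventually_sequentially)
    then show ?thesis using True by (simp add: LIM_zero_iff)
  qed (simp add: g_def)
  ultimately have "(\<lambda>x. if x \<in> R then \<phi> x else 0) \<in> borel_measurable BL"
    by (rule borel_measurable_LIMSEQ_metric)
  then show ?thesis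
    by (rule measurable_discrete_difference[OF _ countable_not_R])
      (auto intro: singleton_BL)
qed

subsection \<open>Invariant measures\<close>

lemma invariantD:
  assumes "\<mu> \<in> invariant_measures I f"
  shows "prob_space \<mu>" "sets \<mu> = sets BL" "space \<mu> = \<Lambda>" "distr \<mu> \<mu> T = \<mu>"
  using assms sets_eq_imp_space_eq[of \<mu> BL] by (auto simp: invariant_measures_def)

lemma invariant_pow:
  assumes "\<mu> \<in> invariant_measures I f"
  shows "distr \<mu> \<mu> (T ^^ n) = \<mu>"
proof -
  note [measurable_cong] = invariantD(2)[OF assms]
  note [measurable] = T_measurable T_pow_measurable
  show ?thesis
  proof (induction n)
    case 0
    show ?case by (simp add: id_def)
  next
    case (Suc n)
    have "distr (distr \<mu> \<mu> (T ^^ n)) \<mu> T = distr \<mu> \<mu> (T \<circ> T ^^ n)"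
      by (rule distr_distr) measurable
    then show ?case unfolding funpow.simps using Suc invariantD(4)[OF assms] by metis
  qed
qed

lemma invariant_nn_integral:
  assumes "\<mu> \<in> invariant_measures I f" "g \<in> borel_measurable BL"
  shows "(\<integral>\<^sup>+x. g ((T ^^ n) x) \<partial>\<mu>) = (\<integral>\<^sup>+x. g x \<partial>\<mu>)"
proof -
  note [measurable_cong] = invariantD(2)[OF assms(1)]
  note [measurable] = T_measurable assms(2)
  have "(\<integral>\<^sup>+x. g x \<partial>distr \<mu> \<mu> (T ^^ n)) = (\<integral>\<^sup>+x. g ((T ^^ n) x) \<partial>\<mu>)"
    by (rule nn_integral_distr) simp_all
  then show ?thesis using invariant_pow[OF assms(1)] by simp
qed

lemma invariant_integral:
  fixes g :: "real \<Rightarrow> real"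
  assumes "\<mu> \<in> invariant_measures I f" "integrable \<mu> g"
  shows "integrable \<mu> (\<lambda>x. g ((T ^^ n) x))" "(\<integral>x. g ((T ^^ n) x) \<partial>\<mu>) = (\<integral>x. g x \<partial>\<mu>)"
proof -
  note [measurable_cong] = invariantD(2)[OF assms(1)]
  note [measurable] = T_measurable
  have m: "T ^^ n \<in> measurable \<mu> \<mu>" by measurable
  have g: "g \<in> borel_measurable \<mu>" using assms(2) by auto
  show "integrable \<mu> (\<lambda>x. g ((T ^^ n) x))"
    using integrable_distr_eq[OF m g] assms(2) invariant_pow[OF assms(1)] by simp
  show "(\<integral>x. g ((T ^^ n) x) \<partial>\<mu>) = (\<integral>x. g x \<partial>\<mu>)"
    using integral_distr[OF m g] invariant_pow[OF assms(1)] by simp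
qed

text \<open>Points outside \<open>R\<close> enter \<open>{0, 1}\<close> after a positive time and stay there, so they are
  wandering.\<close>

lemma AE_R:
  assumes "\<mu> \<in> invariant_measures I f"
  shows "AE x in \<mu>. x \<in> R"
proof -
  interpret prob_space \<mu> by (rule invariantD[OF assms])
  note [measurable_cong] = invariantD(2)[OF assms]
  define N where "N n = (T ^^ n) -` {0, 1} \<inter> \<Lambda>" for n
  have sp: "space \<mu> = \<Lambda>" by (rule invariantD[OF assms])
  have end01: "{0, 1} \<inter> \<Lambda> \<in> sets BL" by (rule sets_BL_countable) auto
  have Nalt: "N n = (T ^^ n) -` ({0, 1} \<inter> \<Lambda>) \<inter> space BL" for n
    using T_pow_limit_set by (auto simp: N_def)
  have Nm: "N n \<in> sets \<mu>" for n
    unfolding Nalt invariantD(2)[OF assms] by (rule measurable_sets[OF T_pow_measurable end01])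
  have "emeasure \<mu> (N n) = emeasure \<mu> (N 0)" for n
  proof -
    have "emeasure (distr \<mu> \<mu> (T ^^ n)) (N 0) = emeasure \<mu> ((T ^^ n) -` N 0 \<inter> space \<mu>)"
      using T_pow_measurable Nm by (intro emeasure_distr) (auto cong: measurable_cong_sets simp: invariantD(2)[OF assms])
    moreover have "(T ^^ n) -` N 0 \<inter> space \<mu> = N n"
      using T_pow_limit_set sp by (auto simp: N_def)
    ultimately show ?thesis using invariant_pow[OF assms] by simp
  qed
  from this have eq: "measure \<mu> (N n) = measure \<mu> (N 0)" for n unfolding measure_def by metis
  have sub: "N 0 \<subseteq> N n" for n
  proof
    fix x assume "x \<in> N 0"
    then have x: "x \<in> \<Lambda>" "x \<in> {0, 1}" by (auto simp: N_def)
    then have "itinerary x \<in> end_codes" using cod_itinerary[OF x(1)] by (simp add: end_codes_def)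
    from end_codes_shift[OF this, of n] show "x \<in> N n"
      using x cod_shift_code_itinerary[OF x(1), of n] by (auto simp: end_codes_def N_def)
  qed
  \<comment> \<open>Invariance gives \<open>N n\<close> and \<open>N 0\<close> the same mass, and
    the first contains the second.\<close>
  have null: "N n - N 0 \<in> null_sets \<mu>" for n
  proof -
    have "measure \<mu> (N n - N 0) = 0"
      using finite_measure_Diff[OF Nm Nm sub, of n] eq by simp
    then show ?thesis using Nm by (auto simp: emeasure_eq_measure null_sets_def)
  qed
  have "(\<Union>n. N n - N 0) \<in> null_sets \<mu>" using null by (intro null_sets_UN) auto
  moreover have "{x \<in> space \<mu>. x \<notin> R} \<subseteq> (\<Union>n. N n - N 0)"
  proof
    fix x assume "x \<in> {x \<in> space \<mu>. x \<notin> R}"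
    then have x: "x \<in> \<Lambda>" "x \<notin> R" using sp by auto
    then have "itinerary x \<notin> reg" by (rule not_R_itinerary)
    then obtain n where n: "itinerary x \<notin> end_codes" "shift_code n (itinerary x) \<in> end_codes"
      by (auto simp: reg_def)
    then have "x \<notin> N 0" "x \<in> N n"
      using cod_itinerary[OF x(1)] cod_shift_code_itinerary[OF x(1), of n] x by (auto simp: end_codes_def N_def)
    then show "x \<in> (\<Union>n. N n - N 0)" by blast
  qed
  ultimately show ?thesis by (rule AE_I')
qed

text \<open>The mean of the first \<open>n\<close> images of a \<open>T ^^ n\<close>-invariant
  measure, realised as the image of a product with the uniform law on times. The integral identity
  is exported so that later computations take place under \<open>\<nu>\<close>.\<close>

lemma average_measure:
  assumes \<nu>: "prob_space \<nu>" "sets \<nu> = sets BL" "distr \<nu> \<nu> (T ^^ n) = \<nu>" and n: "0 < n"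
  obtains \<mu> where "\<mu> \<in> invariant_measures I f"
    and "\<And>g. g \<in> borel_measurable BL \<Longrightarrow>
      (\<integral>\<^sup>+x. g x \<partial>\<mu>) = (\<integral>\<^sup>+x. (\<Sum>j<n. g ((T ^^ j) x)) / of_nat n \<partial>\<nu>)"
proof -
  interpret \<nu>: prob_space \<nu> by (rule \<nu>)
  define U where "U = measure_pmf (pmf_of_set {..<n})"
  interpret U: prob_space U unfolding U_def by (rule measure_pmf.prob_space_axioms)
  note [measurable_cong] = \<nu>(2)
  note [measurable] = T_measurable T_pow_measurable
  have setsU [measurable_cong]: "sets U = sets (count_space UNIV)" by (simp add: U_def)
  have pm [measurable]: "(\<lambda>(j, x). (T ^^ j) x) \<in> measurable (U \<Otimes>\<^sub>M \<nu>) BL"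
  proof -
    have "(\<lambda>p. (T ^^ (fst p)) (snd p)) \<in> measurable (U \<Otimes>\<^sub>M \<nu>) BL"
      by (rule measurable_compose_countable'[where I = UNIV]) auto
    then show ?thesis by (simp add: case_prod_beta')
  qed
  define \<mu> where "\<mu> = distr (U \<Otimes>\<^sub>M \<nu>) BL (\<lambda>(j, x). (T ^^ j) x)"
  interpret P: pair_prob_space U \<nu> ..
  have prob: "prob_space \<mu>" unfolding \<mu>_def by (rule P.prob_space_distr[OF pm])
  have sets\<mu>: "sets \<mu> = sets BL" and sp: "space \<mu> = \<Lambda>" by (simp_all add: \<mu>_def)
  have fin: "finite {..<n}" "{..<n} \<noteq> {}" using n by auto
  have avg: "(\<integral>\<^sup>+x. g x \<partial>\<mu>) = (\<integral>\<^sup>+x. (\<Sum>j<n. g ((T ^^ j) x)) / of_nat n \<partial>\<nu>)"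
    if [measurable]: "g \<in> borel_measurable BL" for g
  proof -
    have "(\<integral>\<^sup>+x. g x \<partial>\<mu>) = (\<integral>\<^sup>+p. g (case p of (j, x) \<Rightarrow> (T ^^ j) x) \<partial>(U \<Otimes>\<^sub>M \<nu>))"
      unfolding \<mu>_def by (rule nn_integral_distr) measurable
    also have "\<dots> = (\<integral>\<^sup>+j. \<integral>\<^sup>+x. g ((T ^^ j) x) \<partial>\<nu> \<partial>U)"
      by (subst \<nu>.nn_integral_fst[symmetric]) auto
    also have "\<dots> = (\<Sum>j<n. \<integral>\<^sup>+x. g ((T ^^ j) x) \<partial>\<nu>) / of_nat n"
      unfolding U_def by (simp add: nn_integral_pmf_of_set fin)
    also have "\<dots> = (\<integral>\<^sup>+x. (\<Sum>j<n. g ((T ^^ j) x)) / of_nat n \<partial>\<nu>)"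
      by (simp add: nn_integral_divide nn_integral_sum)
    finally show ?thesis .
  qed
  have "distr \<mu> \<mu> T = \<mu>"
  proof (rule measure_eqI)
    fix A assume "A \<in> sets (distr \<mu> \<mu> T)"
    then have A [measurable]: "A \<in> sets BL" by (simp add: sets\<mu>)
    have Tm: "T \<in> measurable \<mu> \<mu>" using T_measurable by (simp cong: measurable_cong_sets add: sets\<mu>)
    let ?i = "\<lambda>j. \<integral>\<^sup>+x. indicator A ((T ^^ j) x) \<partial>\<nu>"
    have e: "(\<integral>\<^sup>+x. (\<Sum>j<n. indicator A ((T ^^ (k + j)) x)) / of_nat n \<partial>\<nu>) = (\<Sum>j<n. ?i (k + j)) / of_nat n" for k
      by (simp add: nn_integral_divide nn_integral_sum)
    have "?i n = (\<integral>\<^sup>+x. indicator A x \<partial>distr \<nu> \<nu> (T ^^ n))"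
      by (subst nn_integral_distr) auto
    \<comment> \<open>Invariance under \<open>T ^^ n\<close> closes the cycle: shifting the sum by
      one time step only moves its first term to the end.\<close>
    then have per: "?i n = ?i 0" using \<nu>(3) by simp
    have "emeasure (distr \<mu> \<mu> T) A = (\<integral>\<^sup>+x. indicator A x \<partial>distr \<mu> \<mu> T)"
      using A by (simp add: sets\<mu>)
    also have "\<dots> = (\<integral>\<^sup>+x. indicator A (T x) \<partial>\<mu>)"
      using A by (intro nn_integral_distr[OF Tm]) (simp add: sets\<mu> cong: measurable_cong_sets)
    also have "\<dots> = (\<integral>\<^sup>+x. (\<Sum>j<n. indicator A ((T ^^ (1 + j)) x)) / of_nat n \<partial>\<nu>)"
      by (subst avg) auto
    also have "\<dots> = (\<Sum>j<n. ?i (1 + j)) / of_nat n" by (rule e)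
    also have "(\<Sum>j<n. ?i (1 + j)) = (\<Sum>j<n. ?i j)"
      by (rule sum_cyclic_shift[OF per])
    also have "(\<Sum>j<n. ?i j) / of_nat n = (\<integral>\<^sup>+x. (\<Sum>j<n. indicator A ((T ^^ j) x)) / of_nat n \<partial>\<nu>)"
      using e[of 0] by simp
    also have "\<dots> = (\<integral>\<^sup>+x. indicator A x \<partial>\<mu>)" by (subst avg) auto
    also have "\<dots> = emeasure \<mu> A" using A by (simp add: sets\<mu>)
    finally show "emeasure (distr \<mu> \<mu> T) A = emeasure \<mu> A" .
  qed simp
  then have "\<mu> \<in> invariant_measures I f"
    using prob sets\<mu> T_measurable by (simp add: invariant_measures_def cong: measurable_cong_sets)
  then show thesis using avg that by blast
qed

lemma average_AE:
  assumes \<mu>: "\<mu> \<in> invariant_measures I f" and \<nu>: "sets \<nu> = sets BL"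
    and avg: "\<And>g. g \<in> borel_measurable BL \<Longrightarrow>
      (\<integral>\<^sup>+x. g x \<partial>\<mu>) = (\<integral>\<^sup>+x. (\<Sum>j<n. g ((T ^^ j) x)) / of_nat n \<partial>\<nu>)"
    and Q: "{x \<in> \<Lambda>. Q x} \<in> sets BL" and AE: "AE x in \<nu>. \<forall>j<n. Q ((T ^^ j) x)"
  shows "AE x in \<mu>. Q x"
proof -
  let ?A = "\<Lambda> - {x \<in> \<Lambda>. Q x}"
  have A: "?A \<in> sets BL" using sets.compl_sets[OF Q] by simp
  have im: "(indicator ?A :: real \<Rightarrow> ennreal) \<in> borel_measurable BL" using A by simp
  have "(\<integral>\<^sup>+x. indicator ?A x \<partial>\<mu>) = (\<integral>\<^sup>+x. (\<Sum>j<n. indicator ?A ((T ^^ j) x)) / of_nat n \<partial>\<nu>)"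
    by (rule avg[OF im])
  also have "\<dots> = (\<integral>\<^sup>+x. 0 \<partial>\<nu>)"
    by (rule nn_integral_cong_AE) (use AE in \<open>auto elim!: eventually_mono simp: indicator_def\<close>)
  finally have "emeasure \<mu> ?A = 0" using A invariantD(2)[OF \<mu>] by simp
  then have "?A \<in> null_sets \<mu>" using A invariantD(2)[OF \<mu>] by auto
  then show ?thesis
    by (rule AE_I') (use invariantD(3)[OF \<mu>] in auto)
qed

text \<open>The averaging identity is available for nonnegative functions, so the potential is first
  raised by its bound \<open>B\<close>. The error \<open>\<epsilon>\<close> is inherited because the
  sum over one period is controlled almost everywhere, not just in mean.\<close>

lemma average_integral:
  assumes \<mu>: "\<mu> \<in> invariant_measures I f" and \<nu>: "prob_space \<nu>" "sets \<nu> = sets BL" and n: "0 < n"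
    and avg: "\<And>g. g \<in> borel_measurable BL \<Longrightarrow>
      (\<integral>\<^sup>+x. g x \<partial>\<mu>) = (\<integral>\<^sup>+x. (\<Sum>j<n. g ((T ^^ j) x)) / of_nat n \<partial>\<nu>)"
    and \<phi>: "\<phi> \<in> borel_measurable BL" and bnd: "AE x in \<nu>. \<forall>j<n. \<bar>\<phi> ((T ^^ j) x)\<bar> \<le> B"
    and sum: "AE x in \<nu>. \<bar>(\<Sum>j<n. \<phi> ((T ^^ j) x)) - real n * c\<bar> \<le> real n * \<epsilon>"
  shows "integrable \<mu> \<phi>" "\<bar>(\<integral>x. \<phi> x \<partial>\<mu>) - c\<bar> \<le> \<epsilon>" "AE x in \<mu>. \<bar>\<phi> x\<bar> \<le> B"
proof -
  interpret \<nu>: prob_space \<nu> by (rule \<nu>)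
  interpret \<mu>: prob_space \<mu> by (rule invariantD[OF \<mu>])
  have s\<mu>: "sets \<mu> = sets BL" by (rule invariantD[OF \<mu>])
  note [measurable_cong] = \<nu>(2) s\<mu>
  note [measurable] = T_pow_measurable \<phi>
  show AEb: "AE x in \<mu>. \<bar>\<phi> x\<bar> \<le> B"
  proof (rule average_AE[OF \<mu> \<nu>(2) avg _ bnd])
    have "{x \<in> space BL. \<bar>\<phi> x\<bar> \<le> B} \<in> sets BL" by measurable
    then show "{x \<in> \<Lambda>. \<bar>\<phi> x\<bar> \<le> B} \<in> sets BL" by simp
  qed
  show int: "integrable \<mu> \<phi>"
    by (rule \<mu>.integrable_const_bound[OF _ _]) (use AEb in auto)
  have "(\<integral>\<^sup>+x. ennreal (\<phi> x + B) \<partial>\<mu>) = ennreal (\<integral>x. \<phi> x + B \<partial>\<mu>)"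
    using int AEb by (intro nn_integral_eq_integral) (auto elim!: eventually_mono)
  moreover have "(\<integral>x. \<phi> x + B \<partial>\<mu>) = (\<integral>x. \<phi> x \<partial>\<mu>) + B"
    using int by (simp add: \<mu>.prob_space)
  ultimately have e1: "(\<integral>\<^sup>+x. ennreal (\<phi> x + B) \<partial>\<mu>) = ennreal ((\<integral>x. \<phi> x \<partial>\<mu>) + B)" by simp
  have e2: "(\<integral>\<^sup>+x. ennreal (\<phi> x + B) \<partial>\<mu>)
      = (\<integral>\<^sup>+x. (\<Sum>j<n. ennreal (\<phi> ((T ^^ j) x) + B)) / of_nat n \<partial>\<nu>)"
    by (rule avg) measurable
  have AEin: "AE x in \<nu>. ennreal (c - \<epsilon> + B) \<le> (\<Sum>j<n. ennreal (\<phi> ((T ^^ j) x) + B)) / of_nat n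
      \<and> (\<Sum>j<n. ennreal (\<phi> ((T ^^ j) x) + B)) / of_nat n \<le> ennreal (c + \<epsilon> + B) \<and> 0 \<le> c + \<epsilon> + B"
    using bnd sum
  proof eventually_elim
    case (elim x)
    have nn: "0 \<le> \<phi> ((T ^^ j) x) + B" if "j < n" for j using elim(1) that by (auto simp: abs_le_iff)
    have "(\<Sum>j<n. ennreal (\<phi> ((T ^^ j) x) + B)) = ennreal (\<Sum>j<n. \<phi> ((T ^^ j) x) + B)"
      using nn by (intro sum_ennreal) auto
    then have e: "(\<Sum>j<n. ennreal (\<phi> ((T ^^ j) x) + B)) / of_nat n
        = ennreal ((\<Sum>j<n. \<phi> ((T ^^ j) x) + B) / real n)"
      unfolding \<open>(\<Sum>j<n. ennreal (\<phi> ((T ^^ j) x) + B)) = _\<close> ennreal_of_nat_eq_real_of_nat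
      using n nn by (intro divide_ennreal sum_nonneg) auto
    have s: "(\<Sum>j<n. \<phi> ((T ^^ j) x) + B) = (\<Sum>j<n. \<phi> ((T ^^ j) x)) + real n * B"
      by (simp add: sum.distrib)
    have "c - \<epsilon> + B \<le> (\<Sum>j<n. \<phi> ((T ^^ j) x) + B) / real n"
      "(\<Sum>j<n. \<phi> ((T ^^ j) x) + B) / real n \<le> c + \<epsilon> + B"
      using elim(2) n unfolding s by (auto simp: field_simps abs_le_iff)
    moreover have "0 \<le> (\<Sum>j<n. \<phi> ((T ^^ j) x) + B) / real n"
      using nn by (intro divide_nonneg_nonneg sum_nonneg) auto
    ultimately show ?case unfolding e by (auto intro: ennreal_leI)
  qed
  have low: "ennreal (c - \<epsilon> + B) \<le> ennreal ((\<integral>x. \<phi> x \<partial>\<mu>) + B)"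
  proof -
    have "ennreal (c - \<epsilon> + B) = (\<integral>\<^sup>+x. ennreal (c - \<epsilon> + B) \<partial>\<nu>)" by (simp add: \<nu>.emeasure_space_1)
    also have "\<dots> \<le> ennreal ((\<integral>x. \<phi> x \<partial>\<mu>) + B)"
      unfolding e1[symmetric] e2 by (rule nn_integral_mono_AE) (use AEin in \<open>auto elim: eventually_mono\<close>)
    finally show ?thesis .
  qed
  have up: "ennreal ((\<integral>x. \<phi> x \<partial>\<mu>) + B) \<le> ennreal (c + \<epsilon> + B)"
  proof -
    have "ennreal ((\<integral>x. \<phi> x \<partial>\<mu>) + B) \<le> (\<integral>\<^sup>+x. ennreal (c + \<epsilon> + B) \<partial>\<nu>)"
      unfolding e1[symmetric] e2 by (rule nn_integral_mono_AE) (use AEin in \<open>auto elim: eventually_mono\<close>)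
    then show ?thesis by (simp add: \<nu>.emeasure_space_1)
  qed
  have pos: "0 \<le> c + \<epsilon> + B"
  proof -
    have "AE x in \<nu>. 0 \<le> c + \<epsilon> + B" using AEin by (auto elim: eventually_mono)
    then show ?thesis by simp
  qed
  have pos2: "0 \<le> (\<integral>x. \<phi> x \<partial>\<mu>) + B"
  proof -
    have "0 \<le> (\<integral>x. \<phi> x + B \<partial>\<mu>)" using AEb by (intro integral_nonneg_AE) (auto elim!: eventually_mono)
    then show ?thesis using int by (simp add: \<mu>.prob_space)
  qed
  show "\<bar>(\<integral>x. \<phi> x \<partial>\<mu>) - c\<bar> \<le> \<epsilon>"
    using low up pos pos2 by (auto simp: ennreal_le_iff2 abs_le_iff)
qed

subsection \<open>Level sets outside the closure of the averages are empty\<close>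

text \<open>The orbit measure of the periodic point: its orbit is finite, so all potentials are
  integrable at once and their integrals are averages over one period.\<close>

lemma periodic_measure:
  assumes w: "w \<noteq> []"
  obtains \<mu> where "\<mu> \<in> invariant_measures I f"
    and "\<And>\<phi> c \<epsilon>. potential_variations_vanish I f \<phi> \<Longrightarrow>
      \<bar>birkhoff_sum \<phi> (length w) (periodic_code w) - real (length w) * c\<bar> \<le> real (length w) * \<epsilon> \<Longrightarrow>
      integrable \<mu> \<phi> \<and> \<bar>(\<integral>x. \<phi> x \<partial>\<mu>) - c\<bar> \<le> \<epsilon>"
proof -
  let ?n = "length w" and ?p = "cod (periodic_code w)"
  define \<nu> where "\<nu> = return BL ?p"
  have n: "0 < ?n" using w by simp
  have prob: "prob_space \<nu>" unfolding \<nu>_def by (rule prob_space_return) simp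
  have s: "sets \<nu> = sets BL" by (simp add: \<nu>_def)
  have Tj: "(T ^^ j) ?p = cod (shift_code j (periodic_code w))" for j
    using reg_T_pow[OF periodic_code_reg[OF w]] by simp
  have "distr \<nu> \<nu> (T ^^ ?n) = \<nu>"
  proof -
    have "distr \<nu> BL (T ^^ ?n) = return BL ((T ^^ ?n) ?p)"
      unfolding \<nu>_def by (rule distr_return[OF T_pow_measurable]) simp
    moreover have "distr \<nu> \<nu> (T ^^ ?n) = distr \<nu> BL (T ^^ ?n)"
      by (rule distr_cong) (auto simp: s)
    ultimately show ?thesis using Tj[of ?n] shift_periodic_code[of 1 w] by (simp add: \<nu>_def)
  qed
  from average_measure[OF prob s this n] obtain \<mu> where \<mu>: "\<mu> \<in> invariant_measures I f"
    and avg: "\<And>g. g \<in> borel_measurable BL \<Longrightarrow>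
      (\<integral>\<^sup>+x. g x \<partial>\<mu>) = (\<integral>\<^sup>+x. (\<Sum>j<?n. g ((T ^^ j) x)) / of_nat ?n \<partial>\<nu>)" by blast
  have "integrable \<mu> \<phi> \<and> \<bar>(\<integral>x. \<phi> x \<partial>\<mu>) - c\<bar> \<le> \<epsilon>"
    if \<phi>: "potential_variations_vanish I f \<phi>"
      and b: "\<bar>birkhoff_sum \<phi> ?n (periodic_code w) - real ?n * c\<bar> \<le> real ?n * \<epsilon>" for \<phi> c \<epsilon>
  proof -
    note [measurable] = T_pow_measurable potential_measurable[OF \<phi>]
    have B: "\<forall>j<?n. \<bar>\<phi> ((T ^^ j) ?p)\<bar> \<le> (\<Sum>i<?n. \<bar>\<phi> ((T ^^ i) ?p)\<bar>)"
      by (auto intro: member_le_sum)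
    have "AE x in \<nu>. \<forall>j<?n. \<bar>\<phi> ((T ^^ j) x)\<bar> \<le> (\<Sum>i<?n. \<bar>\<phi> ((T ^^ i) ?p)\<bar>)"
      unfolding \<nu>_def by (subst AE_return) (use B in auto)
    moreover have "AE x in \<nu>. \<bar>(\<Sum>j<?n. \<phi> ((T ^^ j) x)) - real ?n * c\<bar> \<le> real ?n * \<epsilon>"
      unfolding \<nu>_def by (subst AE_return) (use b in \<open>auto simp: birkhoff_sum_def Tj\<close>)
    ultimately show ?thesis
      using average_integral[OF \<mu> prob s n avg potential_measurable[OF \<phi>]] by blast
  qed
  then show thesis using \<mu> that by blast
qed

text \<open>A point of the level set yields periodic codes that repeat longer and longer prefixes of
  its itinerary. Their averages are realised exactly by orbit measures and converge to
  \<open>\<gamma>\<close>, since the comparison error divided by the length tends to 0.\<close>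

lemma level_set_empty:
  assumes pot: "\<And>i. potential_variations_vanish I f (\<phi> i)"
    and ne: "birkhoff_level_set I f \<phi> \<gamma> \<noteq> {}"
  shows "\<gamma> \<in> approx_averages I f \<phi>"
proof -
  obtain x where x: "x \<in> \<Lambda>"
    and lim: "\<And>i. (\<lambda>n. birkhoff_sum (\<phi> i) n (itinerary x) / real n) \<longlonglongrightarrow> \<gamma> i"
    using ne by (auto simp: birkhoff_level_set_def birkhoff_sum_itinerary)
  define p where "p n = periodic_code (prefix_of (itinerary x) n)" for n
  have pne: "prefix_of (itinerary x) (Suc n) \<noteq> []" for n by (simp add: prefix_of_Suc)
  have "\<exists>\<mu>. \<mu> \<in> invariant_measures I f \<and> (\<forall>\<phi> c \<epsilon>. potential_variations_vanish I f \<phi> \<longrightarrow>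
      \<bar>birkhoff_sum \<phi> (Suc n) (p (Suc n)) - real (Suc n) * c\<bar> \<le> real (Suc n) * \<epsilon> \<longrightarrow>
      integrable \<mu> \<phi> \<and> \<bar>(\<integral>x. \<phi> x \<partial>\<mu>) - c\<bar> \<le> \<epsilon>)" for n
    using periodic_measure[OF pne[of n]] unfolding p_def length_prefix_of by metis
  then obtain M where M: "\<And>n. M n \<in> invariant_measures I f"
    and MI: "\<And>n \<phi> c \<epsilon>. potential_variations_vanish I f \<phi> \<Longrightarrow>
      \<bar>birkhoff_sum \<phi> (Suc n) (p (Suc n)) - real (Suc n) * c\<bar> \<le> real (Suc n) * \<epsilon> \<Longrightarrow>
      integrable (M n) \<phi> \<and> \<bar>(\<integral>x. \<phi> x \<partial>M n) - c\<bar> \<le> \<epsilon>"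
    by metis
  define a where "a n i = birkhoff_sum (\<phi> i) (Suc n) (p (Suc n)) / real (Suc n)" for n i
  have int: "integrable (M n) (\<phi> i)" "(\<integral>x. \<phi> i x \<partial>M n) = a n i" for n i
    \<comment> \<open>With error 0 around the average itself, closeness becomes equality.\<close>
    using MI[OF pot, of i n "a n i" 0] by (auto simp: a_def)
  have mem: "a n \<in> exact_averages I f \<phi>" for n
    unfolding exact_averages_def using M int by blast
  have "(\<lambda>n. a n i) \<longlonglongrightarrow> \<gamma> i" for i
  proof -
    obtain C where C: "\<And>n \<tau>. \<tau> \<in> reg \<Longrightarrow> prefix_of \<tau> n = prefix_of (itinerary x) n \<Longrightarrow>
        \<bar>birkhoff_sum (\<phi> i) n \<tau> - birkhoff_sum (\<phi> i) n (itinerary x)\<bar> \<le> C + pot_osc (\<phi> i) n"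
      using birkhoff_sum_itinerary_close[OF pot x] by blast
    have close: "\<bar>a n i - birkhoff_sum (\<phi> i) (Suc n) (itinerary x) / real (Suc n)\<bar> \<le> (C + pot_osc (\<phi> i) (Suc n)) / real (Suc n)" for n
    proof -
      have "prefix_of (p (Suc n)) (Suc n) = prefix_of (itinerary x) (Suc n)"
        unfolding p_def using prefix_periodic_code[OF pne, of n] by simp
      moreover have "p (Suc n) \<in> reg" unfolding p_def by (rule periodic_code_reg[OF pne])
      ultimately have "\<bar>birkhoff_sum (\<phi> i) (Suc n) (p (Suc n)) - birkhoff_sum (\<phi> i) (Suc n) (itinerary x)\<bar> \<le> C + pot_osc (\<phi> i) (Suc n)"
        using C by blast
      then show ?thesis
        by (simp add: a_def flip: diff_divide_distrib) (simp add: abs_divide divide_right_mono)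
    qed
    have "(\<lambda>n. (C + pot_osc (\<phi> i) (Suc n)) / real (Suc n)) \<longlonglongrightarrow> 0"
    proof (rule LIMSEQ_I)
      fix e :: real assume e: "0 < e"
      then obtain K where K: "\<And>n. pot_osc (\<phi> i) n \<le> K + e/2 * real n" "K \<ge> 0"
        using pot_osc_sublinear[OF pot, of "e/2"] by auto
      obtain N where N: "2 * (\<bar>C\<bar> + K) / e < real N" using reals_Archimedean2 by blast
      have "norm ((C + pot_osc (\<phi> i) (Suc n)) / real (Suc n) - 0) < e" if "n \<ge> N" for n
      proof -
        have "\<bar>C + pot_osc (\<phi> i) (Suc n)\<bar> \<le> \<bar>C\<bar> + K + e * real (Suc n) / 2"
          using K(1)[of "Suc n"] cum_modulus_nonneg[of "\<lambda>w. basic_interval I f w \<inter> \<Lambda>" "\<lambda>w. \<phi> i" "Suc n"] by linarith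
        moreover have "2 * (\<bar>C\<bar> + K) < e * real (Suc n)"
        proof -
          have "2 * (\<bar>C\<bar> + K) < e * real N" using N e by (simp add: field_simps)
          also have "\<dots> \<le> e * real (Suc n)" using e that by simp
          finally show ?thesis .
        qed
        ultimately have "\<bar>C + pot_osc (\<phi> i) (Suc n)\<bar> < e * real (Suc n)"
          by (smt (verit, best) field_sum_of_halves)
        then show ?thesis by (simp add: abs_divide pos_divide_less_eq)
      qed
      then show "\<exists>N. \<forall>n\<ge>N. norm ((C + pot_osc (\<phi> i) (Suc n)) / real (Suc n) - 0) < e" by blast
    qed
    then have "(\<lambda>n. a n i - birkhoff_sum (\<phi> i) (Suc n) (itinerary x) / real (Suc n)) \<longlonglongrightarrow> 0"
      by (rule Lim_null_comparison[rotated]) (use close in simp)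
    from tendsto_add[OF this LIMSEQ_Suc[OF lim[of i]]] show ?thesis by simp
  qed
  then have "a \<longlonglongrightarrow> \<gamma>"
    using limitin_componentwise[of "\<lambda>_. euclideanreal" UNIV a \<gamma> sequentially]
    by (simp add: euclidean_product_topology)
  then show ?thesis
    unfolding approx_averages_def closure_sequential using mem by blast
qed

end

section \<open>Entropy along the cylinder partitions\<close>

lemma nn_integral_countable_valued:
  fixes X :: "'a \<Rightarrow> 'c::countable" and h :: "'c \<Rightarrow> ennreal"
  assumes X: "X \<in> measurable M (count_space UNIV)" and A: "\<And>x. x \<in> space M \<Longrightarrow> X x \<in> A"
  shows "(\<integral>\<^sup>+x. h (X x) \<partial>M) = (\<Sum>\<^sub>\<infinity>w\<in>A. h w * emeasure M (X -` {w} \<inter> space M))"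
proof -
  let ?E = "\<lambda>w. X -` {w} \<inter> space M"
  have E [measurable]: "?E w \<in> sets M" for w
    using X by (rule measurable_sets) simp
  have hX [measurable]: "(\<lambda>x. h (X x)) \<in> borel_measurable M"
    by (rule measurable_compose[OF X]) simp
  define g where "g F x = (\<Sum>w\<in>F. h w * indicator (?E w) x)" for F x
  have gm [measurable]: "g F \<in> borel_measurable M" for F
    unfolding g_def by measurable
  have gi: "(\<integral>\<^sup>+x. g F x \<partial>M) = (\<Sum>w\<in>F. h w * emeasure M (?E w))" for F
    unfolding g_def by (simp add: nn_integral_sum nn_integral_cmult_indicator)
  have gv: "g F x = (if X x \<in> F then h (X x) else 0)" if "finite F" "x \<in> space M" for F x
  proof -
    have "g F x = (\<Sum>w\<in>F. if w = X x then h w else 0)"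
      unfolding g_def using that by (intro sum.cong) (auto simp: indicator_def)
    then show ?thesis using that(1) by (simp add: sum.delta)
  qed
  \<comment> \<open>The unordered sum, which is how \<open>partition_entropy\<close> is defined, is
    a supremum over finite sets, that is, over integrals of the simple functions
    \<open>g F\<close>.\<close>
  have inf: "(\<Sum>\<^sub>\<infinity>w\<in>A. h w * emeasure M (?E w)) = (SUP F\<in>{F. finite F \<and> F \<subseteq> A}. \<integral>\<^sup>+x. g F x \<partial>M)"
    unfolding gi by (rule nonneg_infsum_complete) simp
  show ?thesis unfolding inf
  proof (rule antisym)
    define F where "F k = {w \<in> A. to_nat w < k}" for k
    have fin: "finite (F k)" for k
      unfolding F_def by (rule finite_subset[OF _ finite_vimageI[of "{..<k}" to_nat]]) auto
    have "(\<integral>\<^sup>+x. h (X x) \<partial>M) = (\<integral>\<^sup>+x. (SUP k. g (F k) x) \<partial>M)"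
    proof (rule nn_integral_cong)
      fix x assume x: "x \<in> space M"
      have "(SUP k. g (F k) x) = h (X x)"
      proof (rule antisym)
        show "(SUP k. g (F k) x) \<le> h (X x)" using gv[OF fin x] by (intro SUP_least) auto
        have "X x \<in> F (Suc (to_nat (X x)))" using A[OF x] by (simp add: F_def)
        then show "h (X x) \<le> (SUP k. g (F k) x)"
          using gv[OF fin x] by (intro SUP_upper2[of "Suc (to_nat (X x))"]) auto
      qed
      then show "h (X x) = (SUP k. g (F k) x)" by simp
    qed
    also have "\<dots> = (SUP k. \<integral>\<^sup>+x. g (F k) x \<partial>M)"
    proof (rule nn_integral_monotone_convergence_SUP)
      show "incseq (\<lambda>k. g (F k))"
        unfolding g_def incseq_def le_fun_def
        using fin by (auto intro!: sum_mono2 simp: F_def)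
    qed simp
    also have "\<dots> \<le> (SUP F\<in>{F. finite F \<and> F \<subseteq> A}. \<integral>\<^sup>+x. g F x \<partial>M)"
      using fin by (intro SUP_least SUP_upper) (auto simp: F_def)
    finally show "(\<integral>\<^sup>+x. h (X x) \<partial>M) \<le> (SUP F\<in>{F. finite F \<and> F \<subseteq> A}. \<integral>\<^sup>+x. g F x \<partial>M)" .
    show "(SUP F\<in>{F. finite F \<and> F \<subseteq> A}. \<integral>\<^sup>+x. g F x \<partial>M) \<le> (\<integral>\<^sup>+x. h (X x) \<partial>M)"
      by (intro SUP_least nn_integral_mono) (auto simp: gv)
  qed
qed

text \<open>Fekete's lemma with the limit identified as the infimum. The resulting bound at every
  fixed \<open>n\<close> is used to transfer an entropy gap to one chosen level.\<close>

lemma fekete: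
  fixes a :: "nat \<Rightarrow> real"
  assumes sub: "\<And>m n. a (m + n) \<le> a m + a n" and nonneg: "\<And>n. 0 \<le> a n"
  shows "\<exists>h\<ge>0. (\<lambda>n. a n / real n) \<longlonglongrightarrow> h \<and> (\<forall>n. real n * h \<le> a n)"
proof -
  define h where "h = (INF n\<in>{1..}. a n / real n)"
  have bdd: "bdd_below ((\<lambda>n. a n / real n) ` {1..})"
    using nonneg by (intro bdd_belowI[of _ 0]) auto
  have h0: "0 \<le> h" unfolding h_def using nonneg by (intro cINF_greatest) auto
  have le: "h \<le> a n / real n" if "n \<ge> 1" for n
    unfolding h_def using bdd that by (intro cINF_lower) auto
  have hn: "real n * h \<le> a n" for n
  proof (cases "n = 0")
    case False
    then show ?thesis using le[of n] by (simp add: field_simps)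
  qed (use nonneg in auto)
  have mult: "a (q * k + i) \<le> real q * a k + a i" for q k i
  proof (induction q)
    case (Suc q)
    have "a (Suc q * k + i) \<le> a k + a (q * k + i)" using sub[of k "q * k + i"] by (simp add: add.assoc)
    then show ?case using Suc by (simp add: algebra_simps)
  qed simp
  have "(\<lambda>n. a n / real n) \<longlonglongrightarrow> h"
  proof (rule LIMSEQ_I)
    fix e :: real assume e: "0 < e"
    have "\<exists>k\<in>{1..}. a k / real k < h + e/2"
      using cINF_less_iff[OF _ bdd, of "h + e/2"] e unfolding h_def by auto
    then obtain k where k: "k \<ge> 1" "a k / real k < h + e/2" by auto
    define B where "B = (\<Sum>i<k. a i)"
    have B: "a i \<le> B" if "i < k" for i unfolding B_def using nonneg that by (intro member_le_sum) auto
    obtain N where N: "2 * B / e < real N" using reals_Archimedean2 by blast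
    have "norm (a n / real n - h) < e" if n: "n \<ge> max 1 N" for n
    proof -
      have npos: "0 < real n" using n by simp
      have "a n \<le> real (n div k) * a k + a (n mod k)" using mult[of "n div k" k "n mod k"] by simp
      also have "\<dots> \<le> real (n div k) * a k + B" using B[of "n mod k"] k by simp
      also have "real (n div k) * a k = real (n div k * k) * (a k / real k)" using k by simp
      also have "\<dots> \<le> real n * (a k / real k)"
        using nonneg by (intro mult_right_mono) (simp_all only: of_nat_le_iff div_times_less_eq_dividend divide_nonneg_nonneg of_nat_0_le_iff)
      also have "\<dots> < real n * (h + e/2)" using k npos by (intro mult_strict_left_mono) auto
      finally have "a n < real n * (h + e/2) + B" by simp
      moreover have "2 * B < e * real n"
      proof -
        have "2 * B < e * real N" using N e by (simp add: field_simps)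
        also have "\<dots> \<le> e * real n" using n e by simp
        finally show ?thesis .
      qed
      ultimately have "a n < real n * (h + e)" by (simp add: algebra_simps)
      then have "a n / real n < h + e" using npos by (simp add: pos_divide_less_eq mult.commute)
      moreover have "h \<le> a n / real n" using le n by simp
      ultimately show ?thesis by simp
    qed
    then show "\<exists>N. \<forall>n\<ge>N. norm (a n / real n - h) < e" by blast
  qed
  then show ?thesis using h0 hn by blast
qed

context expanding_system
begin

abbreviation word :: "nat \<Rightarrow> real \<Rightarrow> nat list" where
  "word n x \<equiv> prefix_of (itinerary x) n"

abbreviation H :: "real measure \<Rightarrow> nat \<Rightarrow> ennreal" where
  "H \<equiv> partition_entropy I f"

definition cyl_prob :: "real measure \<Rightarrow> nat list \<Rightarrow> real" where
  "cyl_prob \<mu> w = measure \<mu> (basic_interval I f w \<inter> \<Lambda>)"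

lemma word_add: "word (m + n) x = word m x @ word n ((T ^^ m) x)"
  by (simp add: prefix_of_add shift_code_itinerary)

text \<open>Off the null complement of \<open>R\<close>, a basic interval consists of the points
  whose itinerary begins with the word, so entropy can be computed from the random word
  \<open>word n\<close>.\<close>

lemma cyl_prob_alt:
  assumes "\<mu> \<in> invariant_measures I f" "length w = n"
  shows "cyl_prob \<mu> w = measure \<mu> (word n -` {w} \<inter> space \<mu>)"
    and "emeasure \<mu> (word n -` {w} \<inter> space \<mu>) = ennreal (cyl_prob \<mu> w)"
    and "word n -` {w} \<inter> space \<mu> \<in> sets \<mu>"
proof -
  interpret prob_space \<mu> by (rule invariantD[OF assms(1)])
  have s: "sets \<mu> = sets BL" "space \<mu> = \<Lambda>" using invariantD[OF assms(1)] by auto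
  show m: "word n -` {w} \<inter> space \<mu> \<in> sets \<mu>"
    using measurable_sets[OF itinerary_word_measurable[of n], of "{w}"] s by simp
  have "basic_interval I f w \<inter> \<Lambda> = (W w \<inter> \<Lambda>) - (multiply_coded I f \<inter> \<Lambda>)"
    by (auto simp: basic_interval_def)
  moreover have "multiply_coded I f \<inter> \<Lambda> \<in> sets BL"
    using countable_multiply_coded by (intro sets_BL_countable) auto
  ultimately have b: "basic_interval I f w \<inter> \<Lambda> \<in> sets \<mu>"
    using W_sets_BL s by auto
  have "AE x in \<mu>. x \<in> basic_interval I f w \<inter> \<Lambda> \<longleftrightarrow> x \<in> word n -` {w} \<inter> space \<mu>"
    using AE_R[OF assms(1)]
    by eventually_elim (use assms(2) s reg_in_basic_iff itinerary_cod in auto)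
  then show p: "cyl_prob \<mu> w = measure \<mu> (word n -` {w} \<inter> space \<mu>)"
    unfolding cyl_prob_def by (intro measure_eq_AE b m)
  show "emeasure \<mu> (word n -` {w} \<inter> space \<mu>) = ennreal (cyl_prob \<mu> w)"
    by (simp add: p emeasure_eq_measure)
qed

lemma cyl_prob_nonneg: "0 \<le> cyl_prob \<mu> w"
  by (simp add: cyl_prob_def)

lemma cyl_prob_le_1: "\<mu> \<in> invariant_measures I f \<Longrightarrow> cyl_prob \<mu> w \<le> 1"
  unfolding cyl_prob_def using invariantD(1) prob_space.prob_le_1 by blast

lemma sum_cyl_prob_le_1:
  assumes "\<mu> \<in> invariant_measures I f" "finite F" "\<And>w. w \<in> F \<Longrightarrow> length w = n"
  shows "(\<Sum>w\<in>F. cyl_prob \<mu> w) \<le> 1"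
proof -
  interpret prob_space \<mu> by (rule invariantD[OF assms(1)])
  have "(\<Sum>w\<in>F. cyl_prob \<mu> w) = (\<Sum>w\<in>F. measure \<mu> (word n -` {w} \<inter> space \<mu>))"
    using assms by (intro sum.cong) (auto intro: cyl_prob_alt)
  also have "\<dots> = measure \<mu> (\<Union>w\<in>F. word n -` {w} \<inter> space \<mu>)"
    using assms by (intro finite_measure_finite_Union[symmetric])
      (auto simp: disjoint_family_on_def intro: cyl_prob_alt)
  finally show ?thesis by simp
qed

lemma word_measurable:
  assumes "\<mu> \<in> invariant_measures I f"
  shows "(\<lambda>x. word n ((T ^^ k) x)) \<in> measurable \<mu> (count_space UNIV)"
    and "(\<lambda>x. h (word n ((T ^^ k) x))) \<in> measurable \<mu> (borel :: 'b::topological_space measure)"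
proof -
  have m: "(\<lambda>x. word n ((T ^^ k) x)) \<in> measurable BL (count_space UNIV)"
    by (rule measurable_compose[OF T_pow_measurable itinerary_word_measurable])
  then show 1: "(\<lambda>x. word n ((T ^^ k) x)) \<in> measurable \<mu> (count_space UNIV)"
    using invariantD(2)[OF assms] by (simp cong: measurable_cong_sets)
  show "(\<lambda>x. h (word n ((T ^^ k) x))) \<in> measurable \<mu> (borel :: 'b measure)"
    by (rule measurable_compose[OF 1]) simp
qed

lemma word_measurable_0:
  assumes "\<mu> \<in> invariant_measures I f"
  shows "word n \<in> measurable \<mu> (count_space UNIV)"
    and "(\<lambda>x. h (word n x)) \<in> measurable \<mu> (borel :: 'b::topological_space measure)"
  using word_measurable(1)[OF assms, of 0 n] word_measurable(2)[OF assms, of h 0 n]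
  unfolding funpow_0 by blast+

text \<open>Entropy as the mean of the information function; inequalities between entropies then
  follow from pointwise ones.\<close>

lemma partition_entropy_eq:
  assumes "\<mu> \<in> invariant_measures I f"
  shows "H \<mu> n = (\<integral>\<^sup>+x. ennreal (- ln (cyl_prob \<mu> (word n x))) \<partial>\<mu>)"
proof -
  note X = word_measurable_0(1)[OF assms]
  have "(\<integral>\<^sup>+x. ennreal (- ln (cyl_prob \<mu> (word n x))) \<partial>\<mu>)
      = (\<Sum>\<^sub>\<infinity>w\<in>{w. length w = n}. ennreal (- ln (cyl_prob \<mu> w)) * emeasure \<mu> (word n -` {w} \<inter> space \<mu>))"
    by (rule nn_integral_countable_valued[OF X]) simp
  also have "\<dots> = H \<mu> n"
    unfolding partition_entropy_def Let_def cyl_prob_def[symmetric]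
  proof (intro infsum_cong)
    fix w :: "nat list" assume w: "w \<in> {w. length w = n}"
    have "ennreal (- ln (cyl_prob \<mu> w)) * ennreal (cyl_prob \<mu> w) = ennreal (- ln (cyl_prob \<mu> w) * cyl_prob \<mu> w)"
      by (rule ennreal_mult''[OF cyl_prob_nonneg, symmetric])
    then show "ennreal (- ln (cyl_prob \<mu> w)) * emeasure \<mu> (word n -` {w} \<inter> space \<mu>) = ennreal (- (cyl_prob \<mu> w * ln (cyl_prob \<mu> w)))"
      using w cyl_prob_alt(2)[OF assms, of w n] by (simp add: mult.commute)
  qed
  finally show ?thesis by simp
qed

text \<open>There are countably many words, so the cylinders of mass 0 form a null set. This
  discards the points at which the convention \<open>ln 0 = 0\<close> would falsify pointwise
  estimates.\<close>

lemma AE_cyl_prob_pos: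
  assumes "\<mu> \<in> invariant_measures I f"
  shows "AE x in \<mu>. 0 < cyl_prob \<mu> (word n ((T ^^ k) x))" "AE x in \<mu>. 0 < cyl_prob \<mu> (word n x)"
proof -
  note X = word_measurable_0(1)[OF assms]
  define h :: "nat list \<Rightarrow> ennreal" where "h w = (if cyl_prob \<mu> w = 0 then 1 else 0)" for w
  have "(\<integral>\<^sup>+x. h (word n x) \<partial>\<mu>)
      = (\<Sum>\<^sub>\<infinity>w\<in>{w. length w = n}. h w * emeasure \<mu> (word n -` {w} \<inter> space \<mu>))"
    by (rule nn_integral_countable_valued[OF X]) simp
  also have "\<dots> = 0"
    using assms by (intro infsum_0) (simp add: cyl_prob_alt(2) h_def)
  finally have h0: "(\<integral>\<^sup>+x. h (word n x) \<partial>\<mu>) = 0" .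
  show 1: "AE x in \<mu>. 0 < cyl_prob \<mu> (word n ((T ^^ k) x))" for k
  proof -
    have "(\<integral>\<^sup>+x. h (word n ((T ^^ k) x)) \<partial>\<mu>) = 0"
      unfolding h0[symmetric]
      by (rule invariant_nn_integral[OF assms, of "\<lambda>x. h (word n x)"])
        (rule measurable_compose[OF itinerary_word_measurable], simp)
    then have "AE x in \<mu>. h (word n ((T ^^ k) x)) = 0"
      using nn_integral_0_iff_AE[OF word_measurable(2)[OF assms, of h k n]] by blast
    then show ?thesis
    proof eventually_elim
      case (elim x)
      then have "cyl_prob \<mu> (word n ((T ^^ k) x)) \<noteq> 0" by (auto simp: h_def split: if_splits)
      then show ?case using cyl_prob_nonneg by (simp add: less_le)
    qed
  qed
  show "AE x in \<mu>. 0 < cyl_prob \<mu> (word n x)" using 1[of 0] unfolding funpow_0 .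
qed

lemma cyl_prob_append_le:
  assumes "\<mu> \<in> invariant_measures I f"
  shows "cyl_prob \<mu> (u @ v) \<le> cyl_prob \<mu> u"
proof -
  interpret prob_space \<mu> by (rule invariantD[OF assms])
  show ?thesis
    unfolding cyl_prob_alt(1)[OF assms refl]
    using cyl_prob_alt(3)[OF assms refl] by (intro finite_measure_mono) (auto simp: word_add)
qed

text \<open>The inequality \<open>ln t \<le> t - 1\<close> is applied to the ratio \<open>q\<close>
  between the product law of the two subwords and their joint law; the mean of that ratio is at most
  1.\<close>

lemma entropy_subadditive:
  assumes \<mu>: "\<mu> \<in> invariant_measures I f"
  shows "H \<mu> (n + m) \<le> H \<mu> n + H \<mu> m"
proof -
  interpret prob_space \<mu> by (rule invariantD[OF \<mu>])
  let ?p = "cyl_prob \<mu>"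
  let ?a = "\<lambda>x. word n x" and ?b = "\<lambda>x. word m ((T ^^ n) x)"
  let ?X = "\<lambda>x. (?a x, ?b x)"
  note wm = word_measurable(2)[OF \<mu>]
  note wm0 = word_measurable_0(2)[OF \<mu>]
  define q where "q = (\<lambda>(u, v). ennreal (?p u * ?p v / ?p (u @ v)))"
  have qm: "(\<lambda>x. q (?X x)) \<in> borel_measurable \<mu>"
  proof -
    have "(\<lambda>x. (\<lambda>w. q (take n w, drop n w)) (word (n + m) x)) \<in> borel_measurable \<mu>"
      by (rule wm0)
    then show ?thesis by (simp add: word_add)
  qed
  have Xm: "?X \<in> measurable \<mu> (count_space UNIV)"
  proof -
    have "(\<lambda>x. (\<lambda>w. (take n w, drop n w)) (word (n + m) ((T ^^ 0) x))) \<in> measurable \<mu> (count_space UNIV)"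
      by (rule measurable_compose[OF word_measurable(1)[OF \<mu>]]) simp
    then show ?thesis by (simp add: word_add)
  qed
  have "(\<integral>\<^sup>+x. q (?X x) \<partial>\<mu>)
      = (\<Sum>\<^sub>\<infinity>w\<in>{u. length u = n} \<times> {v. length v = m}. q w * emeasure \<mu> (?X -` {w} \<inter> space \<mu>))"
    by (rule nn_integral_countable_valued[OF Xm]) simp
  also have "\<dots> \<le> 1"
    unfolding nonneg_infsum_complete[OF zero_le]
  proof (intro SUP_least)
    fix F :: "(nat list \<times> nat list) set"
    assume "F \<in> {F. finite F \<and> F \<subseteq> {u. length u = n} \<times> {v. length v = m}}"
    then have F: "finite F" "\<And>u v. (u, v) \<in> F \<Longrightarrow> length u = n \<and> length v = m" by auto
    \<comment> \<open>The mass of the joined cylinder cancels the denominator of \<open>q\<close>,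
      leaving a product of marginals whose sum over any finite set is at most 1.\<close>
    have tm: "q w * emeasure \<mu> (?X -` {w} \<inter> space \<mu>) \<le> ennreal (?p (fst w) * ?p (snd w))" if w: "w \<in> F" for w
    proof -
      obtain u v where uv: "w = (u, v)" "length u = n" "length v = m" using F(2) w by (cases w) auto
      have "?X -` {w} \<inter> space \<mu> = word (n + m) -` {u @ v} \<inter> space \<mu>"
        using uv by (auto simp: word_add)
      then have "emeasure \<mu> (?X -` {w} \<inter> space \<mu>) = ennreal (?p (u @ v))"
        using cyl_prob_alt(2)[OF \<mu>, of "u @ v" "n + m"] uv by simp
      then show ?thesis
        using cyl_prob_nonneg[of \<mu>] by (cases "?p (u @ v) = 0")
          (simp_all add: uv(1) q_def flip: ennreal_mult)
    qed
    have "(\<Sum>w\<in>F. q w * emeasure \<mu> (?X -` {w} \<inter> space \<mu>)) \<le> (\<Sum>w\<in>F. ennreal (?p (fst w) * ?p (snd w)))"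
      by (rule sum_mono) (rule tm)
    also have "\<dots> = ennreal (\<Sum>w\<in>F. ?p (fst w) * ?p (snd w))"
      using cyl_prob_nonneg[of \<mu>] by (intro sum_ennreal) simp
    also have "(\<Sum>w\<in>F. ?p (fst w) * ?p (snd w)) \<le> (\<Sum>w\<in>fst ` F \<times> snd ` F. ?p (fst w) * ?p (snd w))"
      using F(1) cyl_prob_nonneg[of \<mu>] by (intro sum_mono2) (auto simp: image_iff Bex_def)
    also have "\<dots> = (\<Sum>u\<in>fst ` F. ?p u) * (\<Sum>v\<in>snd ` F. ?p v)"
      by (simp add: sum_product sum.cartesian_product case_prod_beta')
    also have "\<dots> \<le> 1 * 1"
      using F cyl_prob_nonneg[of \<mu>] by (intro mult_mono sum_cyl_prob_le_1[OF \<mu>] sum_nonneg) auto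
    finally show "(\<Sum>w\<in>F. q w * emeasure \<mu> (?X -` {w} \<inter> space \<mu>)) \<le> 1"
      by (simp add: ennreal_leI)
  qed
  finally have q1: "(\<integral>\<^sup>+x. q (?X x) \<partial>\<mu>) \<le> 1" .
  \<comment> \<open>Adding 1 on the left balances the mean of \<open>q\<close> on the right, so no
    subtraction of possibly infinite values occurs; the two units are cancelled at the end.\<close>
  have "H \<mu> (n + m) + 1 = (\<integral>\<^sup>+x. ennreal (- ln (?p (word (n + m) x))) + 1 \<partial>\<mu>)"
    unfolding partition_entropy_eq[OF \<mu>]
    using wm0[of "\<lambda>w. ennreal (- ln (?p w))"] by (subst nn_integral_add) (auto simp: emeasure_space_1)
  also have "\<dots> \<le> (\<integral>\<^sup>+x. (ennreal (- ln (?p (?a x))) + ennreal (- ln (?p (?b x)))) + q (?X x) \<partial>\<mu>)"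
  proof (rule nn_integral_mono_AE)
    show "AE x in \<mu>. ennreal (- ln (?p (word (n + m) x))) + 1
        \<le> (ennreal (- ln (?p (?a x))) + ennreal (- ln (?p (?b x)))) + q (?X x)"
      using AE_cyl_prob_pos(2)[OF \<mu>, of n] AE_cyl_prob_pos(2)[OF \<mu>, of "n + m"] AE_cyl_prob_pos(1)[OF \<mu>, of n m]
    proof eventually_elim
      case (elim x)
      have ab: "word (n + m) x = ?a x @ ?b x" by (rule word_add)
      let ?u = "?p (?a x)" and ?v = "?p (?b x)" and ?w = "?p (?a x @ ?b x)"
      have pos: "0 < ?u" "0 < ?w" and le1: "?u \<le> 1" "?v \<le> 1" "?w \<le> 1"
        using elim cyl_prob_le_1[OF \<mu>] by (auto simp: ab)
      have v: "0 < ?v" by (rule elim(3))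
      show ?case
      proof -
        have "ln (?u * ?v / ?w) \<le> ?u * ?v / ?w - 1"
          using pos v by (intro ln_le_minus_one) simp
        then have "- ln ?w + 1 \<le> - ln ?u + - ln ?v + ?u * ?v / ?w"
          using pos v by (simp add: ln_mult ln_div)
        then have "ennreal (- ln ?w + 1) \<le> ennreal (- ln ?u + - ln ?v + ?u * ?v / ?w)"
          by (rule ennreal_leI)
        moreover have "ennreal (- ln ?w + 1) = ennreal (- ln ?w) + 1"
          using pos le1 by (subst ennreal_plus) auto
        moreover have "ennreal (- ln ?u + - ln ?v + ?u * ?v / ?w)
            = ennreal (- ln ?u) + ennreal (- ln ?v) + ennreal (?u * ?v / ?w)"
        proof -
          have "0 \<le> - ln ?u" "0 \<le> - ln ?v" "0 \<le> ?u * ?v / ?w" using pos v le1 by auto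
          then show ?thesis by (metis add_nonneg_nonneg ennreal_plus)
        qed
        ultimately show ?thesis by (simp add: ab q_def)
      qed
    qed
  qed
  also have "\<dots> = (H \<mu> n + H \<mu> m) + (\<integral>\<^sup>+x. q (?X x) \<partial>\<mu>)"
  proof -
    have "(\<integral>\<^sup>+x. ennreal (- ln (?p (?b x))) \<partial>\<mu>) = H \<mu> m"
      unfolding partition_entropy_eq[OF \<mu>]
      by (rule invariant_nn_integral[OF \<mu>, of "\<lambda>x. ennreal (- ln (?p (word m x)))"])
        (rule measurable_compose[OF itinerary_word_measurable], simp)
    then show ?thesis
      using wm0[of "\<lambda>w. ennreal (- ln (?p w))" n] wm[of "\<lambda>w. ennreal (- ln (?p w))" n m] qm
      by (simp add: nn_integral_add partition_entropy_eq[OF \<mu>])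
  qed
  also have "\<dots> \<le> (H \<mu> n + H \<mu> m) + 1" using q1 by (rule add_left_mono)
  finally show ?thesis
    by (simp add: add.commute[of _ 1] ennreal_add_left_cancel_le)
qed

lemma entropy_mono_1:
  assumes \<mu>: "\<mu> \<in> invariant_measures I f" and n: "n \<ge> 1"
  shows "H \<mu> 1 \<le> H \<mu> n"
  unfolding partition_entropy_eq[OF \<mu>]
proof (rule nn_integral_mono_AE)
  show "AE x in \<mu>. ennreal (- ln (cyl_prob \<mu> (word 1 x))) \<le> ennreal (- ln (cyl_prob \<mu> (word n x)))"
    using AE_cyl_prob_pos(2)[OF \<mu>, of n]
  proof eventually_elim
    case (elim x)
    have "cyl_prob \<mu> (word n x) \<le> cyl_prob \<mu> (word 1 x)"
      using cyl_prob_append_le[OF \<mu>, of "word 1 x" "word (n - 1) ((T ^^ 1) x)"] n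
      unfolding word_add[symmetric] by simp
    then show ?case using elim by (intro ennreal_leI) simp
  qed
qed

text \<open>Entropies of finer partitions dominate that of the first one. Contrapositively, a
  measure with finite entropy has \<open>H \<mu> 1 < \<infinity>\<close>, the entry condition of
  \<open>entropy_converges\<close>.\<close>

lemma entropy_infinite:
  assumes \<mu>: "\<mu> \<in> invariant_measures I f" and inf: "H \<mu> 1 = \<infinity>"
  shows "entropy_of I f \<mu> = \<infinity>"
proof -
  have "eventually (\<lambda>n. \<infinity> = H \<mu> n / of_nat n) sequentially"
    unfolding eventually_sequentially
  proof (intro exI[of _ 1] allI impI)
    fix n :: nat assume n: "1 \<le> n"
    then have "H \<mu> n = \<infinity>" using entropy_mono_1[OF \<mu> n] inf by (simp add: top.extremum_unique)
    then show "\<infinity> = H \<mu> n / of_nat n" by (simp add: ennreal_of_nat_eq_real_of_nat ennreal_top_divide)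
  qed
  then have "(\<lambda>n. H \<mu> n / of_nat n) \<longlonglongrightarrow> \<infinity>"
    by (rule Lim_transform_eventually[OF tendsto_const])
  then show ?thesis unfolding entropy_of_def by (rule limI)
qed

text \<open>Finiteness at level 1 spreads to all levels by subadditivity, after which Fekete's lemma
  applies to real numbers and shows that the \<open>lim\<close> in \<open>entropy_of\<close> is a
  genuine limit.\<close>

lemma entropy_converges:
  assumes \<mu>: "\<mu> \<in> invariant_measures I f" and fin: "H \<mu> 1 < \<infinity>"
  obtains h where "0 \<le> h" "entropy_of I f \<mu> = ennreal h"
    and "\<And>n. H \<mu> n < \<infinity>" "\<And>n. real n * h \<le> enn2real (H \<mu> n)"
    and "(\<lambda>n. enn2real (H \<mu> n) / real n) \<longlonglongrightarrow> h"
proof -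
  interpret prob_space \<mu> by (rule invariantD[OF \<mu>])
  have H0: "H \<mu> 0 = 0"
  proof -
    have "cyl_prob \<mu> [] = 1"
      using cyl_prob_alt(1)[OF \<mu>, of "[]" 0] prob_space by simp
    then show ?thesis by (simp add: partition_entropy_eq[OF \<mu>])
  qed
  have Hfin: "H \<mu> n < \<infinity>" for n
  proof (induction n)
    case (Suc n)
    have "H \<mu> (Suc n) \<le> H \<mu> n + H \<mu> 1" using entropy_subadditive[OF \<mu>, of n 1] by simp
    also have "\<dots> < \<infinity>" using Suc fin by simp
    finally show ?case .
  qed (simp add: H0)
  define a where "a n = enn2real (H \<mu> n)" for n
  have Ha: "H \<mu> n = ennreal (a n)" for n using Hfin[of n] by (simp add: a_def)
  have a0: "0 \<le> a n" for n by (simp add: a_def)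
  have "a (m + n) \<le> a m + a n" for m n
  proof -
    have "ennreal (a (m + n)) \<le> ennreal (a m + a n)"
      using entropy_subadditive[OF \<mu>, of m n] a0 unfolding Ha by simp
    then show ?thesis using a0[of m] a0[of n] by (subst (asm) ennreal_le_iff) auto
  qed
  from fekete[of a, OF this a0]
  obtain h where h: "h \<ge> 0" "(\<lambda>n. a n / real n) \<longlonglongrightarrow> h" "\<forall>n. real n * h \<le> a n"
    by blast
  have "(\<lambda>n. ennreal (a n / real n)) \<longlonglongrightarrow> ennreal h"
    using h(2) by (rule tendsto_ennrealI)
  moreover have "ennreal (a n / real n) = H \<mu> n / of_nat n" if "n \<ge> 1" for n
    unfolding Ha ennreal_of_nat_eq_real_of_nat
    using that a0 by (intro divide_ennreal[symmetric]) auto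
  ultimately have "(\<lambda>n. H \<mu> n / of_nat n) \<longlonglongrightarrow> ennreal h"
    by (elim Lim_transform_eventually) (auto simp: eventually_sequentially intro: exI[of _ 1])
  then have "entropy_of I f \<mu> = ennreal h" unfolding entropy_of_def by (rule limI)
  then show thesis using h Hfin that by (simp add: a_def)
qed

lemma integral_le_enn2real:
  fixes g :: "'b \<Rightarrow> real"
  assumes "integrable M g"
  shows "(\<integral>x. g x \<partial>M) \<le> enn2real (\<integral>\<^sup>+x. ennreal (g x) \<partial>M)"
  using real_lebesgue_integral_def[OF assms] by simp

lemma birkhoff_sum_integral:
  assumes \<mu>: "\<mu> \<in> invariant_measures I f" and g: "integrable \<mu> g"
  shows "integrable \<mu> (\<lambda>x. birkhoff_sum g n (itinerary x))" "(\<integral>x. birkhoff_sum g n (itinerary x) \<partial>\<mu>) = real n * (\<integral>x. g x \<partial>\<mu>)"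
proof -
  have eq: "birkhoff_sum g n (itinerary x) = (\<Sum>j<n. g ((T ^^ j) x))" if "x \<in> space \<mu>" for x
    using birkhoff_sum_itinerary that invariantD(3)[OF \<mu>] by simp
  show "integrable \<mu> (\<lambda>x. birkhoff_sum g n (itinerary x))"
    using invariant_integral(1)[OF \<mu> g] by (subst Bochner_Integration.integrable_cong[OF refl eq]) auto
  have "(\<integral>x. birkhoff_sum g n (itinerary x) \<partial>\<mu>) = (\<integral>x. (\<Sum>j<n. g ((T ^^ j) x)) \<partial>\<mu>)"
    by (rule Bochner_Integration.integral_cong[OF refl eq])
  also have "\<dots> = (\<Sum>j<n. \<integral>x. g ((T ^^ j) x) \<partial>\<mu>)"
    using invariant_integral(1)[OF \<mu> g] by (rule Bochner_Integration.integral_sum)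
  also have "\<dots> = real n * (\<integral>x. g x \<partial>\<mu>)"
    using invariant_integral(2)[OF \<mu> g] by simp
  finally show "(\<integral>x. birkhoff_sum g n (itinerary x) \<partial>\<mu>) = real n * (\<integral>x. g x \<partial>\<mu>)" .
qed

text \<open>The Gibbs upper bound makes the information of a cylinder at least \<open>s\<close>
  times \<open>- ln r\<close>, up to a constant, and \<open>- ln r\<close> is a Birkhoff sum of
  \<open>log |T'|\<close> up to \<open>V\<close>. Integrating and dividing by the length removes
  both errors.\<close>

lemma entropy_ge_lyapunov:
  assumes \<mu>: "\<mu> \<in> invariant_measures I f" and fin: "H \<mu> 1 < \<infinity>" and s: "0 \<le> s" and C: "0 < C"
    and gibbs: "\<And>w. cyl_prob \<mu> w \<le> C * r w powr s" and int: "integrable \<mu> log_expansion"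
  shows "ennreal (s * (\<integral>x. log_expansion x \<partial>\<mu>)) \<le> entropy_of I f \<mu>" "entropy_of I f \<mu> < \<infinity>"
proof -
  interpret prob_space \<mu> by (rule invariantD[OF \<mu>])
  let ?l = "\<integral>x. log_expansion x \<partial>\<mu>"
  obtain h where h: "0 \<le> h" "entropy_of I f \<mu> = ennreal h" "\<And>n. H \<mu> n < \<infinity>"
    and "\<And>n. real n * h \<le> enn2real (H \<mu> n)"
    and lim: "(\<lambda>n. enn2real (H \<mu> n) / real n) \<longlonglongrightarrow> h"
    by (rule entropy_converges[OF \<mu> fin], rule that)
  show "entropy_of I f \<mu> < \<infinity>" using h(2) by simp
  have low: "s * (real m * ?l - V m) - ln C \<le> enn2real (H \<mu> m)" for m
  proof -
    let ?g = "\<lambda>x. s * (birkhoff_sum log_expansion m (itinerary x) - V m) - ln C"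
    note bi = birkhoff_sum_integral[OF \<mu> int, of m]
    have gi: "integrable \<mu> ?g" using bi(1) by simp
    have "s * (real m * ?l - V m) - ln C = (\<integral>x. ?g x \<partial>\<mu>)"
      using bi by (simp add: prob_space)
    also have "\<dots> \<le> enn2real (\<integral>\<^sup>+x. ennreal (?g x) \<partial>\<mu>)" by (rule integral_le_enn2real[OF gi])
    also have "\<dots> \<le> enn2real (H \<mu> m)"
    proof (rule enn2real_mono)
      show "(\<integral>\<^sup>+x. ennreal (?g x) \<partial>\<mu>) \<le> H \<mu> m"
        unfolding partition_entropy_eq[OF \<mu>]
      proof (rule nn_integral_mono_AE)
        show "AE x in \<mu>. ennreal (?g x) \<le> ennreal (- ln (cyl_prob \<mu> (word m x)))"
          using AE_cyl_prob_pos(2)[OF \<mu>, of m] AE_R[OF \<mu>]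
        proof eventually_elim
          case (elim x)
          have rp: "0 < r (word m x)" by (rule r_pos)
          have "ln (cyl_prob \<mu> (word m x)) \<le> ln (C * r (word m x) powr s)"
            using elim(1) gibbs[of "word m x"] by (subst ln_le_cancel_iff) auto
          also have "\<dots> = ln C + s * ln (r (word m x))"
            using C rp by (simp add: ln_mult ln_powr)
          also have "ln (r (word m x)) \<le> V m - birkhoff_sum log_expansion m (itinerary x)"
            using birkhoff_sum_log_expansion_r[of "itinerary x" m] R_itinerary[OF elim(2)] by (simp add: abs_le_iff)
          finally have "ln (cyl_prob \<mu> (word m x)) \<le> ln C + s * (V m - birkhoff_sum log_expansion m (itinerary x))"
            using s by (simp add: mult_left_mono)
          then show ?case by (intro ennreal_leI) (simp add: algebra_simps)
        qed
      qed
      show "H \<mu> m < top" using h(3) by simp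
    qed
    finally show ?thesis .
  qed
  have "s * ?l - s * \<delta> \<le> h" if d: "0 < \<delta>" for \<delta>
  proof -
    obtain K where K: "\<And>n. V n \<le> K + \<delta> * real n" using V_sublinear[OF d] by blast
    have "(\<lambda>m. s * ?l - s * \<delta> - (s * K + ln C) / real m) \<longlonglongrightarrow> s * ?l - s * \<delta> - 0"
      by (intro tendsto_diff tendsto_const lim_const_over_n)
    moreover have "s * ?l - s * \<delta> - (s * K + ln C) / real m \<le> enn2real (H \<mu> m) / real m" if "m \<ge> 1" for m
    proof -
      have "s * V m \<le> s * (K + \<delta> * real m)" using K s by (intro mult_left_mono)
      then have "real m * (s * ?l - s * \<delta>) - (s * K + ln C) \<le> enn2real (H \<mu> m)"
        using low[of m] by (simp add: algebra_simps)
      then have "(real m * (s * ?l - s * \<delta>) - (s * K + ln C)) / real m \<le> enn2real (H \<mu> m) / real m"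
        by (rule divide_right_mono) simp
      then show ?thesis using that by (simp add: diff_divide_distrib)
    qed
    ultimately show ?thesis
      using LIMSEQ_le[OF _ lim, of "\<lambda>m. s * ?l - s * \<delta> - (s * K + ln C) / real m"] by auto
  qed
  then have "s * ?l - h \<le> s * \<delta>" if "0 < \<delta>" for \<delta> using that by (simp add: algebra_simps)
  then have "s * ?l \<le> h"
  proof -
    have "s * ?l - h \<le> 0 + e" if e: "0 < e" for e
    proof -
      \<comment> \<open>Dividing by \<open>s + 1\<close> rather than \<open>s\<close> keeps
        \<open>s = 0\<close> admissible.\<close>
      have "s * (e / (s + 1)) \<le> e" using s e by (simp add: field_simps)
      then show ?thesis using \<open>\<And>\<delta>. 0 < \<delta> \<Longrightarrow> s * ?l - h \<le> s * \<delta>\<close>[of "e / (s + 1)"] s e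
        by (simp add: add_nonneg_pos)
    qed
    then show ?thesis using field_le_epsilon[of "s * ?l - h" 0] by auto
  qed
  then show "ennreal (s * ?l) \<le> entropy_of I f \<mu>" unfolding h(2) by (rule ennreal_leI)
qed

lemma lyapunov_eq:
  assumes \<mu>: "\<mu> \<in> invariant_measures I f"
  shows "lyapunov_exponent I f \<mu> = (\<integral>\<^sup>+x. ennreal (log_expansion x) \<partial>\<mu>)"
    and "lyapunov_exponent I f \<mu> < \<infinity> \<Longrightarrow> integrable \<mu> log_expansion"
    and "integrable \<mu> log_expansion \<Longrightarrow> lyapunov_exponent I f \<mu> = ennreal (\<integral>x. log_expansion x \<partial>\<mu>)"
    and "integrable \<mu> log_expansion \<Longrightarrow> ln \<xi> \<le> (\<integral>x. log_expansion x \<partial>\<mu>)"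
proof -
  interpret prob_space \<mu> by (rule invariantD[OF \<mu>])
  have sp: "space \<mu> = \<Lambda>" by (rule invariantD[OF \<mu>])
  have pos: "0 \<le> log_expansion x" "ln \<xi> \<le> log_expansion x" if "x \<in> space \<mu>" for x
    using log_expansion_ge[of x] ln_\<xi>_pos that sp by auto
  have m: "log_expansion \<in> borel_measurable \<mu>"
    using log_expansion_measurable invariantD(2)[OF \<mu>] by (simp cong: measurable_cong_sets)
  show eq: "lyapunov_exponent I f \<mu> = (\<integral>\<^sup>+x. ennreal (log_expansion x) \<partial>\<mu>)"
    by (simp add: lyapunov_exponent_def log_expansion_def)
  show "lyapunov_exponent I f \<mu> < \<infinity> \<Longrightarrow> integrable \<mu> log_expansion"
    unfolding eq using pos m by (intro integrableI_nonneg) auto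
  show "integrable \<mu> log_expansion \<Longrightarrow> lyapunov_exponent I f \<mu> = ennreal (\<integral>x. log_expansion x \<partial>\<mu>)"
    unfolding eq using pos by (intro nn_integral_eq_integral) auto
  show "ln \<xi> \<le> (\<integral>x. log_expansion x \<partial>\<mu>)" if "integrable \<mu> log_expansion"
  proof -
    have "(\<integral>x. ln \<xi> \<partial>\<mu>) \<le> (\<integral>x. log_expansion x \<partial>\<mu>)"
      using that pos by (intro integral_mono) auto
    then show ?thesis by (simp add: prob_space)
  qed
qed

end

section \<open>Random concatenations of words\<close>

definition concat_blocks :: "(nat \<Rightarrow> nat list) \<Rightarrow> nat \<Rightarrow> nat list" where
  "concat_blocks X m = concat (map X [0..<m])"

text \<open>The infinite concatenation of the blocks: when no block is empty, the first
  \<open>Suc j\<close> of them already contain position \<open>j\<close>.\<close>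

definition block_code :: "(nat \<Rightarrow> nat list) \<Rightarrow> nat \<Rightarrow> nat" where
  "block_code X j = concat_blocks X (Suc j) ! j"

lemma concat_blocks_0 [simp]: "concat_blocks X 0 = []"
  by (simp add: concat_blocks_def)

lemma concat_blocks_Suc: "concat_blocks X (Suc m) = concat_blocks X m @ X m"
  by (simp add: concat_blocks_def)

lemma concat_blocks_add: "concat_blocks X (m + k) = concat_blocks X m @ concat_blocks (\<lambda>i. X (m + i)) k"
  by (induction k) (auto simp: concat_blocks_Suc)

lemma concat_blocks_cong: "(\<And>i. i < m \<Longrightarrow> X i = Y i) \<Longrightarrow> concat_blocks X m = concat_blocks Y m"
  by (induction m) (auto simp: concat_blocks_Suc)

lemma length_concat_blocks_ge: "(\<And>i. X i \<noteq> []) \<Longrightarrow> m \<le> length (concat_blocks X m)"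
proof (induction m)
  case (Suc m)
  have "0 < length (X m)" using Suc.prems[of m] by simp
  then show ?case using Suc.IH[OF Suc.prems] unfolding concat_blocks_Suc length_append by linarith
qed simp

lemma block_code_nth:
  assumes "\<And>i. X i \<noteq> []" "j < length (concat_blocks X m)"
  shows "block_code X j = concat_blocks X m ! j"
proof -
  define M where "M = max m (Suc j)"
  have "j < length (concat_blocks X (Suc j))" using length_concat_blocks_ge[of X "Suc j"] assms(1) by simp
  then have "concat_blocks X M ! j = concat_blocks X (Suc j) ! j"
    using concat_blocks_add[of X "Suc j" "M - Suc j"] by (simp add: M_def nth_append)
  moreover have "concat_blocks X M ! j = concat_blocks X m ! j"
    using concat_blocks_add[of X m "M - m"] assms(2) by (simp add: M_def nth_append)
  ultimately show ?thesis by (simp add: block_code_def)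
qed

lemma prefix_block_code: "(\<And>i. X i \<noteq> []) \<Longrightarrow> prefix_of (block_code X) (length (concat_blocks X m)) = concat_blocks X m"
  by (rule nth_equalityI) (auto simp: block_code_nth)

lemma shift_block_code:
  assumes "\<And>i. X i \<noteq> []"
  shows "shift_code (length (concat_blocks X m)) (block_code X) = block_code (\<lambda>i. X (m + i))"
proof
  fix j
  let ?Y = "\<lambda>i. X (m + i)"
  have l: "j < length (concat_blocks ?Y (Suc j))" using length_concat_blocks_ge[of ?Y "Suc j"] assms by simp
  have "block_code X (length (concat_blocks X m) + j) = concat_blocks X (m + Suc j) ! (length (concat_blocks X m) + j)"
    using l by (intro block_code_nth assms) (simp add: concat_blocks_add del: concat_blocks_Suc add_Suc_right)
  also have "\<dots> = concat_blocks ?Y (Suc j) ! j"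
    unfolding concat_blocks_add[of X m "Suc j"] by (simp add: nth_append)
  finally show "shift_code (length (concat_blocks X m)) (block_code X) j = block_code ?Y j"
    by (simp add: shift_code_apply block_code_def)
qed

context expanding_system
begin

definition block_pmf :: "real \<Rightarrow> nat list set \<Rightarrow> nat list pmf" where
  "block_pmf s F = embed_pmf (\<lambda>w. if w \<in> F then weight w powr s / (\<Sum>v\<in>F. weight v powr s) else 0)"

text \<open>As the total weight is at least 1, normalising can only lower the individual weights.
  This is where the threshold 1 turns into a Gibbs upper bound.\<close>

lemma block_pmf:
  assumes F: "finite F" "1 \<le> (\<Sum>v\<in>F. weight v powr s)"
  shows "pmf (block_pmf s F) w \<le> weight w powr s" "set_pmf (block_pmf s F) \<subseteq> F"
proof -
  let ?Z = "\<Sum>v\<in>F. weight v powr s"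
  let ?g = "\<lambda>w. if w \<in> F then weight w powr s / ?Z else 0"
  have Z: "0 < ?Z" using F(2) by linarith
  have "(\<integral>\<^sup>+w. ennreal (?g w) \<partial>count_space UNIV) = (\<Sum>w\<in>F. ennreal (?g w))"
    using F(1) by (intro nn_integral_count_space') auto
  also have "\<dots> = ennreal (\<Sum>w\<in>F. weight w powr s / ?Z)"
    using Z by (subst sum_ennreal[symmetric]) auto
  also have "(\<Sum>w\<in>F. weight w powr s / ?Z) = 1" using Z by (simp flip: sum_divide_distrib)
  finally have p: "pmf (block_pmf s F) w = ?g w" for w
    unfolding block_pmf_def using Z by (intro pmf_embed_pmf) auto
  have "weight w powr s / ?Z \<le> weight w powr s / 1"
    using F(2) Z by (intro divide_left_mono) auto
  then show "pmf (block_pmf s F) w \<le> weight w powr s" unfolding p by auto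
  show "set_pmf (block_pmf s F) \<subseteq> F"
    by (auto simp: set_pmf_iff p split: if_splits)
qed

lemma r_concat_blocks_ge: "(\<Prod>i<m. weight (b i)) * r v \<le> r (concat_blocks b m @ v)"
proof (induction m arbitrary: v)
  case (Suc m)
  have "(\<Prod>i<Suc m. weight (b i)) * r v = (\<Prod>i<m. weight (b i)) * (weight (b m) * r v)" by simp
  also have "\<dots> \<le> (\<Prod>i<m. weight (b i)) * r (b m @ v)"
    using weight_pos by (intro mult_left_mono r_append_ge prod_nonneg) (auto simp: less_imp_le)
  also have "\<dots> \<le> r (concat_blocks b m @ b m @ v)" by (rule Suc.IH)
  finally show ?case by (simp add: concat_blocks_Suc)
qed simp

text \<open>Displays a coded point as a limit of functions of finitely many symbols, which gives
  measurability of the random point below.\<close>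

lemma cod_limit: "(\<lambda>n. wmap (prefix_of \<omega> n) 0) \<longlonglongrightarrow> cod \<omega>"
proof -
  have "\<bar>wmap (prefix_of \<omega> n) 0 - cod \<omega>\<bar> \<le> (1 / \<xi>) ^ n" for n
  proof -
    have "\<bar>wmap (prefix_of \<omega> n) 0 - cod \<omega>\<bar> \<le> r (prefix_of \<omega> n)"
      using cod_in_W by (intro W_dist) (auto simp: W_eq_image)
    also have "\<dots> \<le> (1 / \<xi>) ^ n"
      using r_le_power[of "prefix_of \<omega> n"] \<xi>_gt_1 by (simp add: power_divide field_simps)
    finally show ?thesis .
  qed
  moreover have "(\<lambda>n. (1 / \<xi>) ^ n) \<longlonglongrightarrow> 0"
    using \<xi>_gt_1 by (intro LIMSEQ_realpow_zero) auto
  ultimately have "(\<lambda>n. wmap (prefix_of \<omega> n) 0 - cod \<omega>) \<longlonglongrightarrow> 0"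
    by (elim Lim_null_comparison[rotated]) simp
  then show ?thesis by (simp add: LIM_zero_iff)
qed

end

text \<open>One setting for both constructions: constant \<open>G\<close> and \<open>L\<close>
  produce the ergodic measures, slowly varying ones the measure on the level set. Words within one
  \<open>G m\<close> share a length, so block boundaries are not random.\<close>

locale block_system = expanding_system \<xi> I f for \<xi> I f +
  fixes s :: real and G :: "nat \<Rightarrow> nat list set" and L :: "nat \<Rightarrow> nat"
  assumes s_pos: "0 < s"
    and finite_G: "\<And>m. finite (G m)"
    and length_G: "\<And>m w. w \<in> G m \<Longrightarrow> length w = L m"
    and L_pos: "\<And>m. 0 < L m"
    and sum_G: "\<And>m. 1 \<le> (\<Sum>w\<in>G m. weight w powr s)"
begin

definition P :: "(nat \<Rightarrow> nat list) measure" where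
  "P = PiM UNIV (\<lambda>m. measure_pmf (block_pmf s (G m)))"

definition pos :: "nat \<Rightarrow> nat" where
  "pos m = (\<Sum>i<m. L i)"

definition good :: "(nat \<Rightarrow> nat list) \<Rightarrow> bool" where
  "good X \<longleftrightarrow> (\<forall>m. X m \<in> G m)"

interpretation PP: product_prob_space "\<lambda>m. measure_pmf (block_pmf s (G m))" UNIV
  by (intro product_prob_spaceI measure_pmf.prob_space_axioms)

lemma prob_space_P: "prob_space P"
  unfolding P_def by (rule PP.P.prob_space_axioms)

sublocale P: prob_space P
  by (rule prob_space_P)

lemma space_P [simp]: "space P = UNIV"
  by (simp add: P_def space_PiM PiE_UNIV_domain)

lemma good_nonempty: "good X \<Longrightarrow> X i \<noteq> []"
  using length_G L_pos unfolding good_def by (metis less_irrefl list.size(3))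

lemma good_length: "good X \<Longrightarrow> length (concat_blocks X m) = pos m"
  by (induction m) (auto simp: concat_blocks_Suc pos_def good_def length_G)

lemma pos_ge: "m \<le> pos m"
proof (induction m)
  case (Suc m)
  then show ?case using L_pos[of m] by (simp add: pos_def)
qed simp

lemma prefix_block_code_good: "good X \<Longrightarrow> prefix_of (block_code X) (pos m) = concat_blocks X m"
  using prefix_block_code[of X m] good_nonempty good_length by simp

lemma shift_block_code_good: "good X \<Longrightarrow> shift_code (pos m) (block_code X) = block_code (\<lambda>i. X (m + i))"
  using shift_block_code[of X m] good_nonempty good_length by simp

text \<open>Deterministic block lengths make the concatenation uniquely decodable.\<close>

lemma block_of_block_code: "good X \<Longrightarrow> X m = prefix_of (shift_code (pos m) (block_code X)) (L m)"
proof -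
  assume g: "good X"
  have "prefix_of (block_code X) (pos m) @ prefix_of (shift_code (pos m) (block_code X)) (L m) = concat_blocks X (Suc m)"
    using prefix_block_code_good[OF g, of "Suc m"] by (simp add: pos_def prefix_of_add)
  then show ?thesis using prefix_block_code_good[OF g, of m] by (simp add: concat_blocks_Suc)
qed

lemma AE_good: "AE X in P. good X"
proof -
  have "AE X in P. X m \<in> G m" for m
  proof -
    have "AE w in measure_pmf (block_pmf s (G m)). w \<in> G m"
      using block_pmf(2)[OF finite_G sum_G] by (auto simp: AE_measure_pmf_iff)
    then show ?thesis
      unfolding P_def by (intro AE_PiM_component measure_pmf.prob_space_axioms) auto
  qed
  then show ?thesis unfolding good_def by (simp add: AE_all_countable)
qed

definition E :: "(nat \<Rightarrow> nat list) \<Rightarrow> nat \<Rightarrow> (nat \<Rightarrow> nat list) set" where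
  "E b m = {X. \<forall>i<m. X i = b i}"

lemma E_prob: "E b m \<in> sets P" "measure P (E b m) \<le> (\<Prod>i<m. weight (b i)) powr s"
proof -
  have e: "E b m = prod_emb UNIV (\<lambda>m. measure_pmf (block_pmf s (G m))) {..<m} (PiE {..<m} (\<lambda>i. {b i}))"
    by (auto simp: E_def prod_emb_def PiE_UNIV_domain restrict_def PiE_def Pi_def extensional_def)
  show "E b m \<in> sets P"
    unfolding e P_def by (rule sets_PiM_I) auto
  have "measure P (E b m) = (\<Prod>i<m. measure (measure_pmf (block_pmf s (G i))) {b i})"
    unfolding e P_def by (rule PP.measure_PiM_emb) auto
  also have "\<dots> \<le> (\<Prod>i<m. weight (b i) powr s)"
    using block_pmf(1)[OF finite_G sum_G] by (intro prod_mono) (auto simp: measure_pmf_single)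
  also have "\<dots> = (\<Prod>i<m. weight (b i)) powr s"
  proof (induction m)
    case (Suc m)
    have "0 \<le> (\<Prod>i<m. weight (b i))" using weight_pos by (intro prod_nonneg) (auto simp: less_imp_le)
    then show ?case using Suc weight_pos[of "b m"] by (simp add: powr_mult)
  qed simp
  finally show "measure P (E b m) \<le> (\<Prod>i<m. weight (b i)) powr s" .
qed

text \<open>The product of the weights bounds the probability, and by
  \<open>r_concat_blocks_ge\<close> it also bounds a quotient of lengths from below. The word
  \<open>v\<close> stands for an incomplete block at the end.\<close>

lemma E_prob_r: "measure P (E b m) \<le> (r (concat_blocks b m @ v) / r v) powr s"
proof -
  have "(\<Prod>i<m. weight (b i)) \<le> r (concat_blocks b m @ v) / r v"
    using r_concat_blocks_ge[of b m v] r_pos[of v] by (simp add: pos_le_divide_eq)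
  moreover have "0 \<le> (\<Prod>i<m. weight (b i))" using weight_pos by (intro prod_nonneg) (auto simp: less_imp_le)
  ultimately show ?thesis using E_prob(2)[of b m] s_pos by (meson order_trans powr_mono2 less_imp_le)
qed

text \<open>A fixed code determines all blocks \<open>b\<close>, and the probability of seeing the
  first \<open>m\<close> of them decays geometrically by contraction. Having no atoms, the law
  misses the countable set of irregular codes.\<close>

lemma AE_block_code_neq: "AE X in P. block_code X \<noteq> \<tau>"
proof -
  define b where "b i = prefix_of (shift_code (pos i) \<tau>) (L i)" for i
  have lenb: "length (concat_blocks b m) = pos m" for m
    by (induction m) (auto simp: concat_blocks_Suc b_def pos_def)
  have bound: "measure P (E b m) \<le> ((1 / \<xi>) powr s) ^ m" for m
  proof -
    have "r (concat_blocks b m) \<le> (1 / \<xi>) ^ length (concat_blocks b m)"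
      using r_le_power[of "concat_blocks b m"] \<xi>_gt_1 by (simp add: power_divide field_simps)
    also have "\<dots> \<le> (1 / \<xi>) ^ m"
      using pos_ge[of m] lenb \<xi>_gt_1 by (intro power_decreasing) auto
    finally have "r (concat_blocks b m) powr s \<le> ((1 / \<xi>) ^ m) powr s"
      using r_pos[of "concat_blocks b m"] s_pos by (intro powr_mono2) auto
    also have "\<dots> = ((1 / \<xi>) powr s) ^ m"
      using \<xi>_gt_1 by (simp add: powr_power powr_realpow[symmetric] powr_powr mult.commute)
    finally show ?thesis using E_prob_r[of b m "[]"] by simp
  qed
  have lt1: "(1 / \<xi>) powr s < 1"
    using \<xi>_gt_1 s_pos by (simp add: powr_divide) 
  have pow0: "(\<lambda>m. ((1 / \<xi>) powr s) ^ m) \<longlonglongrightarrow> 0"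
    using lt1 by (intro LIMSEQ_realpow_zero) auto
  have lim0: "(\<lambda>m. measure P (E b m)) \<longlonglongrightarrow> 0"
    by (rule tendsto_sandwich[OF _ _ tendsto_const pow0]) (auto intro!: always_eventually bound)
  have Esub: "(\<Inter>m. E b m) \<subseteq> E b k" for k by blast
  have Isets: "(\<Inter>m. E b m) \<in> sets P" using E_prob(1) by (intro sets.countable_INT) auto
  have "measure P (\<Inter>m. E b m) \<le> measure P (E b k)" for k
    by (rule P.finite_measure_mono[OF Esub E_prob(1)])
  then have "measure P (\<Inter>m. E b m) \<le> 0"
    by (intro LIMSEQ_le_const[OF lim0]) auto
  then have null: "(\<Inter>m. E b m) \<in> null_sets P"
    using Isets by (auto simp: P.emeasure_eq_measure null_sets_def intro: antisym)
  have "AE X in P. X \<notin> (\<Inter>m. E b m)" by (rule AE_not_in[OF null])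
  with AE_good show ?thesis
  proof eventually_elim
    case (elim X)
    show ?case
    proof
      assume "block_code X = \<tau>"
      then have "X i = b i" for i using block_of_block_code[OF elim(1), of i] by (simp add: b_def)
      then show False using elim(2) by (auto simp: E_def)
    qed
  qed
qed

lemma AE_reg: "AE X in P. block_code X \<in> reg"
proof -
  have "AE X in P. \<forall>\<tau>\<in>- reg. block_code X \<noteq> \<tau>"
    using AE_block_code_neq countable_not_reg by (subst AE_ball_countable) auto
  then show ?thesis by eventually_elim auto
qed

text \<open>Each approximating cylinder end depends on finitely many blocks, hence on a discrete
  variable.\<close>

lemma cod_block_code_measurable: "(\<lambda>X. cod (block_code X)) \<in> measurable P BL"
proof (rule measurable_restrict_space2)
  have list: "(\<lambda>X. map X [0..<m]) \<in> measurable P (count_space UNIV)" for m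
    unfolding measurable_count_space_eq2_countable
  proof (intro conjI ballI)
    fix l :: "nat list list"
    show "(\<lambda>X. map X [0..<m]) -` {l} \<inter> space P \<in> sets P"
    proof (cases "length l = m")
      case True
      have "map X [0..<m] = l \<longleftrightarrow> (\<forall>i<m. X i = l ! i)" for X
        using True by (subst list_eq_iff_nth_eq) auto
      then have "(\<lambda>X. map X [0..<m]) -` {l} \<inter> space P = E (\<lambda>i. l ! i) m"
        unfolding E_def vimage_def by simp
      then show ?thesis using E_prob(1) by simp
    next
      case False
      then have "(\<lambda>X. map X [0..<m]) -` {l} \<inter> space P = {}" by auto
      then show ?thesis by simp
    qed
  qed auto
  have "(\<lambda>X. wmap (prefix_of (block_code X) n) 0) \<in> borel_measurable P" for n
  proof -
    define h where "h l = wmap (map (\<lambda>j. concat (take (Suc j) l) ! j) [0..<n]) 0" for l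
    have "prefix_of (block_code X) n = map (\<lambda>j. concat (take (Suc j) (map X [0..<n])) ! j) [0..<n]" for X
      by (auto simp: prefix_of_def block_code_def concat_blocks_def take_map min_def simp del: upt_Suc)
    then have "(\<lambda>X. wmap (prefix_of (block_code X) n) 0) = (\<lambda>X. h (map X [0..<n]))"
      by (simp add: h_def)
    moreover have "(\<lambda>X. h (map X [0..<n])) \<in> borel_measurable P"
      by (rule measurable_compose[OF list]) simp
    ultimately show ?thesis by simp
  qed
  then show "(\<lambda>X. cod (block_code X)) \<in> borel_measurable P"
    by (rule borel_measurable_LIMSEQ_metric) (rule cod_limit)
qed auto

end

lemma le_sum_list_map:
  fixes g :: "'a \<Rightarrow> real"
  assumes "x \<in> set xs" "\<And>y. 0 \<le> g y"
  shows "g x \<le> (\<Sum>y\<leftarrow>xs. g y)"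
  using assms(1)
proof (induction xs)
  case (Cons a xs)
  have "0 \<le> (\<Sum>y\<leftarrow>xs. g y)" using assms(2) by (intro sum_list_nonneg) auto
  then show ?case using Cons assms(2)[of a] by auto
qed simp

context expanding_system
begin

lemma log_expansion_letter: "\<omega> \<in> reg \<Longrightarrow> log_expansion (cod \<omega>) \<le> V 1 - ln (r [\<omega> 0])"
  using birkhoff_sum_log_expansion_r[of \<omega> 1] by (simp add: prefix_of_Suc birkhoff_sum_def)

end

context block_system
begin

text \<open>An arbitrary word is cut into complete blocks and a remainder. The blocks give the
  length estimate, and the remainder costs at most the shortest cylinder of \<open>F\<close>, a
  constant because \<open>F\<close> is finite.\<close>

lemma cylinder_cover:
  assumes const: "\<And>m. G m = F" "\<And>m. L m = n"
  shows "\<exists>N\<in>sets P. measure P N \<le> (r v / Min (r ` F)) powr s \<and>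
    (\<forall>X. good X \<longrightarrow> prefix_of (block_code X) (length v) = v \<longrightarrow> X \<in> N)"
proof (cases "\<exists>X. good X \<and> prefix_of (block_code X) (length v) = v")
  case False
  then show ?thesis by (intro bexI[of _ "{}"]) (auto intro!: powr_ge_zero)
next
  case True
  define k b v' where "k = length v div n" and "b i = drop (i * n) (take (i * n + n) v)"
    and "v' = drop (k * n) v" for i
  have pos: "pos m = m * n" for m by (simp add: pos_def const)
  have npos: "0 < n" using L_pos const by metis
  have blocks: "X i = b i" if "good X" "prefix_of (block_code X) (length v) = v" "i < k" for X i
  proof -
    have "Suc i * n \<le> k * n" using that(3) by (intro mult_right_mono) auto
    also have "\<dots> \<le> length v" by (simp add: k_def)
    finally have le: "i * n + n \<le> length v" by simp
    have "X i = drop (i * n) (prefix_of (block_code X) (i * n + n))"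
      using block_of_block_code[OF that(1), of i] by (simp add: pos const prefix_of_shift_code)
    also have "prefix_of (block_code X) (i * n + n) = take (i * n + n) v"
      using take_prefix_of[OF le, of "block_code X"] that(2) by simp
    finally show ?thesis by (simp add: b_def)
  qed
  obtain X where X: "good X" "prefix_of (block_code X) (length v) = v" using True by blast
  have kn: "k * n \<le> length v" by (simp add: k_def)
  have "concat_blocks b k = concat_blocks X k" by (rule concat_blocks_cong) (use blocks[OF X] in simp)
  also have "\<dots> = take (k * n) v"
    using prefix_block_code_good[OF X(1), of k] take_prefix_of[OF kn, of "block_code X"] X(2) by (simp add: pos)
  finally have v: "v = concat_blocks b k @ v'" by (simp add: v'_def)
  have lt: "length v - k * n < n"
    using npos by (simp add: k_def minus_div_mult_eq_mod)
  \<comment> \<open>Being shorter than a block, the remainder is a prefix of the next block, so its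
    cylinder is at least as long as one from \<open>F\<close>.\<close>
  have "v' = prefix_of (shift_code (k * n) (block_code X)) (length v - k * n)"
    using X(2) kn prefix_of_shift_code[of "k * n" "block_code X" "length v - k * n"] by (simp add: v'_def)
  also have "\<dots> = take (length v - k * n) (X k)"
    using block_of_block_code[OF X(1), of k] lt by (simp add: pos const take_prefix_of)
  finally have "r (X k) \<le> r v'"
    using r_append_le(2)[of v' "drop (length v - k * n) (X k)"] by simp
  moreover have "X k \<in> F" using X(1) by (simp add: good_def const)
  moreover have fF: "finite F" using finite_G[of 0] const by simp
  ultimately have \<rho>: "Min (r ` F) \<le> r v'"
    by (meson Min_le finite_imageI imageI order_trans)
  have \<rho>pos: "0 < Min (r ` F)" using fF \<open>X k \<in> F\<close> r_pos by (subst Min_gr_iff) auto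
  have "measure P (E b k) \<le> (r v / r v') powr s"
    using E_prob_r[of b k v'] v by simp
  also have "\<dots> \<le> (r v / Min (r ` F)) powr s"
    using \<rho> \<rho>pos s_pos r_pos[of v] r_pos[of v'] by (intro powr_mono2 divide_left_mono) auto
  finally show ?thesis
    using E_prob(1)[of b k] blocks by (intro bexI[of _ "E b k"]) (auto simp: E_def)
qed

end

section \<open>Ergodic measures generated by independent blocks\<close>

context expanding_system
begin

text \<open>Blocks of one length from a finite set use finitely many letters, so potentials and
  \<open>log |T'|\<close> are bounded almost everywhere and the entropy is finite. The hypothesis on
  averages holds for all regular codes through a word, hence survives averaging over the position in
  the block.\<close>

lemma block_measure:
  assumes s: "0 < s" and F: "finite F" "\<And>w. w \<in> F \<Longrightarrow> length w = n" and n: "0 < n"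
    and sumF: "1 \<le> (\<Sum>w\<in>F. weight w powr s)"
  obtains \<mu> where "\<mu> \<in> ergodic_measures I f" "entropy_of I f \<mu> < \<infinity>"
    and "ennreal s \<le> entropy_of I f \<mu> / lyapunov_exponent I f \<mu>"
    and "\<And>\<phi> c \<epsilon>. potential_variations_vanish I f \<phi> \<Longrightarrow>
      (\<And>w \<omega>. w \<in> F \<Longrightarrow> \<omega> \<in> reg \<Longrightarrow> prefix_of \<omega> n = w \<Longrightarrow>
         \<bar>birkhoff_sum \<phi> n \<omega> - real n * c\<bar> \<le> real n * \<epsilon>) \<Longrightarrow>
      integrable \<mu> \<phi> \<and> \<bar>(\<integral>x. \<phi> x \<partial>\<mu>) - c\<bar> \<le> \<epsilon>"
proof -
  interpret B: block_system \<xi> I f s "\<lambda>_. F" "\<lambda>_. n"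
    by unfold_locales (use assms in auto)
  interpret SS: sequence_space "measure_pmf (block_pmf s F)"
    by (intro sequence_space.intro product_prob_spaceI measure_pmf.prob_space_axioms)
  let ?P = B.P
  have PS: "?P = PiM UNIV (\<lambda>_. measure_pmf (block_pmf s F))" by (simp add: B.P_def)
  define Y where "Y X = cod (block_code X)" for X
  have Ym [measurable]: "Y \<in> measurable ?P BL" unfolding Y_def by (rule B.cod_block_code_measurable)
  have pos: "B.pos m = m * n" for m by (simp add: B.pos_def)
  note [measurable] = T_measurable T_pow_measurable
  have AEg: "AE X in ?P. B.good X \<and> block_code X \<in> reg" using B.AE_good B.AE_reg by eventually_elim simp
  have TY: "(T ^^ j) (Y X) = cod (shift_code j (block_code X))" if "block_code X \<in> reg" for X j
    unfolding Y_def using reg_T_pow[OF that] .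
  have TYn: "(T ^^ (m * n)) (Y X) = Y (\<lambda>i. X (m + i))" if "B.good X" "block_code X \<in> reg" for X m
    using TY[OF that(2), of "m * n"] B.shift_block_code_good[OF that(1), of m] by (simp add: pos Y_def)
  have head: "prefix_of (block_code X) n = X 0" if "B.good X" for X
    using B.prefix_block_code_good[OF that, of 1] by (simp add: pos concat_blocks_Suc)
  have headF: "X 0 \<in> F" if "B.good X" for X using that by (simp add: B.good_def)
  have shm [measurable]: "(\<lambda>X i. X (m + i)) \<in> measurable ?P ?P" for m
    unfolding PS by (rule measurable_PiM_single') (auto intro: measurable_component_singleton simp: space_PiM)
  have shP: "distr ?P ?P (\<lambda>X i. X (m + i)) = ?P" for m
  proof -
    have "distr ?P ?P (\<lambda>X. \<lambda>i\<in>UNIV. X (m + i)) = ?P"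
      unfolding PS
      by (rule distr_PiM_reindex[of UNIV "\<lambda>_. measure_pmf (block_pmf s F)" "\<lambda>i. m + i" UNIV])
        (auto intro: measure_pmf.prob_space_axioms)
    then show ?thesis unfolding restrict_def by simp
  qed
  define \<nu> where "\<nu> = distr ?P BL Y"
  have prob\<nu>: "prob_space \<nu>" unfolding \<nu>_def by (rule B.P.prob_space_distr[OF Ym])
  have sets\<nu>: "sets \<nu> = sets BL" by (simp add: \<nu>_def)
  have AE\<nu>: "AE x in \<nu>. Q x" if "{x \<in> \<Lambda>. Q x} \<in> sets BL" "\<And>X. B.good X \<Longrightarrow> block_code X \<in> reg \<Longrightarrow> Q (Y X)" for Q
    unfolding \<nu>_def using that AEg by (subst AE_distr_iff[OF Ym]) (auto elim: eventually_mono)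
  \<comment> \<open>On coded points \<open>T ^^ n\<close> removes one block, and the independent
    identically distributed sequence is invariant under that shift.\<close>
  have inv\<nu>: "distr \<nu> \<nu> (T ^^ n) = \<nu>"
  proof -
    have "distr \<nu> \<nu> (T ^^ n) = distr \<nu> BL (T ^^ n)" by (rule distr_cong) (auto simp: sets\<nu>)
    also have "\<dots> = distr ?P BL (T ^^ n \<circ> Y)" unfolding \<nu>_def by (rule distr_distr) measurable
    also have "\<dots> = distr ?P BL (Y \<circ> (\<lambda>X i. X (1 + i)))"
    proof (rule distr_cong_AE)
      show "AE X in ?P. (T ^^ n \<circ> Y) X = (Y \<circ> (\<lambda>X i. X (1 + i))) X"
        using AEg
      proof eventually_elim
        case (elim X)
        then show ?case using TYn[of X 1] unfolding comp_apply by simp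
      qed
      show "Y \<circ> (\<lambda>X i. X (1 + i)) \<in> measurable ?P BL" by (rule measurable_comp[OF shm Ym])
      show "T ^^ n \<circ> Y \<in> measurable ?P BL" by (rule measurable_comp[OF Ym T_pow_measurable])
    qed simp_all
    also have "\<dots> = distr (distr ?P ?P (\<lambda>X i. X (1 + i))) BL Y"
      by (rule distr_distr[symmetric]) measurable
    also have "\<dots> = \<nu>" unfolding shP \<nu>_def ..
    finally show ?thesis .
  qed
  from average_measure[OF prob\<nu> sets\<nu> inv\<nu> n] obtain \<mu> where \<mu>: "\<mu> \<in> invariant_measures I f"
    and avg: "\<And>g. g \<in> borel_measurable BL \<Longrightarrow>
      (\<integral>\<^sup>+x. g x \<partial>\<mu>) = (\<integral>\<^sup>+x. (\<Sum>j<n. g ((T ^^ j) x)) / of_nat n \<partial>\<nu>)" by blast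
  interpret \<mu>: prob_space \<mu> by (rule invariantD[OF \<mu>])
  note s\<mu> = invariantD(2)[OF \<mu>]

  \<comment> \<open>A zero-one law: an invariant set pulls back to an event \<open>D\<close> that
    does not change, up to null sets, when the first \<open>m\<close> blocks are dropped. So
    \<open>D\<close> is independent of every event on finitely many blocks, and finally of
    itself.\<close>
  have ergodic: "\<mu> \<in> ergodic_measures I f"
  proof -
    have "measure \<mu> A = 0 \<or> measure \<mu> A = 1"
      if A': "A \<in> sets \<mu>" and TA: "T -` A \<inter> space \<mu> = A" for A
    proof -
      have A [measurable]: "A \<in> sets BL" using A' s\<mu> by simp
      have iff1: "T x \<in> A \<longleftrightarrow> x \<in> A" if "x \<in> \<Lambda>" for x
        using TA that invariantD(3)[OF \<mu>] by auto
      have iff: "(T ^^ k) x \<in> A \<longleftrightarrow> x \<in> A" if "x \<in> \<Lambda>" for x k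
        by (induction k) (auto simp: iff1 T_pow_limit_set that)
      define D where "D = Y -` A \<inter> space ?P"
      have D [measurable]: "D \<in> sets ?P" unfolding D_def by measurable
      have "emeasure \<mu> A = (\<integral>\<^sup>+x. indicator A x \<partial>\<mu>)" using A s\<mu> by simp
      also have "\<dots> = (\<integral>\<^sup>+x. (\<Sum>j<n. indicator A ((T ^^ j) x)) / of_nat n \<partial>\<nu>)"
        by (rule avg) simp
      also have "\<dots> = (\<integral>\<^sup>+x. indicator A x \<partial>\<nu>)"
      proof (rule nn_integral_cong)
        fix x assume "x \<in> space \<nu>"
        then have x: "x \<in> \<Lambda>" using sets_eq_imp_space_eq[OF sets\<nu>] by simp
        have "(\<Sum>j<n. indicator A ((T ^^ j) x)) = (of_nat n * indicator A x :: ennreal)"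
          using iff[OF x] by (simp add: indicator_def)
        then show "(\<Sum>j<n. indicator A ((T ^^ j) x)) / of_nat n = (indicator A x :: ennreal)"
          using n by (simp add: indicator_def ennreal_of_nat_eq_real_of_nat divide_ennreal)
      qed
      also have "\<dots> = emeasure \<nu> A" using A sets\<nu> by simp
      also have "\<dots> = emeasure ?P D" unfolding \<nu>_def D_def by (rule emeasure_distr) measurable
      finally have \<mu>D: "emeasure \<mu> A = emeasure ?P D" .
      have indep: "emeasure ?P (D \<inter> B0) = emeasure ?P D * emeasure ?P B0"
        if J: "finite J" and B0: "B0 = prod_emb UNIV (\<lambda>_. measure_pmf (block_pmf s F)) J (Pi\<^sub>E J Aj)" for J Aj B0
      proof -
        obtain m where m: "\<And>j. j \<in> J \<Longrightarrow> j < m"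
          using J unfolding finite_nat_set_iff_bounded by blast
        have B0alt: "B0 = {X. \<forall>j\<in>J. X j \<in> Aj j}"
          unfolding B0 by (auto simp: prod_emb_def restrict_PiE_iff)
        have B0s [measurable]: "B0 \<in> sets ?P"
          unfolding PS B0 using J by (intro sets_PiM_I) auto
        define C where "C = ((\<lambda>X i. X (m + i)) -` D \<inter> space ?P) \<inter> B0"
        have Cs: "C \<in> sets ?P" unfolding C_def by measurable
        have "emeasure ?P (D \<inter> B0) = emeasure ?P C"
        proof (rule emeasure_eq_AE)
          show "AE X in ?P. X \<in> D \<inter> B0 \<longleftrightarrow> X \<in> C"
            using AEg
          proof eventually_elim
            case (elim X)
            have "Y X \<in> A \<longleftrightarrow> (T ^^ (m * n)) (Y X) \<in> A" by (rule iff[symmetric]) (simp add: Y_def)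
            then have "Y X \<in> A \<longleftrightarrow> Y (\<lambda>i. X (m + i)) \<in> A" using TYn[of X m] elim by simp
            then show ?case unfolding C_def D_def by simp
          qed
        qed (use Cs in auto)
        \<comment> \<open>\<open>comb_seq\<close> reassembles a sequence from its first
          \<open>m\<close> entries and an independent copy of the rest; \<open>B0\<close> sees only
          the former, the shifted \<open>D\<close> only the latter.\<close>
        also have "emeasure ?P C = emeasure (distr (?P \<Otimes>\<^sub>M ?P) ?P (\<lambda>(\<omega>, \<omega>'). comb_seq m \<omega> \<omega>')) C"
          unfolding PS by (subst SS.PiM_comb_seq) simp
        also have "\<dots> = emeasure (?P \<Otimes>\<^sub>M ?P) ((\<lambda>(\<omega>, \<omega>'). comb_seq m \<omega> \<omega>') -` C \<inter> space (?P \<Otimes>\<^sub>M ?P))"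
          by (rule emeasure_distr[OF _ Cs]) (unfold PS, rule measurable_comb_seq)
        also have "(\<lambda>(\<omega>, \<omega>'). comb_seq m \<omega> \<omega>') -` C \<inter> space (?P \<Otimes>\<^sub>M ?P) = B0 \<times> D"
        proof -
          have "(\<lambda>i. comb_seq m x y (m + i)) = y" for x y :: "nat \<Rightarrow> nat list"
            by (auto simp: fun_eq_iff comb_seq_add[of m x y, unfolded add.commute[of _ m]])
          moreover have "comb_seq m x y \<in> B0 \<longleftrightarrow> x \<in> B0" for x y
            unfolding B0alt using m by (auto simp: comb_seq_less)
          ultimately show ?thesis
            by (auto simp: C_def space_pair_measure)
        qed
        also have "emeasure (?P \<Otimes>\<^sub>M ?P) (B0 \<times> D) = emeasure ?P B0 * emeasure ?P D"
          by (rule B.P.emeasure_pair_measure_Times) auto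
        finally show ?thesis by (simp add: mult.commute)
      qed
      \<comment> \<open>Both finite measures agree on finite-dimensional cylinders, hence
        everywhere; evaluating them at \<open>D\<close> gives
        \<open>P(D) = P(D) ^ 2\<close>.\<close>
      have "density ?P (indicator D) = scale_measure (emeasure ?P D) ?P"
      proof (rule measure_eqI_PiM_infinite[where I = UNIV and M = "\<lambda>_. measure_pmf (block_pmf s F)"])
        show "finite_measure (density ?P (indicator D))"
          by (rule finite_measureI) (use emeasure_restricted[OF D sets.top] B.P.emeasure_finite in simp)
        fix Aj :: "nat \<Rightarrow> nat list set" and J :: "nat set"
        assume J: "finite J"
        let ?B = "prod_emb UNIV (\<lambda>_. measure_pmf (block_pmf s F)) J (Pi\<^sub>E J Aj)"
        have Bs: "?B \<in> sets ?P" unfolding PS using J by (intro sets_PiM_I) auto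
        show "emeasure (density ?P (indicator D)) ?B = emeasure (scale_measure (emeasure ?P D) ?P) ?B"
          using indep[OF J refl, of Aj] emeasure_restricted[OF D Bs] by simp
      qed (simp_all add: PS)
      then have "emeasure ?P (D \<inter> D) = emeasure ?P D * emeasure ?P D"
        using emeasure_restricted[OF D D] by simp
      then have "measure ?P D = measure ?P D * measure ?P D"
        by (simp add: B.P.emeasure_eq_measure flip: ennreal_mult)
      then have "measure ?P D = 0 \<or> measure ?P D = 1" by auto
      then show ?thesis using \<mu>D by (simp add: measure_def)
    qed
    then show ?thesis using \<mu> by (simp add: ergodic_measures_def)
  qed

  \<comment> \<open>Only a bound in terms of the first letter is asked for, so the same argument
    serves the potentials and \<open>log_expansion\<close>.\<close>
  have avg_pot: "integrable \<mu> \<phi> \<and> \<bar>(\<integral>x. \<phi> x \<partial>\<mu>) - c\<bar> \<le> \<epsilon>"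
    if \<phi>m [measurable]: "\<phi> \<in> borel_measurable BL"
      and bnd: "\<And>\<omega>. \<omega> \<in> reg \<Longrightarrow> \<bar>\<phi> (cod \<omega>)\<bar> \<le> b (\<omega> 0)" and b: "\<And>a. 0 \<le> b a"
      and av: "\<And>w \<omega>. w \<in> F \<Longrightarrow> \<omega> \<in> reg \<Longrightarrow> prefix_of \<omega> n = w \<Longrightarrow>
         \<bar>birkhoff_sum \<phi> n \<omega> - real n * c\<bar> \<le> real n * \<epsilon>" for \<phi> b c \<epsilon>
  proof -
    define K where "K = (\<Sum>w\<in>F. \<Sum>a\<leftarrow>w. b a)"
    have K: "\<bar>\<phi> ((T ^^ j) (Y X))\<bar> \<le> K" if "B.good X" "block_code X \<in> reg" "j < n" for X j
    proof -
      have "block_code X j = X 0 ! j" using head[OF that(1)] that(3) by (metis nth_prefix_of)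
      moreover have "j < length (X 0)" using that(3) F(2)[OF headF[OF that(1)]] by simp
      ultimately have "block_code X j \<in> set (X 0)" by simp
      then have "b (block_code X j) \<le> (\<Sum>a\<leftarrow>X 0. b a)"
          using b by (intro le_sum_list_map)
      also have "\<dots> \<le> K" unfolding K_def
        by (rule member_le_sum[of "X 0" F]) (use headF[OF that(1)] F(1) b in \<open>auto intro!: sum_list_nonneg\<close>)
      finally show ?thesis
        using bnd[OF reg_shift[OF that(2), of j]] TY[OF that(2)] by (simp add: shift_code_apply)
    qed
    define g where "g j x = \<phi> ((T ^^ j) x)" for j x
    have gm [measurable]: "g j \<in> borel_measurable BL" for j
      unfolding g_def by (rule measurable_compose[OF T_pow_measurable \<phi>m])
    have 1: "AE x in \<nu>. \<forall>j<n. \<bar>\<phi> ((T ^^ j) x)\<bar> \<le> K"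
    proof (rule AE\<nu>)
      have "{x \<in> space BL. \<forall>j\<in>{..<n}. \<bar>g j x\<bar> \<le> K} \<in> sets BL" by measurable
      moreover have "{x \<in> \<Lambda>. \<forall>j<n. \<bar>\<phi> ((T ^^ j) x)\<bar> \<le> K} = {x \<in> space BL. \<forall>j\<in>{..<n}. \<bar>g j x\<bar> \<le> K}"
        unfolding g_def space_BL by blast
      ultimately show "{x \<in> \<Lambda>. \<forall>j<n. \<bar>\<phi> ((T ^^ j) x)\<bar> \<le> K} \<in> sets BL" by (simp only:)
    qed (use K in blast)
    have 2: "AE x in \<nu>. \<bar>(\<Sum>j<n. \<phi> ((T ^^ j) x)) - real n * c\<bar> \<le> real n * \<epsilon>"
    proof (rule AE\<nu>)
      have "{x \<in> space BL. \<bar>(\<Sum>j<n. g j x) - real n * c\<bar> \<le> real n * \<epsilon>} \<in> sets BL" by measurable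
      then show "{x \<in> \<Lambda>. \<bar>(\<Sum>j<n. \<phi> ((T ^^ j) x)) - real n * c\<bar> \<le> real n * \<epsilon>} \<in> sets BL"
        unfolding g_def space_BL .
      show "\<bar>(\<Sum>j<n. \<phi> ((T ^^ j) (Y X))) - real n * c\<bar> \<le> real n * \<epsilon>" if "B.good X" "block_code X \<in> reg" for X
        using av[OF headF[OF that(1)] that(2) head[OF that(1)]] TY[OF that(2)] by (simp add: birkhoff_sum_def)
    qed
    show ?thesis
      using average_integral[OF \<mu> prob\<nu> sets\<nu> n avg \<phi>m 1 2] by blast
  qed
  have intlog: "integrable \<mu> log_expansion"
  proof -
    define b where "b a = \<bar>V 1 - ln (r [a])\<bar>" for a
    have c1: "\<bar>log_expansion (cod \<omega>)\<bar> \<le> b (\<omega> 0)" if "\<omega> \<in> reg" for \<omega>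
      using log_expansion_letter[OF that] log_expansion_ge[of "cod \<omega>"] ln_\<xi>_pos by (simp add: b_def)
    \<comment> \<open>Integrability alone is wanted here, so the centre 0 and a crude bound summed
      over the finite set \<open>F\<close> suffice. The summand is arranged to be
      nonnegative.\<close>
    have c2: "\<bar>birkhoff_sum log_expansion n \<omega> - real n * 0\<bar> \<le> real n * ((\<Sum>v\<in>F. V n - ln (r v) + \<bar>ln (r v)\<bar> * 2) / real n)"
      if w: "w \<in> F" "\<omega> \<in> reg" "prefix_of \<omega> n = w" for w \<omega>
    proof -
      have "\<bar>birkhoff_sum log_expansion n \<omega>\<bar> \<le> V n + \<bar>ln (r w)\<bar>"
        using birkhoff_sum_log_expansion_r[OF w(2), of n] w(3) by simp
      also have "\<dots> \<le> V n - ln (r w) + \<bar>ln (r w)\<bar> * 2" by simp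
      also have "\<dots> \<le> (\<Sum>v\<in>F. V n - ln (r v) + \<bar>ln (r v)\<bar> * 2)"
        by (rule member_le_sum[OF w(1)]) (use F(1) V_nonneg[of n] in \<open>auto simp: abs_if\<close>)
      finally show ?thesis using n by simp
    qed
    have b0: "0 \<le> b a" for a by (simp add: b_def)
    show ?thesis using avg_pot[OF log_expansion_measurable c1 b0 c2] by (rule conjunct1)
  qed

  \<comment> \<open>\<open>card F\<close> bounds the number of possible initial pieces when the word
    starts inside a block; the other factor is the constant of
    \<open>cylinder_cover\<close>.\<close>
  define C where "C = real (card F) * (1 / Min (r ` F)) powr s"
  have Fne: "F \<noteq> {}" using sumF by auto
  have \<rho>: "0 < Min (r ` F)" using F(1) Fne r_pos by (subst Min_gr_iff) auto
  have C: "0 < C"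
  proof -
    have "1 / Min (r ` F) \<noteq> 0" using \<rho> by (metis divide_pos_pos less_irrefl zero_less_one)
    then have "0 < (1 / Min (r ` F)) powr s" by (rule powr_gt_zero[THEN iffD2])
    moreover have "0 < real (card F)" using F(1) Fne by (simp add: card_gt_0_iff)
    ultimately show ?thesis unfolding C_def by (rule mult_pos_pos[rotated])
  qed
  have gibbs: "cyl_prob \<mu> w \<le> C * r w powr s" for w
  proof -
    let ?m = "length w"
    let ?A = "{x \<in> \<Lambda>. word ?m x = w}"
    have Aeq: "?A = word ?m -` {w} \<inter> space BL" by auto
    have A [measurable]: "?A \<in> sets BL" unfolding Aeq by (rule measurable_sets[OF itinerary_word_measurable]) simp
    have "\<forall>v. \<exists>N\<in>sets ?P. measure ?P N \<le> (r v / Min (r ` F)) powr s \<and>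
        (\<forall>X. B.good X \<longrightarrow> prefix_of (block_code X) (length v) = v \<longrightarrow> X \<in> N)"
      using B.cylinder_cover[OF refl refl] by blast
    then obtain N where N [measurable]: "\<And>v. N v \<in> sets ?P" and Nm: "\<And>v. measure ?P (N v) \<le> (r v / Min (r ` F)) powr s"
      and Nc: "\<And>v X. B.good X \<Longrightarrow> prefix_of (block_code X) (length v) = v \<Longrightarrow> X \<in> N v"
      by metis
    \<comment> \<open>If the word starts at position \<open>j\<close> of a block, then prefixing it
      with the first \<open>j\<close> letters of that block gives a word starting at a block
      boundary.\<close>
    have bound: "(\<integral>\<^sup>+x. indicator ?A ((T ^^ j) x) \<partial>\<nu>) \<le> ennreal (C * r w powr s)" if j: "j < n" for j
    proof -
      let ?U = "take j ` F"
      have "(\<integral>\<^sup>+x. indicator ?A ((T ^^ j) x) \<partial>\<nu>) = (\<integral>\<^sup>+X. indicator ?A ((T ^^ j) (Y X)) \<partial>?P)"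
        unfolding \<nu>_def by (rule nn_integral_distr) measurable
      also have "\<dots> \<le> (\<integral>\<^sup>+X. (\<Sum>u\<in>?U. indicator (N (u @ w)) X) \<partial>?P)"
      proof (rule nn_integral_mono_AE)
        show "AE X in ?P. indicator ?A ((T ^^ j) (Y X)) \<le> (\<Sum>u\<in>?U. indicator (N (u @ w)) X :: ennreal)"
          using AEg
        proof eventually_elim
          case (elim X)
          show ?case
          proof (cases "(T ^^ j) (Y X) \<in> ?A")
            case True
            then have "prefix_of (shift_code j (block_code X)) ?m = w"
              using TY[of X j] elim itinerary_cod[OF reg_shift[of "block_code X" j]] by simp
            moreover have pj: "prefix_of (block_code X) j = take j (X 0)"
              using head[of X] take_prefix_of[of j n "block_code X"] elim j by simp
            ultimately have "prefix_of (block_code X) (length (take j (X 0) @ w)) = take j (X 0) @ w"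
              using j F(2)[OF headF[of X]] elim by (simp add: prefix_of_add min_def)
            then have "X \<in> N (take j (X 0) @ w)" using Nc elim by blast
            then have "1 \<le> (indicator (N (take j (X 0) @ w)) X :: ennreal)" by simp
            also have "\<dots> \<le> (\<Sum>u\<in>?U. indicator (N (u @ w)) X)"
              using headF[of X] elim F(1) by (intro member_le_sum) auto
            finally show ?thesis using True by simp
          next
            case False
            then have "indicator ?A ((T ^^ j) (Y X)) = (0 :: ennreal)" by (rule indicator_simps(2))
            then show ?thesis by (simp only: zero_le)
          qed
        qed
      qed
      also have "\<dots> = (\<Sum>u\<in>?U. ennreal (measure ?P (N (u @ w))))"
        by (simp add: nn_integral_sum B.P.emeasure_eq_measure)
      also have "\<dots> \<le> (\<Sum>u\<in>?U. ennreal ((1 / Min (r ` F)) powr s * r w powr s))"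
      proof (rule sum_mono, rule ennreal_leI)
        fix u assume "u \<in> ?U"
        have "measure ?P (N (u @ w)) \<le> (r (u @ w) / Min (r ` F)) powr s" by (rule Nm)
        also have "\<dots> \<le> (r w / Min (r ` F)) powr s"
          using r_append_le(1)[of u w] \<rho> s r_pos[of "u @ w"] by (intro powr_mono2 divide_right_mono) auto
        also have "\<dots> = (1 / Min (r ` F)) powr s * r w powr s"
          using \<rho> r_pos[of w] by (simp add: powr_divide)
        finally show "measure ?P (N (u @ w)) \<le> (1 / Min (r ` F)) powr s * r w powr s" .
      qed
      also have "\<dots> = ennreal (real (card ?U) * ((1 / Min (r ` F)) powr s * r w powr s))"
        by (simp add: ennreal_mult ennreal_of_nat_eq_real_of_nat)
      also have "\<dots> \<le> ennreal (C * r w powr s)"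
        unfolding C_def mult.assoc using card_image_le[OF F(1), of "take j"]
        by (intro ennreal_leI mult_right_mono) auto
      finally show ?thesis .
    qed
    have "ennreal (cyl_prob \<mu> w) = emeasure \<mu> ?A"
      using cyl_prob_alt(2)[OF \<mu> refl, of w] Aeq invariantD(3)[OF \<mu>] by simp
    also have "\<dots> = (\<integral>\<^sup>+x. indicator ?A x \<partial>\<mu>)" using A s\<mu> by simp
    also have "\<dots> = (\<integral>\<^sup>+x. (\<Sum>j<n. indicator ?A ((T ^^ j) x)) / of_nat n \<partial>\<nu>)"
      by (rule avg) measurable
    also have "\<dots> = (\<Sum>j<n. \<integral>\<^sup>+x. indicator ?A ((T ^^ j) x) \<partial>\<nu>) / of_nat n"
    proof -
      have [measurable_cong]: "sets \<nu> = sets BL" by (rule sets\<nu>)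
      have "(\<lambda>x. indicator ?A ((T ^^ j) x) :: ennreal) \<in> borel_measurable \<nu>" for j by measurable
      then show ?thesis by (simp add: nn_integral_divide nn_integral_sum)
    qed
    also have "\<dots> \<le> (\<Sum>j<n. ennreal (C * r w powr s)) / of_nat n"
      using bound by (intro divide_right_mono_ennreal sum_mono) auto
    also have "\<dots> = ennreal (C * r w powr s)"
      using n C by (simp add: ennreal_of_nat_eq_real_of_nat divide_ennreal flip: ennreal_mult)
    finally show ?thesis using C by (subst (asm) ennreal_le_iff) auto
  qed

  have H1: "H \<mu> 1 < \<infinity>"
  proof -
    \<comment> \<open>The finitely many letters occurring in \<open>F\<close>, as words of length 1;
      they carry the whole mass, so the first entropy is a finite sum.\<close>
    define Ls where "Ls = (\<lambda>a. [a]) ` (\<Union>w\<in>F. set w)"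
    have fL: "finite Ls" unfolding Ls_def using F(1) by auto
    have "AE x in \<mu>. word 1 x \<in> Ls"
    proof (rule average_AE[OF \<mu> sets\<nu> avg])
      have "word 1 -` Ls \<inter> space BL \<in> sets BL" by (rule measurable_sets[OF itinerary_word_measurable]) simp
      moreover have "word 1 -` Ls \<inter> space BL = {x \<in> \<Lambda>. word 1 x \<in> Ls}" by auto
      ultimately show Qm: "{x \<in> \<Lambda>. word 1 x \<in> Ls} \<in> sets BL" by simp
      show "AE x in \<nu>. \<forall>j<n. word 1 ((T ^^ j) x) \<in> Ls"
      proof (rule AE\<nu>)
        define Sj where "Sj j = (T ^^ j) -` {x \<in> \<Lambda>. word 1 x \<in> Ls} \<inter> space BL" for j
        have Sj: "Sj j \<in> sets BL" for j
          unfolding Sj_def by (rule measurable_sets[OF T_pow_measurable Qm])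
        have "{x \<in> \<Lambda>. \<forall>j<n. word 1 ((T ^^ j) x) \<in> Ls} = (\<Inter>j\<in>{..<n}. Sj j)"
          using T_pow_limit_set n by (auto simp: Sj_def)
        also have "\<dots> \<in> sets BL"
          using Sj n by (intro sets.finite_INT) auto
        finally show "{x \<in> \<Lambda>. \<forall>j<n. word 1 ((T ^^ j) x) \<in> Ls} \<in> sets BL" .
        show "\<forall>j<n. word 1 ((T ^^ j) (Y X)) \<in> Ls" if X: "B.good X" "block_code X \<in> reg" for X
        proof (intro allI impI)
          fix j assume j: "j < n"
          have "block_code X j = X 0 ! j" using head[OF X(1)] j by (metis nth_prefix_of)
          moreover have "j < length (X 0)" using j F(2)[OF headF[OF X(1)]] by simp
          ultimately have "block_code X j \<in> set (X 0)" by simp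
          then show "word 1 ((T ^^ j) (Y X)) \<in> Ls"
            using TY[OF X(2), of j] itinerary_cod[OF reg_shift[OF X(2), of j]] headF[OF X(1)]
            by (auto simp: Ls_def prefix_of_def shift_code_apply)
        qed
      qed
    qed
    then have "AE x in \<mu>. ennreal (- ln (cyl_prob \<mu> (word 1 x))) \<le> ennreal (\<Sum>w\<in>Ls. \<bar>ln (cyl_prob \<mu> w)\<bar>)"
    proof eventually_elim
      case (elim x)
      have "- ln (cyl_prob \<mu> (word 1 x)) \<le> \<bar>ln (cyl_prob \<mu> (word 1 x))\<bar>" by simp
      also have "\<dots> \<le> (\<Sum>w\<in>Ls. \<bar>ln (cyl_prob \<mu> w)\<bar>)" using elim fL by (intro member_le_sum) auto
      finally show ?case by (rule ennreal_leI)
    qed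
    then have "H \<mu> 1 \<le> (\<integral>\<^sup>+x. ennreal (\<Sum>w\<in>Ls. \<bar>ln (cyl_prob \<mu> w)\<bar>) \<partial>\<mu>)"
      unfolding partition_entropy_eq[OF \<mu>] by (rule nn_integral_mono_AE)
    also have "\<dots> < \<infinity>" by (simp add: \<mu>.emeasure_space_1)
    finally show ?thesis .
  qed
  have s0: "0 \<le> s" using s by simp
  note ent = entropy_ge_lyapunov[OF \<mu> H1 s0 C gibbs intlog]
  have "ennreal s \<le> entropy_of I f \<mu> / lyapunov_exponent I f \<mu>"
  proof -
    let ?l = "\<integral>x. log_expansion x \<partial>\<mu>"
    have l: "0 < ?l" using lyapunov_eq(4)[OF \<mu> intlog] ln_\<xi>_pos by linarith
    have "ennreal s = ennreal (s * ?l) / ennreal ?l" using l s by (simp add: divide_ennreal)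
    also have "\<dots> \<le> entropy_of I f \<mu> / ennreal ?l" by (rule divide_right_mono_ennreal[OF ent(1)])
    finally show ?thesis using lyapunov_eq(3)[OF \<mu> intlog] by simp
  qed
  moreover have "integrable \<mu> \<phi> \<and> \<bar>(\<integral>x. \<phi> x \<partial>\<mu>) - c\<bar> \<le> \<epsilon>"
    if "potential_variations_vanish I f \<phi>"
      "\<And>w \<omega>. w \<in> F \<Longrightarrow> \<omega> \<in> reg \<Longrightarrow> prefix_of \<omega> n = w \<Longrightarrow>
         \<bar>birkhoff_sum \<phi> n \<omega> - real n * c\<bar> \<le> real n * \<epsilon>" for \<phi> c \<epsilon>
    by (rule avg_pot[OF potential_measurable[OF that(1)], of "letter_bound \<phi>"])
      (use letter_bound[OF that(1)] letter_bound_nonneg that(2) in blast)+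
  ultimately show thesis using that ergodic ent(2) by blast
qed

end

subsection \<open>The mass distribution principle\<close>

text \<open>A covering set lies in the interval of its own diameter that starts at its infimum, so
  bounds on intervals bound every cover from below. All exponents up to \<open>t\<close> are
  excluded, as \<open>hausdorff_dim\<close> is an infimum over exponents with measure 0.\<close>

lemma mass_distribution:
  fixes Y :: "'a \<Rightarrow> real"
  assumes M: "prob_space M" and Y: "Y \<in> borel_measurable M" and A: "AE x in M. Y x \<in> A"
    and C: "0 < C" and t: "0 < t"
    and mass: "\<And>a d. 0 < d \<Longrightarrow> d < 1 \<Longrightarrow> measure M {x \<in> space M. Y x \<in> {a..a + d}} \<le> C * d powr t"
  shows "ennreal t \<le> hausdorff_dim A"
proof -
  interpret prob_space M by (rule M)
  note [measurable] = Y
  let ?B = "\<lambda>a d. {x \<in> space M. Y x \<in> {a..a + d}}"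
  have Bs: "?B a d \<in> sets M" for a d by measurable
  \<comment> \<open>Covering sets of diameter 0 fall outside the hypothesis \<open>mass\<close> and
    are treated as a limit of short intervals.\<close>
  have point: "measure M (?B a 0) = 0" for a
  proof -
    have b: "measure M (?B a 0) \<le> C * (1 / real (Suc (Suc n))) powr t" for n
    proof -
      have "measure M (?B a 0) \<le> measure M (?B a (1 / real (Suc (Suc n))))"
        by (intro finite_measure_mono Bs) auto
      also have "\<dots> \<le> C * (1 / real (Suc (Suc n))) powr t" by (rule mass) auto
      finally show ?thesis .
    qed
    have "(\<lambda>n. 1 / real (Suc (Suc n))) \<longlonglongrightarrow> 0"
      using LIMSEQ_ignore_initial_segment[OF lim_1_over_n, of 2] by simp
    then have "(\<lambda>n. C * (1 / real (Suc (Suc n))) powr t) \<longlonglongrightarrow> C * 0 powr t"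
      using t by (intro tendsto_mult tendsto_const tendsto_powr2) (auto intro: always_eventually)
    then have "measure M (?B a 0) \<le> C * 0 powr t"
      by (rule LIMSEQ_le_const) (use b in blast)
    then show ?thesis using t by (simp add: measure_le_0_iff)
  qed
  have pos: "hausdorff_measure s A \<noteq> 0" if s: "0 \<le> s" "s \<le> t" for s
  proof -
    \<comment> \<open>The mesh \<open>1/2\<close> keeps diameters below 1, as \<open>mass\<close>
      demands, and makes the power with exponent \<open>t\<close> at most the one with exponent
      \<open>s\<close>.\<close>
    have lower: "ennreal (1 / C) \<le> (\<Sum>i. hausdorff_gauge s (U i))"
      if U: "A \<subseteq> (\<Union>i. U i)" "\<And>i. bounded (U i)" "\<And>i. diameter (U i) \<le> 1/2" for U :: "nat \<Rightarrow> real set"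
    proof -
      define J where "J i = (if U i = {} then {} else ?B (Inf (U i)) (diameter (U i)))" for i
      have Js: "J i \<in> sets M" for i unfolding J_def using Bs by auto
      have cover: "x \<in> space M \<Longrightarrow> Y x \<in> U i \<Longrightarrow> x \<in> J i" for x i
      proof -
        assume x: "x \<in> space M" "Y x \<in> U i"
        have "Inf (U i) \<le> Y x"
          using x(2) U(2)[of i] by (intro cInf_lower bounded_imp_bdd_below)
        moreover have "Y x - diameter (U i) \<le> Inf (U i)"
        proof (rule cInf_greatest)
          fix y assume "y \<in> U i"
          then show "Y x - diameter (U i) \<le> y"
            using diameter_bounded_bound[OF U(2) x(2), of y] by (auto simp: dist_real_def abs_le_iff)
        qed (use x(2) in auto)
        ultimately show "x \<in> J i" using x by (auto simp: J_def)
      qed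
      have "AE x in M. x \<in> (\<Union>i. J i)"
        using A AE_space by eventually_elim (use U(1) cover in blast)
      then have "1 = emeasure M (\<Union>i. J i)"
        using Js by (intro emeasure_eq_1_AE[symmetric]) auto
      also have "\<dots> \<le> (\<Sum>i. emeasure M (J i))"
        using Js by (intro emeasure_subadditive_countably) auto
      also have "\<dots> \<le> (\<Sum>i. ennreal C * hausdorff_gauge s (U i))"
      proof (rule suminf_le)
        fix i
        show "emeasure M (J i) \<le> ennreal C * hausdorff_gauge s (U i)"
        proof (cases "U i = {} \<or> diameter (U i) = 0")
          case True
          then have "J i = {} \<or> J i = ?B (Inf (U i)) 0" by (auto simp: J_def)
          then have "emeasure M (J i) = 0"
          proof
            assume "J i = ?B (Inf (U i)) 0"
            then show ?thesis using point[of "Inf (U i)"] unfolding emeasure_eq_measure by (simp only: ennreal_0)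
          qed simp
          then show ?thesis by simp
        next
          case False
          let ?d = "diameter (U i)"
          have d: "0 < ?d" "?d < 1"
            using False diameter_ge_0[OF U(2)[of i]] U(3)[of i] by auto
          have "emeasure M (J i) = ennreal (measure M (?B (Inf (U i)) ?d))"
            using False by (simp add: J_def emeasure_eq_measure)
          also have "\<dots> \<le> ennreal (C * ?d powr t)"
            by (intro ennreal_leI mass d)
          also have "\<dots> = ennreal C * ennreal (?d powr t)" using C by (simp add: ennreal_mult)
          also have "\<dots> \<le> ennreal C * hausdorff_gauge s (U i)"
          proof (rule mult_left_mono)
            have "?d powr t \<le> (if s = 0 then 1 else ?d powr s)"
              using d s t by (auto intro: powr_mono' powr_le1)
            then show "ennreal (?d powr t) \<le> hausdorff_gauge s (U i)"
              using False by (auto simp: hausdorff_gauge_def intro: ennreal_leI split: if_splits)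
          qed simp
          finally show ?thesis .
        qed
      qed auto
      also have "\<dots> = ennreal C * (\<Sum>i. hausdorff_gauge s (U i))" by (rule ennreal_suminf_cmult)
      finally have one: "1 \<le> ennreal C * (\<Sum>i. hausdorff_gauge s (U i))" .
      have "ennreal (1 / C) = ennreal (1 / C) * 1" by simp
      also have "\<dots> \<le> ennreal (1 / C) * (ennreal C * (\<Sum>i. hausdorff_gauge s (U i)))"
        using one by (intro mult_left_mono) auto
      also have "\<dots> = (\<Sum>i. hausdorff_gauge s (U i))"
        using C by (simp add: mult.assoc[symmetric] ennreal_mult[symmetric])
      finally show ?thesis .
    qed
    have "ennreal (1 / C) \<le> hausdorff_premeasure s (1/2) A"
      unfolding hausdorff_premeasure_def by (intro INF_greatest lower) auto
    also have "\<dots> \<le> hausdorff_measure s A"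
      unfolding hausdorff_measure_def by (rule SUP_upper) simp
    finally have "ennreal (1 / C) \<le> hausdorff_measure s A" .
    moreover have "0 < ennreal (1 / C)" using C by simp
    ultimately show ?thesis by (metis leD)
  qed
  show ?thesis
    unfolding hausdorff_dim_def
  proof (rule INF_greatest)
    fix s assume "s \<in> {s. 0 \<le> s \<and> hausdorff_measure s A = 0}"
    then have "\<not> s \<le> t" using pos by auto
    then show "ennreal t \<le> ennreal s" by (simp add: ennreal_leI)
  qed
qed

context block_system
begin

lemma pos_interval: "\<exists>M. pos M \<le> n \<and> n < pos (Suc M)"
proof (induction n)
  case 0
  show ?case using L_pos[of 0] by (intro exI[of _ 0]) (simp add: pos_def)
next
  case (Suc n)
  then obtain M where M: "pos M \<le> n" "n < pos (Suc M)" by blast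
  show ?case
  proof (cases "Suc n < pos (Suc M)")
    case True
    then show ?thesis using M by (intro exI[of _ M]) auto
  next
    case False
    then have "pos (Suc M) = Suc n" using M by simp
    moreover have "pos (Suc M) < pos (Suc (Suc M))" using L_pos[of "Suc M"] by (simp add: pos_def)
    ultimately show ?thesis by (intro exI[of _ "Suc M"]) auto
  qed
qed

lemma pos_mono: "m \<le> n \<Longrightarrow> pos m \<le> pos n"
  unfolding pos_def by (intro sum_mono2) auto

text \<open>Complete blocks contribute errors proportional to their length, and the unfinished block
  an error \<open>o(m)\<close> with \<open>m\<close> its index, which is at most the elapsed
  time.\<close>

lemma good_average:
  assumes avg: "\<And>\<eta>. 0 < \<eta> \<Longrightarrow> \<exists>m0. \<forall>m\<ge>m0. \<forall>w\<in>G m. \<forall>\<omega>\<in>reg. prefix_of \<omega> (L m) = w \<longrightarrow>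
        \<bar>birkhoff_sum \<phi> (L m) \<omega> - real (L m) * c\<bar> \<le> \<eta> * real (L m)"
    and part: "\<And>\<eta>. 0 < \<eta> \<Longrightarrow> \<exists>m0. \<forall>m\<ge>m0. \<forall>w\<in>G m. \<forall>l\<le>L m. \<forall>\<omega>\<in>reg. prefix_of \<omega> (L m) = w \<longrightarrow>
        \<bar>birkhoff_sum \<phi> l \<omega> - real l * c\<bar> \<le> \<eta> * real m"
    and X: "good X" "block_code X \<in> reg"
  shows "(\<lambda>n. birkhoff_sum \<phi> n (block_code X) / real n) \<longlonglongrightarrow> c"
proof -
  let ?w = "block_code X"
  define D where "D n = birkhoff_sum \<phi> n ?w - real n * c" for n
  define bl where "bl m = birkhoff_sum \<phi> (L m) (shift_code (pos m) ?w) - real (L m) * c" for m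
  have Dpos: "D (pos m) = (\<Sum>i<m. bl i)" for m
  proof (induction m)
    case (Suc m)
    have "pos (Suc m) = pos m + L m" by (simp add: pos_def)
    then have "D (pos (Suc m)) = D (pos m) + bl m"
      by (simp only: D_def bl_def birkhoff_sum_add of_nat_add) (simp add: algebra_simps)
    then show ?case using Suc by simp
  qed (simp add: D_def pos_def)
  have block: "shift_code (pos m) ?w \<in> reg" "prefix_of (shift_code (pos m) ?w) (L m) \<in> G m" for m
    by (rule reg_shift[OF X(2)]) (metis block_of_block_code[OF X(1), of m] X(1) good_def)
  have bound: "\<exists>K\<ge>0. \<forall>n. \<bar>D n\<bar> \<le> K + \<eta> * real n" if e: "0 < \<eta>" for \<eta>
  proof -
    have e2: "0 < \<eta> / 2" using e by simp
    obtain m0 where m0: "\<And>m w \<omega>. m0 \<le> m \<Longrightarrow> w \<in> G m \<Longrightarrow> \<omega> \<in> reg \<Longrightarrow> prefix_of \<omega> (L m) = w \<Longrightarrow>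
        \<bar>birkhoff_sum \<phi> (L m) \<omega> - real (L m) * c\<bar> \<le> \<eta> / 2 * real (L m)"
      using avg[OF e2] by blast
    obtain m1 where m1: "\<And>m w l \<omega>. m1 \<le> m \<Longrightarrow> w \<in> G m \<Longrightarrow> l \<le> L m \<Longrightarrow> \<omega> \<in> reg \<Longrightarrow> prefix_of \<omega> (L m) = w \<Longrightarrow>
        \<bar>birkhoff_sum \<phi> l \<omega> - real l * c\<bar> \<le> \<eta> / 2 * real m"
      using part[OF e2] by blast
    \<comment> \<open>\<open>K1\<close> absorbs the blocks before their averages are good,
      \<open>K2\<close> all times before the estimate for unfinished blocks applies.\<close>
    define K1 K2 where "K1 = (\<Sum>m<m0. \<bar>bl m\<bar>)" and "K2 = (\<Sum>n<pos m1. \<bar>D n\<bar>)"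
    have K: "0 \<le> K1" "0 \<le> K2" by (auto simp: K1_def K2_def sum_nonneg)
    have blk: "\<bar>bl m\<bar> \<le> (if m < m0 then \<bar>bl m\<bar> else 0) + \<eta> / 2 * real (L m)" for m
      using m0[OF _ block(2) block(1) refl, of m] e by (auto simp: bl_def not_less)
    have full: "\<bar>D (pos M)\<bar> \<le> K1 + \<eta> / 2 * real (pos M)" for M
    proof -
      have "\<bar>D (pos M)\<bar> \<le> (\<Sum>m<M. \<bar>bl m\<bar>)" unfolding Dpos by (rule sum_abs)
      also have "\<dots> \<le> (\<Sum>m<M. (if m < m0 then \<bar>bl m\<bar> else 0) + \<eta> / 2 * real (L m))"
        by (rule sum_mono) (rule blk)
      also have "\<dots> = (\<Sum>m<M. if m < m0 then \<bar>bl m\<bar> else 0) + \<eta> / 2 * real (pos M)"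
        by (simp add: sum.distrib pos_def sum_distrib_left)
      also have "(\<Sum>m<M. if m < m0 then \<bar>bl m\<bar> else 0) = (\<Sum>m\<in>{..<M} \<inter> {m. m < m0}. \<bar>bl m\<bar>)"
        by (simp add: sum.inter_restrict)
      also have "\<dots> \<le> K1" unfolding K1_def by (intro sum_mono2) auto
      finally show ?thesis by simp
    qed
    have "\<bar>D n\<bar> \<le> (K1 + K2) + \<eta> * real n" for n
    proof (cases "n < pos m1")
      case True
      have "\<bar>D n\<bar> \<le> K2" unfolding K2_def using True by (intro member_le_sum) auto
      moreover have "0 \<le> \<eta> * real n" using e by simp
      ultimately show ?thesis using K by linarith
    next
      case False
      obtain M where M: "pos M \<le> n" "n < pos (Suc M)" using pos_interval by blast
      have Mm1: "m1 \<le> M"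
      proof (rule ccontr)
        assume "\<not> m1 \<le> M"
        then have "pos (Suc M) \<le> pos m1" by (intro pos_mono) simp
        then show False using False M by simp
      qed
      let ?l = "n - pos M"
      have "D n = D (pos M) + (birkhoff_sum \<phi> ?l (shift_code (pos M) ?w) - real ?l * c)"
        using birkhoff_sum_add[of \<phi> "pos M" ?l ?w] M by (simp add: D_def of_nat_diff algebra_simps)
      moreover have "\<bar>birkhoff_sum \<phi> ?l (shift_code (pos M) ?w) - real ?l * c\<bar> \<le> \<eta> / 2 * real M"
        using M by (intro m1[OF Mm1 block(2) _ block(1) refl]) (simp add: pos_def)
      moreover have "\<eta> / 2 * real M \<le> \<eta> / 2 * real n" "\<eta> / 2 * real (pos M) \<le> \<eta> / 2 * real n"
        using M e pos_ge[of M] by (auto intro!: mult_left_mono)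
      ultimately have "\<bar>D n\<bar> \<le> K1 + \<eta> / 2 * real n + \<eta> / 2 * real n"
        using full[of M] abs_triangle_ineq[of "D (pos M)" "birkhoff_sum \<phi> ?l (shift_code (pos M) ?w) - real ?l * c"]
        by linarith
      also have "\<dots> = K1 + \<eta> * real n" by simp
      finally show ?thesis using K by linarith
    qed
    then show ?thesis using K by (intro exI[of _ "K1 + K2"]) auto
  qed
  have "(\<lambda>n. birkhoff_sum \<phi> n ?w / real n - c) \<longlonglongrightarrow> 0"
  proof (rule LIMSEQ_I)
    fix e :: real assume e: "0 < e"
    obtain K where K: "0 \<le> K" "\<And>n. \<bar>D n\<bar> \<le> K + e/2 * real n" using bound[of "e/2"] e by auto
    obtain N where N: "2 * K / e < real N" using reals_Archimedean2 by blast
    have "norm (birkhoff_sum \<phi> n ?w / real n - c - 0) < e" if n: "n \<ge> Suc N" for n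
    proof -
      have npos: "0 < real n" using n by simp
      have "2 * K < e * real N" using N e by (simp add: field_simps)
      also have "\<dots> \<le> e * real n" using n e by simp
      finally have "\<bar>D n\<bar> < e * real n" using K(2)[of n] by (simp add: field_simps)
      moreover have "birkhoff_sum \<phi> n ?w / real n - c = D n / real n" using npos by (simp add: D_def field_simps)
      ultimately show ?thesis using npos by (simp add: abs_divide pos_divide_less_eq)
    qed
    then show "\<exists>N. \<forall>n\<ge>N. norm (birkhoff_sum \<phi> n ?w / real n - c - 0) < e" by blast
  qed
  then show ?thesis by (simp add: LIM_zero_iff)
qed

text \<open>Appending a block divides the length by at most a small power of itself:
  \<open>- ln r\<close> grows at least linearly in the elapsed time, whereas distortion and the cost
  of the next block are sublinear.\<close>

lemma scale_growth:
  assumes cost: "\<And>\<eta>. 0 < \<eta> \<Longrightarrow> \<exists>m0. \<forall>m\<ge>m0. \<forall>w\<in>G m. - ln (weight w) \<le> \<eta> * real m"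
    and d: "0 < \<delta>"
  shows "\<exists>\<kappa>>0. \<forall>X m. good X \<longrightarrow> \<kappa> * r (concat_blocks X m) powr (1 + \<delta>) \<le> r (concat_blocks X (Suc m))"
proof -
  \<comment> \<open>Three errors of size \<open>\<eta>\<close> times the elapsed time occur, two
    from the distortion in \<open>weight\<close> and one from the new block; together they match
    \<open>\<delta> * ln \<xi>\<close>.\<close>
  define \<eta> where "\<eta> = \<delta> * ln \<xi> / 3"
  have e: "0 < \<eta>" using d ln_\<xi>_pos by (simp add: \<eta>_def)
  obtain m0 where m0: "\<And>m w. m0 \<le> m \<Longrightarrow> w \<in> G m \<Longrightarrow> - ln (weight w) \<le> \<eta> * real m"
    using cost[OF e] by blast
  define K1 where "K1 = (\<Sum>m<m0. \<Sum>w\<in>G m. \<bar>ln (weight w)\<bar>)"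
  obtain K2 where K2: "\<And>n. V n \<le> K2 + \<eta> * real n" using V_sublinear[OF e] by blast
  define K where "K = K1 + 2 * K2"
  have c: "- ln (weight w) \<le> K1 + \<eta> * real m" if "w \<in> G m" for m w
  proof (cases "m < m0")
    case True
    have "- ln (weight w) \<le> \<bar>ln (weight w)\<bar>" by simp
    also have "\<dots> \<le> (\<Sum>w\<in>G m. \<bar>ln (weight w)\<bar>)" using that finite_G by (intro member_le_sum) auto
    also have "\<dots> \<le> K1" unfolding K1_def using True by (intro member_le_sum) (auto intro: sum_nonneg)
    finally have "- ln (weight w) \<le> K1" .
    moreover have "0 \<le> \<eta> * real m" using e by simp
    ultimately show ?thesis by linarith
  next
    case False
    have "0 \<le> K1" unfolding K1_def by (intro sum_nonneg) auto
    then show ?thesis using m0[of m w] False that by simp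
  qed
  have "exp (- K) * r (concat_blocks X m) powr (1 + \<delta>) \<le> r (concat_blocks X (Suc m))" if X: "good X" for X m
  proof -
    let ?u = "concat_blocks X m"
    have "weight ?u * weight (X m) \<le> weight ?u * r (X m)"
      using weight_pos[of ?u] r_pos[of "X m"] V_nonneg[of "length (X m)"]
      by (intro mult_left_mono) (auto simp: weight_def mult_le_cancel_left1)
    also have "\<dots> \<le> r (concat_blocks X (Suc m))" unfolding concat_blocks_Suc by (rule r_append_ge)
    finally have a: "weight ?u * weight (X m) \<le> r (concat_blocks X (Suc m))" .
    have len: "length ?u = pos m" by (rule good_length[OF X])
    have lr: "ln (r ?u) \<le> - (real (pos m) * ln \<xi>)" using ln_r_le[of ?u] len by simp
    have "- (K1 + \<eta> * real m) \<le> ln (weight (X m))" using c[of "X m" m] X by (auto simp: good_def)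
    moreover have "\<eta> * real m \<le> \<eta> * real (pos m)" using pos_ge[of m] e by simp
    moreover have "ln (weight ?u) = ln (r ?u) - 2 * V (pos m)"
      using r_pos[of ?u] by (simp add: weight_def ln_mult len)
    ultimately have "- K - 3 * (\<eta> * real (pos m)) + ln (r ?u) \<le> ln (weight ?u) + ln (weight (X m))"
      using K2[of "pos m"] by (simp add: K_def)
    moreover have "\<delta> * ln (r ?u) \<le> - 3 * (\<eta> * real (pos m))"
      using mult_left_mono[OF lr, of \<delta>] d by (simp add: \<eta>_def algebra_simps)
    ultimately have "- K + (1 + \<delta>) * ln (r ?u) \<le> ln (weight ?u * weight (X m))"
      using weight_pos[of ?u] weight_pos[of "X m"] by (simp add: ln_mult algebra_simps)
    moreover have "ln (exp (- K) * r ?u powr (1 + \<delta>)) = - K + (1 + \<delta>) * ln (r ?u)"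
      using r_pos[of ?u] by (simp add: ln_mult ln_powr)
    ultimately have "ln (exp (- K) * r ?u powr (1 + \<delta>)) \<le> ln (weight ?u * weight (X m))" by simp
    then have "exp (- K) * r ?u powr (1 + \<delta>) \<le> weight ?u * weight (X m)"
      using weight_pos[of ?u] weight_pos[of "X m"] r_pos[of ?u] by (subst (asm) ln_le_cancel_iff) auto
    then show ?thesis using a by linarith
  qed
  then show ?thesis by (intro exI[of _ "exp (- K)"]) auto
qed

text \<open>Stop every good sequence of blocks when its cylinder becomes shorter than \<open>d\<close>. The stopped
  cylinders do not overlap, they are not much shorter than \<open>d\<close>, and so few of them meet a given
  interval of length \<open>d\<close>.\<close>

lemma interval_mass:
  assumes \<kappa>: "0 < \<kappa>" "\<And>X m. good X \<Longrightarrow> \<kappa> * r (concat_blocks X m) powr (1 + \<delta>) \<le> r (concat_blocks X (Suc m))"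
    and \<delta>: "0 < \<delta>" and d: "0 < d" "d < 1"
  shows "measure P {X \<in> space P. cod (block_code X) \<in> {a..a + d}} \<le> (3 / \<kappa>) * d powr (s - \<delta>)"
proof -
  define M where "M X = (LEAST m. r (concat_blocks X m) \<le> d)" for X
  \<comment> \<open>By contraction every good sequence is stopped after at most \<open>M0\<close>
    blocks, so only finitely many stopped sequences arise.\<close>
  obtain M0 where M0: "1 / d < \<xi> ^ M0" using real_arch_pow[OF \<xi>_gt_1] by blast
  have small: "r (concat_blocks X M0) \<le> d" if "good X" for X
  proof -
    have "\<xi> ^ M0 * r (concat_blocks X M0) \<le> \<xi> ^ length (concat_blocks X M0) * r (concat_blocks X M0)"
      using good_length[OF that, of M0] pos_ge[of M0] \<xi>_gt_1 r_pos[of "concat_blocks X M0"]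
      by (intro mult_right_mono power_increasing) auto
    also have "\<dots> \<le> 1" by (rule r_le_power)
    also have "1 < \<xi> ^ M0 * d" using M0 d by (simp add: field_simps)
    finally show ?thesis using \<xi>_gt_1 by (simp add: mult_less_cancel_left less_imp_le)
  qed
  have Mle: "r (concat_blocks X (M X)) \<le> d" "M X \<le> M0" if "good X" for X
    unfolding M_def using small[OF that] by (auto intro: LeastI Least_le)
  have Mgt: "d < r (concat_blocks X m)" if "m < M X" for X m
    using not_less_Least[of m "\<lambda>m. r (concat_blocks X m) \<le> d"] that by (auto simp: M_def)
  have Mpos: "0 < M X" if "good X" for X
  proof (rule ccontr)
    assume "\<not> 0 < M X"
    then show False using Mle(1)[OF that] d by simp
  qed
  have low: "\<kappa> * d powr (1 + \<delta>) \<le> r (concat_blocks X (M X))" if X: "good X" for X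
  proof -
    obtain m where m: "M X = Suc m" using Mpos[OF X] by (cases "M X") auto
    have "\<kappa> * d powr (1 + \<delta>) \<le> \<kappa> * r (concat_blocks X m) powr (1 + \<delta>)"
      using Mgt[of m X] m \<kappa>(1) \<delta> d by (intro mult_left_mono powr_mono2) auto
    also have "\<dots> \<le> r (concat_blocks X (M X))" unfolding m by (rule \<kappa>(2)[OF X])
    finally show ?thesis .
  qed
  define S where "S = (\<lambda>X. map X [0..<M X]) ` {X. good X \<and> cod (block_code X) \<in> {a..a + d}}"
  have cct: "concat (map X [0..<m]) = concat_blocks X m" for X m by (simp add: concat_blocks_def)
  have finS: "finite S"
  proof (rule finite_subset)
    show "S \<subseteq> {l. set l \<subseteq> (\<Union>m<M0. G m) \<and> length l \<le> M0}"
    proof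
      fix l assume "l \<in> S"
      then obtain X where X: "l = map X [0..<M X]" "good X" by (auto simp: S_def)
      have "set l \<subseteq> (\<Union>m<M0. G m)"
        using X Mle(2)[OF X(2)] by (force simp: good_def)
      then show "l \<in> {l. set l \<subseteq> (\<Union>m<M0. G m) \<and> length l \<le> M0}"
        using X(1) Mle(2)[OF X(2)] by simp
    qed
    show "finite {l. set l \<subseteq> (\<Union>m<M0. G m) \<and> length l \<le> M0}"
      using finite_G by (intro finite_lists_length_le) auto
  qed
  have rS: "r (concat l) \<le> d" "\<kappa> * d powr (1 + \<delta>) \<le> r (concat l)"
    "Wint (concat l) \<subseteq> {a - d..a + 2 * d}" if "l \<in> S" for l
  proof -
    obtain X where X: "l = map X [0..<M X]" "good X" "cod (block_code X) \<in> {a..a + d}"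
      using \<open>l \<in> S\<close> by (auto simp: S_def)
    show 1: "r (concat l) \<le> d" "\<kappa> * d powr (1 + \<delta>) \<le> r (concat l)"
      using X(1,2) Mle(1) low by (simp_all add: cct)
    have cW: "cod (block_code X) \<in> W (concat l)"
      using cod_in_W[of "block_code X" "pos (M X)"] prefix_block_code_good[OF X(2), of "M X"] X(1) by (simp add: cct)
    show "Wint (concat l) \<subseteq> {a - d..a + 2 * d}"
    proof
      fix y assume "y \<in> Wint (concat l)"
      then have "\<bar>y - cod (block_code X)\<bar> \<le> d" using W_dist[OF _ cW] Wint_subset 1(1) by fastforce
      then show "y \<in> {a - d..a + 2 * d}" using X(3) by (auto simp: abs_le_iff)
    qed
  qed
  \<comment> \<open>No stopped sequence extends another, since the longer one would have been
    stopped earlier. Two of them hence differ at a common block index; the blocks there have equal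
    length and start at the same place, so the words split at a common position.\<close>
  have disj: "disjoint_family_on (\<lambda>l. Wint (concat l)) S"
    unfolding disjoint_family_on_def
  proof (intro ballI impI)
    fix l l' assume l: "l \<in> S" "l' \<in> S" "l \<noteq> l'"
    obtain X where X: "l = map X [0..<M X]" "good X" using l(1) by (auto simp: S_def)
    obtain X' where X': "l' = map X' [0..<M X']" "good X'" using l(2) by (auto simp: S_def)
    have "\<exists>i. i < M X \<and> i < M X' \<and> X i \<noteq> X' i"
    proof (rule ccontr)
      assume neg: "\<not> ?thesis"
      have eq: "X i = X' i" if "i < min (M X) (M X')" for i using neg that by auto
      have "concat_blocks X (min (M X) (M X')) = concat_blocks X' (min (M X) (M X'))" by (rule concat_blocks_cong) (rule eq)
      moreover have "r (concat_blocks X (M X)) \<le> d" "r (concat_blocks X' (M X')) \<le> d" using Mle(1) X(2) X'(2) by auto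
      ultimately have "M X = M X'"
        using Mgt[of "M X" X'] Mgt[of "M X'" X] by (cases "M X" "M X'" rule: linorder_cases) (auto simp: min_def)
      then have "l = l'" using X(1) X'(1) eq by simp
      then show False using l(3) by simp
    qed
    then obtain i0 where i0: "i0 < M X \<and> i0 < M X' \<and> X i0 \<noteq> X' i0" by blast
    define i where "i = (LEAST i. i < M X \<and> i < M X' \<and> X i \<noteq> X' i)"
    have i: "i < M X" "i < M X'" "X i \<noteq> X' i"
      using LeastI[of "\<lambda>i. i < M X \<and> i < M X' \<and> X i \<noteq> X' i", OF i0] by (auto simp: i_def)
    have before: "X j = X' j" if "j < i" for j
      using not_less_Least[OF that[unfolded i_def]] i that by auto
    have "length (X i) = length (X' i)" using length_G X(2) X'(2) unfolding good_def by metis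
    then obtain p x u y v where pre: "x \<noteq> y" "X i = p @ [x] @ u" "X' i = p @ [y] @ v"
      using same_length_different[OF i(3)] by blast
    have "concat_blocks X (M X) = concat_blocks X (Suc i) @ concat_blocks (\<lambda>k. X (Suc i + k)) (M X - Suc i)"
      using concat_blocks_add[of X "Suc i" "M X - Suc i"] i(1) by simp
    then have e1: "concat l = (concat_blocks X i @ p) @ x # (u @ concat_blocks (\<lambda>k. X (Suc i + k)) (M X - Suc i))"
      by (simp add: X(1) cct concat_blocks_Suc pre)
    have "concat_blocks X' (M X') = concat_blocks X' (Suc i) @ concat_blocks (\<lambda>k. X' (Suc i + k)) (M X' - Suc i)"
      using concat_blocks_add[of X' "Suc i" "M X' - Suc i"] i(2) by simp
    moreover have "concat_blocks X' i = concat_blocks X i" by (rule concat_blocks_cong) (simp add: before)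
    ultimately have e2: "concat l' = (concat_blocks X i @ p) @ y # (v @ concat_blocks (\<lambda>k. X' (Suc i + k)) (M X' - Suc i))"
      by (simp add: X'(1) cct concat_blocks_Suc pre)
    show "Wint (concat l) \<inter> Wint (concat l') = {}"
      unfolding e1 e2 by (rule Wint_disjoint[OF pre(1)])
  qed
  \<comment> \<open>Packing: disjoint intervals of length at least
    \<open>\<kappa> * d powr (1 + \<delta>)\<close> lie in an interval of length
    \<open>3 * d\<close>, because each has length at most \<open>d\<close> and its cylinder meets
    \<open>{a..a + d}\<close>.\<close>
  have "ennreal (real (card S) * (\<kappa> * d powr (1 + \<delta>))) = (\<Sum>l\<in>S. ennreal (\<kappa> * d powr (1 + \<delta>)))"
    using \<kappa>(1) by (simp add: ennreal_mult ennreal_of_nat_eq_real_of_nat)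
  also have "\<dots> \<le> (\<Sum>l\<in>S. emeasure lborel (Wint (concat l)))"
    unfolding measure_Wint using rS(2) by (intro sum_mono ennreal_leI) auto
  also have "\<dots> = emeasure lborel (\<Union>l\<in>S. Wint (concat l))"
    using measure_Wint(2) finS disj by (intro sum_emeasure) auto
  also have "\<dots> \<le> emeasure lborel {a - d..a + 2 * d}"
    using rS(3) by (intro emeasure_mono) auto
  also have "\<dots> = ennreal (3 * d)" using d by simp
  finally have "real (card S) * (\<kappa> * d powr (1 + \<delta>)) \<le> 3 * d" using d by (subst (asm) ennreal_le_iff) auto
  then have "real (card S) * \<kappa> * d powr \<delta> \<le> 3" using d by (simp add: powr_add field_simps)
  then have card: "real (card S) \<le> 3 / \<kappa> * d powr (- \<delta>)"
    using \<kappa>(1) d by (simp add: powr_minus field_simps)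
  have Em: "measure P (E (\<lambda>i. l ! i) (length l)) \<le> d powr s" if "l \<in> S" for l
  proof -
    have "concat_blocks (\<lambda>i. l ! i) (length l) = concat l" by (simp add: concat_blocks_def map_nth)
    then have "measure P (E (\<lambda>i. l ! i) (length l)) \<le> r (concat l) powr s"
      using E_prob_r[of "\<lambda>i. l ! i" "length l" "[]"] by simp
    also have "\<dots> \<le> d powr s" using rS(1)[OF that] r_pos[of "concat l"] s_pos by (intro powr_mono2) auto
    finally show ?thesis .
  qed
  have Es: "E b m \<in> sets P" for b m by (rule E_prob)
  have "measure P {X \<in> space P. cod (block_code X) \<in> {a..a + d}} \<le> measure P (\<Union>l\<in>S. E (\<lambda>i. l ! i) (length l))"
  proof (rule P.finite_measure_mono_AE)
    show "AE X in P. X \<in> {X \<in> space P. cod (block_code X) \<in> {a..a + d}} \<longrightarrow> X \<in> (\<Union>l\<in>S. E (\<lambda>i. l ! i) (length l))"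
      using AE_good
    proof eventually_elim
      case (elim X)
      have "X \<in> E (\<lambda>i. map X [0..<M X] ! i) (length (map X [0..<M X]))" by (simp add: E_def)
      moreover have "map X [0..<M X] \<in> S" if "cod (block_code X) \<in> {a..a + d}"
        using elim that by (auto simp: S_def)
      ultimately show ?case by blast
    qed
    show "(\<Union>l\<in>S. E (\<lambda>i. l ! i) (length l)) \<in> sets P" using finS Es by auto
  qed
  also have "\<dots> \<le> (\<Sum>l\<in>S. measure P (E (\<lambda>i. l ! i) (length l)))"
    using finS Es by (intro P.finite_measure_subadditive_finite) auto
  also have "\<dots> \<le> (\<Sum>l\<in>S. d powr s)" by (rule sum_mono) (rule Em)
  also have "\<dots> = real (card S) * d powr s" by simp
  also have "\<dots> \<le> 3 / \<kappa> * d powr (- \<delta>) * d powr s" using card by (intro mult_right_mono) auto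
  also have "\<dots> = (3 / \<kappa>) * d powr (s - \<delta>)" by (simp add: powr_add[symmetric] mult.assoc)
  finally show ?thesis .
qed

text \<open>With \<open>\<delta> = s - t\<close> the exponent in \<open>interval_mass\<close> is
  exactly \<open>t\<close>.\<close>

lemma level_set_dim_ge:
  assumes avg: "\<And>i \<eta>. 0 < \<eta> \<Longrightarrow> \<exists>m0. \<forall>m\<ge>m0. \<forall>w\<in>G m. \<forall>\<omega>\<in>reg. prefix_of \<omega> (L m) = w \<longrightarrow>
        \<bar>birkhoff_sum (\<phi> i) (L m) \<omega> - real (L m) * \<gamma> i\<bar> \<le> \<eta> * real (L m)"
    and part: "\<And>i \<eta>. 0 < \<eta> \<Longrightarrow> \<exists>m0. \<forall>m\<ge>m0. \<forall>w\<in>G m. \<forall>l\<le>L m. \<forall>\<omega>\<in>reg. prefix_of \<omega> (L m) = w \<longrightarrow>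
        \<bar>birkhoff_sum (\<phi> i) l \<omega> - real l * \<gamma> i\<bar> \<le> \<eta> * real m"
    and cost: "\<And>\<eta>. 0 < \<eta> \<Longrightarrow> \<exists>m0. \<forall>m\<ge>m0. \<forall>w\<in>G m. - ln (weight w) \<le> \<eta> * real m"
    and t: "0 < t" "t < s"
  shows "ennreal t \<le> hausdorff_dim (birkhoff_level_set I f \<phi> \<gamma>)"
proof -
  have d: "0 < s - t" using t by simp
  obtain \<kappa> where \<kappa>: "0 < \<kappa>" "\<And>X m. good X \<Longrightarrow> \<kappa> * r (concat_blocks X m) powr (1 + (s - t)) \<le> r (concat_blocks X (Suc m))"
    using scale_growth[OF cost d] by blast
  show ?thesis
  proof (rule mass_distribution[OF prob_space_P, of "\<lambda>X. cod (block_code X)" _ "3 / \<kappa>" t])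
    show "(\<lambda>X. cod (block_code X)) \<in> borel_measurable P"
      using cod_block_code_measurable by (auto simp: measurable_restrict_space2_iff)
    show "AE X in P. cod (block_code X) \<in> birkhoff_level_set I f \<phi> \<gamma>"
      using AE_good AE_reg
    proof eventually_elim
      case (elim X)
      have "birkhoff_sum (\<phi> i) n (block_code X) = (\<Sum>j<n. \<phi> i ((T ^^ j) (cod (block_code X))))" for i n
        using reg_T_pow[OF elim(2)] by (simp add: birkhoff_sum_def)
      then show ?case
        using good_average[OF avg part elim] by (simp add: birkhoff_level_set_def)
    qed
    show "measure P {X \<in> space P. cod (block_code X) \<in> {a..a + e}} \<le> 3 / \<kappa> * e powr t" if "0 < e" "e < 1" for a e
      using interval_mass[OF \<kappa> d that, of a] by simp
  qed (use \<kappa>(1) t in auto)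
qed

end

section \<open>The spectra and the combinatorial condition\<close>

lemma Lim_at_right_mono:
  fixes g :: "real \<Rightarrow> 'a::{complete_linorder, linorder_topology}"
  assumes mono: "\<And>x y. 0 < x \<Longrightarrow> x \<le> y \<Longrightarrow> g x \<le> g y"
  shows "Lim (at_right 0) g = (INF x\<in>{0<..}. g x)"
proof -
  have "(g \<longlongrightarrow> (INF x\<in>{0<..}. g x)) (at_right 0)"
  proof (rule order_tendstoI)
    fix a assume a: "a < (INF x\<in>{0<..}. g x)"
    have "a < g x" if "0 < x" for x
      using a INF_lower[of x "{0<..}" g] that by (auto intro: less_le_trans)
    then show "eventually (\<lambda>x. a < g x) (at_right 0)"
      by (auto simp: eventually_at_right_field intro!: exI[of _ 1])
  next
    fix a assume "(INF x\<in>{0<..}. g x) < a"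
    then obtain x where x: "0 < x" "g x < a" by (auto simp: INF_less_iff)
    then show "eventually (\<lambda>x. g x < a) (at_right 0)"
      unfolding eventually_at_right_field
    proof (intro exI[of _ x] conjI allI impI)
      fix y assume "0 < y" "y < x"
      then show "g y < a" using mono[of y x] x(2) by (meson less_imp_le le_less_trans)
    qed
  qed
  then show ?thesis by (intro tendsto_Lim) auto
qed

definition spectrum_sup ::
    "(nat \<Rightarrow> real set) \<Rightarrow> (nat \<Rightarrow> real \<Rightarrow> real) \<Rightarrow> (nat \<Rightarrow> real \<Rightarrow> real) \<Rightarrow> real measure set
      \<Rightarrow> (nat \<Rightarrow> real) \<Rightarrow> real \<Rightarrow> nat \<Rightarrow> ennreal" where
  "spectrum_sup I f \<phi> M \<gamma> \<epsilon> k =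
    (SUP \<mu> \<in> {\<mu> \<in> M. (\<forall>i<k. integrable \<mu> (\<phi> i) \<and> \<bar>(\<integral>x. \<phi> i x \<partial>\<mu>) - \<gamma> i\<bar> < \<epsilon>)
        \<and> entropy_of I f \<mu> < \<infinity>}. entropy_of I f \<mu> / lyapunov_exponent I f \<mu>)"

text \<open>Increasing \<open>k\<close> or decreasing \<open>\<epsilon>\<close> shrinks the set of
  competing measures, so both limits are infima and can be bounded one pair of parameters at a
  time.\<close>

lemma dim_spectrum_eq_INF:
  "dim_spectrum I f \<phi> M \<gamma> = (INF \<epsilon>\<in>{0<..}. INF k. spectrum_sup I f \<phi> M \<gamma> \<epsilon> k)"
proof -
  let ?s = "spectrum_sup I f \<phi> M \<gamma>"
  have "lim (?s \<epsilon>) = (INF k. ?s \<epsilon> k)" for \<epsilon>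
  proof (intro limI LIMSEQ_INF)
    show "decseq (?s \<epsilon>)"
      unfolding decseq_def spectrum_sup_def by (intro allI impI SUP_subset_mono) auto
  qed
  then have "dim_spectrum I f \<phi> M \<gamma> = Lim (at_right 0) (\<lambda>\<epsilon>. INF k. ?s \<epsilon> k)"
    unfolding dim_spectrum_def spectrum_sup_def by simp
  also have "\<dots> = (INF \<epsilon>\<in>{0<..}. INF k. ?s \<epsilon> k)"
  proof (rule Lim_at_right_mono)
    fix x y :: real assume "x \<le> y"
    then show "(INF k. ?s x k) \<le> (INF k. ?s y k)"
      unfolding spectrum_sup_def by (intro INF_mono' SUP_subset_mono) force+
  qed
  finally show ?thesis .
qed

lemma dim_spectrum_mono: "M \<subseteq> N \<Longrightarrow> dim_spectrum I f \<phi> M \<gamma> \<le> dim_spectrum I f \<phi> N \<gamma>"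
  unfolding dim_spectrum_eq_INF spectrum_sup_def by (intro INF_mono' SUP_subset_mono) auto

context expanding_system
begin

text \<open>Asking for all regular codes through the word makes this a property of the word alone,
  suited to covering as well as to free concatenation.\<close>

definition near_average ::
    "(nat \<Rightarrow> real \<Rightarrow> real) \<Rightarrow> (nat \<Rightarrow> real) \<Rightarrow> real \<Rightarrow> nat \<Rightarrow> nat \<Rightarrow> nat list \<Rightarrow> bool" where
  "near_average \<phi> \<gamma> \<epsilon> k n w \<longleftrightarrow> length w = n \<and>
     (\<forall>i<k. \<forall>\<omega>\<in>reg. prefix_of \<omega> n = w \<longrightarrow> \<bar>birkhoff_sum (\<phi> i) n \<omega> - real n * \<gamma> i\<bar> \<le> real n * \<epsilon>)"

text \<open>The combinatorial condition through which the dimension and both spectra are compared.\<close>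

definition rich :: "(nat \<Rightarrow> real \<Rightarrow> real) \<Rightarrow> (nat \<Rightarrow> real) \<Rightarrow> real \<Rightarrow> bool" where
  "rich \<phi> \<gamma> s \<longleftrightarrow> (\<forall>\<epsilon>>0. \<forall>k N. \<exists>n\<ge>N. \<exists>F. finite F \<and> (\<forall>w\<in>F. near_average \<phi> \<gamma> \<epsilon> k n w) \<and>
     1 \<le> (\<Sum>w\<in>F. weight w powr s))"

lemma richE:
  assumes "rich \<phi> \<gamma> s" "0 < \<epsilon>"
  obtains n F where "N \<le> n" "finite F" "\<And>w. w \<in> F \<Longrightarrow> near_average \<phi> \<gamma> \<epsilon> k n w"
    "1 \<le> (\<Sum>w\<in>F. weight w powr s)"
proof -
  have "\<exists>n\<ge>N. \<exists>F. finite F \<and> (\<forall>w\<in>F. near_average \<phi> \<gamma> \<epsilon> k n w) \<and> 1 \<le> (\<Sum>w\<in>F. weight w powr s)"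
    using assms unfolding rich_def by simp
  then show thesis using that by blast
qed

text \<open>Words with error \<open>\<epsilon> / 2\<close> leave room for the strict inequality in
  the spectrum.\<close>

lemma rich_alpha2:
  assumes s: "0 < s" and rich: "rich \<phi> \<gamma> s" and pot: "\<And>i. potential_variations_vanish I f (\<phi> i)"
  shows "ennreal s \<le> alpha2 I f \<phi> \<gamma>"
  unfolding alpha2_def dim_spectrum_eq_INF
proof (intro INF_greatest)
  fix \<epsilon> :: real and k :: nat assume "\<epsilon> \<in> {0<..}"
  then have e: "0 < \<epsilon> / 2" by simp
  obtain n F where n: "1 \<le> n" and F: "finite F" "1 \<le> (\<Sum>w\<in>F. weight w powr s)"
    and na: "\<And>w. w \<in> F \<Longrightarrow> near_average \<phi> \<gamma> (\<epsilon> / 2) k n w"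
    by (rule richE[OF rich e, of 1 k], rule that)
  have lenF: "length w = n" if "w \<in> F" for w using na[OF that] by (simp add: near_average_def)
  have av: "\<bar>birkhoff_sum (\<phi> i) n \<omega> - real n * \<gamma> i\<bar> \<le> real n * (\<epsilon> / 2)"
    if "i < k" "w \<in> F" "\<omega> \<in> reg" "prefix_of \<omega> n = w" for i w \<omega>
    using na[OF that(2)] that unfolding near_average_def by blast
  have n0: "0 < n" using n by simp
  show "ennreal s \<le> spectrum_sup I f \<phi> (ergodic_measures I f) \<gamma> \<epsilon> k"
  proof (rule block_measure[OF s F(1) lenF n0 F(2)])
    fix \<mu> assume \<mu>: "\<mu> \<in> ergodic_measures I f" "entropy_of I f \<mu> < \<infinity>"
      "ennreal s \<le> entropy_of I f \<mu> / lyapunov_exponent I f \<mu>"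
      and int: "\<And>\<phi> c \<epsilon>. potential_variations_vanish I f \<phi> \<Longrightarrow>
      (\<And>w \<omega>. w \<in> F \<Longrightarrow> \<omega> \<in> reg \<Longrightarrow> prefix_of \<omega> n = w \<Longrightarrow>
         \<bar>birkhoff_sum \<phi> n \<omega> - real n * c\<bar> \<le> real n * \<epsilon>) \<Longrightarrow>
      integrable \<mu> \<phi> \<and> \<bar>(\<integral>x. \<phi> x \<partial>\<mu>) - c\<bar> \<le> \<epsilon>"
    have "integrable \<mu> (\<phi> i) \<and> \<bar>(\<integral>x. \<phi> i x \<partial>\<mu>) - \<gamma> i\<bar> < \<epsilon>" if "i < k" for i
    proof -
      have "integrable \<mu> (\<phi> i) \<and> \<bar>(\<integral>x. \<phi> i x \<partial>\<mu>) - \<gamma> i\<bar> \<le> \<epsilon> / 2"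
        by (rule int[OF pot]) (rule av[OF that])
      then show ?thesis using e by linarith
    qed
    then show ?thesis
      unfolding spectrum_sup_def using \<mu> by (intro SUP_upper2[of \<mu>]) auto
  qed
qed

text \<open>Stage \<open>j\<close> supplies words that are accurate to \<open>1 / (j + 1)\<close>
  for the first \<open>j\<close> potentials. Their lengths and costs are uncontrolled in
  \<open>j\<close>, so each stage is repeated until the next one has become cheap compared with the
  number of blocks already placed.\<close>

lemma rich_dim:
  assumes t: "0 < t" "t < s" and rich: "rich \<phi> \<gamma> s"
    and pot: "\<And>i. potential_variations_vanish I f (\<phi> i)"
  shows "ennreal t \<le> hausdorff_dim (birkhoff_level_set I f \<phi> \<gamma>)"
proof -
  have "\<exists>n F. 1 \<le> n \<and> finite F \<and> (\<forall>w\<in>F. near_average \<phi> \<gamma> (1 / real (Suc j)) j n w) \<and>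
      1 \<le> (\<Sum>w\<in>F. weight w powr s)" for j
    by (rule richE[OF rich, of "1 / real (Suc j)" 1 j]) auto
  then obtain n F where nF: "\<And>j. 1 \<le> n j \<and> finite (F j) \<and>
      (\<forall>w\<in>F j. near_average \<phi> \<gamma> (1 / real (Suc j)) j (n j) w) \<and> 1 \<le> (\<Sum>w\<in>F j. weight w powr s)"
    by metis
  have n: "\<And>j. 1 \<le> n j" and finF: "\<And>j. finite (F j)" and sumF: "\<And>j. 1 \<le> (\<Sum>w\<in>F j. weight w powr s)"
    using nF by blast+
  have lenF: "length w = n j" if "w \<in> F j" for j w using nF[of j] that by (auto simp: near_average_def)
  have avF: "\<bar>birkhoff_sum (\<phi> i) (n j) \<omega> - real (n j) * \<gamma> i\<bar> \<le> real (n j) * (1 / real (Suc j))"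
    if "i < j" "w \<in> F j" "\<omega> \<in> reg" "prefix_of \<omega> (n j) = w" for j i w \<omega>
    using nF[of j] that unfolding near_average_def by blast
  \<comment> \<open>\<open>c1\<close> bounds the logarithmic cost of a block of stage
    \<open>j\<close>, and \<open>c2\<close> the deviation of any partial sum within such a block for
    the first \<open>j\<close> potentials.\<close>
  define c1 where "c1 j = (\<Sum>w\<in>F j. \<bar>ln (weight w)\<bar>)" for j
  define c2 where "c2 j = (\<Sum>i<j. (\<Sum>w\<in>F j. \<Sum>a\<leftarrow>w. letter_bound (\<phi> i) a) + real (n j) * \<bar>\<gamma> i\<bar>)" for j
  have lbs: "0 \<le> (\<Sum>a\<leftarrow>w. letter_bound (\<phi> i) a)" for i w
    by (intro sum_list_nonneg) (auto simp: letter_bound_nonneg)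
  have c0: "0 \<le> c1 j" "0 \<le> c2 j" for j
    unfolding c1_def c2_def by (auto intro!: sum_nonneg add_nonneg_nonneg lbs)
  have "\<exists>c::nat. c1 j + c2 j \<le> real c" for j by (rule real_arch_simple)
  then obtain c :: "nat \<Rightarrow> nat" where c: "\<And>j. c1 j + c2 j \<le> real (c j)" by metis
  define J where "J m = Max {j. j \<le> m \<and> j * c j \<le> m}" for m
  have finJ: "finite {j. j \<le> m \<and> j * c j \<le> m}" for m by simp
  have J: "J m * c (J m) \<le> m" for m
  proof -
    have "J m \<in> {j. j \<le> m \<and> j * c j \<le> m}"
      unfolding J_def by (rule Max_in[OF finJ]) (auto intro: exI[of _ 0])
    then show ?thesis by simp
  qed
  have Jge: "j \<le> J m" if "max j (j * c j) \<le> m" for j m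
    unfolding J_def using that by (intro Max_ge finJ) auto
  have cJ: "real (c (J m)) \<le> \<eta> * real m" if "0 < \<eta>" "1 / \<eta> \<le> real (J m)" for \<eta> m
  proof -
    have "real (c (J m)) * 1 \<le> real (c (J m)) * (\<eta> * real (J m))"
      using that by (intro mult_left_mono) (auto simp: field_simps)
    also have "\<dots> = \<eta> * real (J m * c (J m))" by simp
    also have "\<dots> \<le> \<eta> * real m" using J[of m] that by (intro mult_left_mono) (auto simp flip: of_nat_mult)
    finally show ?thesis by simp
  qed
  interpret B: block_system \<xi> I f s "\<lambda>m. F (J m)" "\<lambda>m. n (J m)"
    by unfold_locales (use t finF lenF sumF n in \<open>auto simp: Suc_le_eq\<close>)
  show ?thesis
  proof (rule B.level_set_dim_ge[OF _ _ _ t])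
    fix i \<eta> assume e: "0 < (\<eta>::real)"
    obtain j0 :: nat where j0: "max (real (Suc i)) (1 / \<eta>) \<le> real j0" using real_arch_simple by blast
    have Jm: "i < J m" "1 / \<eta> \<le> real (J m)" if "max j0 (j0 * c j0) \<le> m" for m
      using Jge[OF that] j0 by auto
    show "\<exists>m0. \<forall>m\<ge>m0. \<forall>w\<in>F (J m). \<forall>\<omega>\<in>reg. prefix_of \<omega> (n (J m)) = w \<longrightarrow>
        \<bar>birkhoff_sum (\<phi> i) (n (J m)) \<omega> - real (n (J m)) * \<gamma> i\<bar> \<le> \<eta> * real (n (J m))"
    proof (intro exI[of _ "max j0 (j0 * c j0)"] allI impI ballI)
      fix m w \<omega> assume m: "max j0 (j0 * c j0) \<le> m" and w: "w \<in> F (J m)" "\<omega> \<in> reg" "prefix_of \<omega> (n (J m)) = w"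
      have "\<bar>birkhoff_sum (\<phi> i) (n (J m)) \<omega> - real (n (J m)) * \<gamma> i\<bar> \<le> real (n (J m)) * (1 / real (Suc (J m)))"
        by (rule avF[OF Jm(1)[OF m] w])
      also have "\<dots> \<le> real (n (J m)) * \<eta>"
        using Jm(2)[OF m] e by (intro mult_left_mono) (auto simp: field_simps)
      finally show "\<bar>birkhoff_sum (\<phi> i) (n (J m)) \<omega> - real (n (J m)) * \<gamma> i\<bar> \<le> \<eta> * real (n (J m))"
        by (simp add: mult.commute)
    qed
    show "\<exists>m0. \<forall>m\<ge>m0. \<forall>w\<in>F (J m). \<forall>l\<le>n (J m). \<forall>\<omega>\<in>reg. prefix_of \<omega> (n (J m)) = w \<longrightarrow>
        \<bar>birkhoff_sum (\<phi> i) l \<omega> - real l * \<gamma> i\<bar> \<le> \<eta> * real m"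
    proof (intro exI[of _ "max j0 (j0 * c j0)"] allI impI ballI)
      fix m w l \<omega> assume m: "max j0 (j0 * c j0) \<le> m" and w: "w \<in> F (J m)" "l \<le> n (J m)" "\<omega> \<in> reg" "prefix_of \<omega> (n (J m)) = w"
      let ?b = "letter_bound (\<phi> i)"
      have "\<bar>birkhoff_sum (\<phi> i) l \<omega>\<bar> \<le> (\<Sum>a\<leftarrow>prefix_of \<omega> l. ?b a)" by (rule birkhoff_sum_letter_bound[OF pot w(3)])
      also have "prefix_of \<omega> l = take l w" using take_prefix_of[OF w(2), of \<omega>] w(4) by simp
      also have "(\<Sum>a\<leftarrow>take l w. ?b a) \<le> (\<Sum>a\<leftarrow>take l w. ?b a) + (\<Sum>a\<leftarrow>drop l w. ?b a)"
        using lbs by simp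
      also have "\<dots> = (\<Sum>a\<leftarrow>w. ?b a)"
        by (simp flip: sum_list_append map_append)
      also have "\<dots> \<le> (\<Sum>w\<in>F (J m). \<Sum>a\<leftarrow>w. ?b a)"
        using w(1) finF lbs by (intro member_le_sum) auto
      finally have 1: "\<bar>birkhoff_sum (\<phi> i) l \<omega>\<bar> \<le> (\<Sum>w\<in>F (J m). \<Sum>a\<leftarrow>w. ?b a)" .
      have 2: "real l * \<bar>\<gamma> i\<bar> \<le> real (n (J m)) * \<bar>\<gamma> i\<bar>" using w(2) by (intro mult_right_mono) auto
      have "(\<Sum>w\<in>F (J m). \<Sum>a\<leftarrow>w. ?b a) + real (n (J m)) * \<bar>\<gamma> i\<bar> \<le> c2 (J m)"
        unfolding c2_def using Jm(1)[OF m]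
        by (intro member_le_sum[where f = "\<lambda>i. (\<Sum>w\<in>F (J m). \<Sum>a\<leftarrow>w. letter_bound (\<phi> i) a) + real (n (J m)) * \<bar>\<gamma> i\<bar>"])
          (auto intro!: sum_nonneg add_nonneg_nonneg lbs)
      also have "\<dots> \<le> real (c (J m))" using c[of "J m"] c0(1)[of "J m"] by linarith
      also have "\<dots> \<le> \<eta> * real m" by (rule cJ[OF e Jm(2)[OF m]])
      finally have "(\<Sum>w\<in>F (J m). \<Sum>a\<leftarrow>w. ?b a) + real (n (J m)) * \<bar>\<gamma> i\<bar> \<le> \<eta> * real m" .
      moreover have "\<bar>birkhoff_sum (\<phi> i) l \<omega> - real l * \<gamma> i\<bar> \<le> \<bar>birkhoff_sum (\<phi> i) l \<omega>\<bar> + real l * \<bar>\<gamma> i\<bar>"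
        using abs_triangle_ineq4[of "birkhoff_sum (\<phi> i) l \<omega>" "real l * \<gamma> i"] by (simp add: abs_mult)
      ultimately show "\<bar>birkhoff_sum (\<phi> i) l \<omega> - real l * \<gamma> i\<bar> \<le> \<eta> * real m" using 1 2 by linarith
    qed
  next
    fix \<eta> assume e: "0 < (\<eta>::real)"
    obtain j0 :: nat where j0: "1 / \<eta> \<le> real j0" using real_arch_simple by blast
    show "\<exists>m0. \<forall>m\<ge>m0. \<forall>w\<in>F (J m). - ln (weight w) \<le> \<eta> * real m"
    proof (intro exI[of _ "max j0 (j0 * c j0)"] allI impI ballI)
      fix m w assume m: "max j0 (j0 * c j0) \<le> m" and w: "w \<in> F (J m)"
      have J1: "1 / \<eta> \<le> real (J m)" using Jge[OF m] j0 by simp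
      have "- ln (weight w) \<le> \<bar>ln (weight w)\<bar>" by simp
      also have "\<dots> \<le> c1 (J m)" unfolding c1_def using w finF by (intro member_le_sum) auto
      also have "\<dots> \<le> real (c (J m))" using c[of "J m"] c0(2)[of "J m"] by linarith
      also have "\<dots> \<le> \<eta> * real m" by (rule cJ[OF e J1])
      finally show "- ln (weight w) \<le> \<eta> * real m" .
    qed
  qed
qed

end

subsection \<open>A weak law of large numbers for finite weights\<close>

definition words_over :: "'a set \<Rightarrow> nat \<Rightarrow> 'a list set" where
  "words_over A m = {l. set l \<subseteq> A \<and> length l = m}"

lemma finite_words_over: "finite A \<Longrightarrow> finite (words_over A m)"
  unfolding words_over_def by (rule finite_lists_length_eq)

lemma words_over_0 [simp]: "words_over A 0 = {[]}"
  by (auto simp: words_over_def)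

lemma sum_words_over_Suc:
  fixes g :: "'a list \<Rightarrow> real"
  shows "(\<Sum>l\<in>words_over A (Suc m). g l) = (\<Sum>x\<in>A. \<Sum>l\<in>words_over A m. g (x # l))"
proof -
  have "words_over A (Suc m) = (\<lambda>(x, l). x # l) ` (A \<times> words_over A m)"
    by (auto simp: words_over_def length_Suc_conv image_iff)
  moreover have "inj_on (\<lambda>(x, l). x # l) (A \<times> words_over A m)"
    by (auto simp: inj_on_def)
  ultimately show ?thesis
    by (simp add: sum.reindex sum.cartesian_product case_prod_unfold comp_def)
qed

text \<open>Total mass, mean and variance of a centred sum under product weights; independence shows
  in the vanishing of the cross term.\<close>

lemma word_moments:
  fixes p g :: "'a \<Rightarrow> real"
  assumes p: "(\<Sum>x\<in>A. p x) = 1" and g: "(\<Sum>x\<in>A. p x * g x) = 0"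
  shows "(\<Sum>l\<in>words_over A m. \<Prod>x\<leftarrow>l. p x) = 1"
    "(\<Sum>l\<in>words_over A m. (\<Prod>x\<leftarrow>l. p x) * (\<Sum>x\<leftarrow>l. g x)) = 0"
    "(\<Sum>l\<in>words_over A m. (\<Prod>x\<leftarrow>l. p x) * (\<Sum>x\<leftarrow>l. g x)\<^sup>2) = real m * (\<Sum>x\<in>A. p x * (g x)\<^sup>2)"
proof (induction m)
  case (Suc m)
  let ?P = "\<lambda>l. \<Prod>x\<leftarrow>l. p x" and ?S = "\<lambda>l. \<Sum>x\<leftarrow>l. g x" and ?W = "words_over A m"
  {
    case 1
    have "(\<Sum>l\<in>words_over A (Suc m). ?P l) = (\<Sum>x\<in>A. p x * (\<Sum>l\<in>?W. ?P l))"
      by (simp add: sum_words_over_Suc sum_distrib_left)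
    then show ?case using Suc p by simp
  next
    case 2
    have "(\<Sum>l\<in>words_over A (Suc m). ?P l * ?S l)
        = (\<Sum>x\<in>A. p x * g x * (\<Sum>l\<in>?W. ?P l) + p x * (\<Sum>l\<in>?W. ?P l * ?S l))"
      by (simp add: sum_words_over_Suc sum_distrib_left sum.distrib[symmetric] algebra_simps)
    then show ?case using Suc g by simp
  next
    case 3
    have "(\<Sum>l\<in>words_over A (Suc m). ?P l * (?S l)\<^sup>2)
        = (\<Sum>x\<in>A. p x * (g x)\<^sup>2 * (\<Sum>l\<in>?W. ?P l) + 2 * (p x * g x) * (\<Sum>l\<in>?W. ?P l * ?S l)
            + p x * (\<Sum>l\<in>?W. ?P l * (?S l)\<^sup>2))"
      by (simp add: sum_words_over_Suc sum_distrib_left sum.distrib[symmetric] algebra_simps power2_eq_square)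
    also have "\<dots> = (\<Sum>x\<in>A. p x * (g x)\<^sup>2) + (\<Sum>x\<in>A. p x) * (real m * (\<Sum>x\<in>A. p x * (g x)\<^sup>2))"
      using Suc by (simp add: sum.distrib sum_distrib_right)
    finally show ?case using p by (simp add: algebra_simps)
  }
qed auto

text \<open>Chebyshev's inequality for each of the \<open>k\<close> functions and a union bound over
  their bad sets; mass \<open>1/2\<close> is all that is used later.\<close>

lemma weak_law:
  fixes p :: "'a \<Rightarrow> real" and g :: "nat \<Rightarrow> 'a \<Rightarrow> real"
  assumes A: "finite A" and p0: "\<And>x. x \<in> A \<Longrightarrow> 0 \<le> p x" and p: "(\<Sum>x\<in>A. p x) = 1" and d: "0 < \<delta>"
  shows "\<exists>M0. \<forall>m\<ge>M0. 1 / 2 \<le> (\<Sum>l\<in>{l \<in> words_over A m.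
      \<forall>j<k. \<bar>(\<Sum>x\<leftarrow>l. g j x) - real m * (\<Sum>x\<in>A. p x * g j x)\<bar> \<le> \<delta> * real m}. \<Prod>x\<leftarrow>l. p x)"
proof -
  define \<mu> where "\<mu> j = (\<Sum>x\<in>A. p x * g j x)" for j
  define v where "v j = (\<Sum>x\<in>A. p x * (g j x - \<mu> j)\<^sup>2)" for j
  have v0: "0 \<le> v j" for j unfolding v_def using p0 by (intro sum_nonneg) auto
  \<comment> \<open>Chosen so that the summed Chebyshev bounds
    \<open>v j / (\<delta>\<^sup>2 * m)\<close> stay below \<open>1/2\<close>.\<close>
  obtain M0 :: nat where M0: "2 * (\<Sum>j<k. v j) / \<delta>\<^sup>2 < real M0" using reals_Archimedean2 by blast
  show ?thesis
  proof (intro exI[of _ "Suc M0"] allI impI)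
    fix m assume m: "Suc M0 \<le> m"
    let ?W = "words_over A m" and ?P = "\<lambda>l. \<Prod>x\<leftarrow>l. p x"
    define B where "B j = {l \<in> ?W. \<delta> * real m < \<bar>(\<Sum>x\<leftarrow>l. g j x) - real m * \<mu> j\<bar>}" for j
    define T where "T = {l \<in> ?W. \<forall>j<k. \<bar>(\<Sum>x\<leftarrow>l. g j x) - real m * \<mu> j\<bar> \<le> \<delta> * real m}"
    have finW: "finite ?W" by (rule finite_words_over[OF A])
    have P0: "0 \<le> ?P l" if "l \<in> ?W" for l
      using that p0 by (intro prod_list_nonneg) (auto simp: words_over_def)
    have mpos: "0 < real m" using m by simp
    have cent: "(\<Sum>x\<in>A. p x * (g j x - \<mu> j)) = 0" for j
      using p by (simp add: right_diff_distrib sum_subtractf \<mu>_def flip: sum_distrib_right)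
    have dev: "(\<Sum>x\<leftarrow>l. g j x - \<mu> j) = (\<Sum>x\<leftarrow>l. g j x) - real m * \<mu> j" if "l \<in> ?W" for l j
      using that by (simp add: words_over_def sum_list_subtractf sum_list_triv)
    have bad: "(\<Sum>l\<in>B j. ?P l) \<le> v j / (\<delta>\<^sup>2 * real m)" for j
    proof -
      have "(\<delta> * real m)\<^sup>2 * (\<Sum>l\<in>B j. ?P l) = (\<Sum>l\<in>B j. ?P l * (\<delta> * real m)\<^sup>2)"
        unfolding sum_distrib_left by (intro sum.cong) auto
      also have "\<dots> \<le> (\<Sum>l\<in>B j. ?P l * (\<Sum>x\<leftarrow>l. g j x - \<mu> j)\<^sup>2)"
      proof (intro sum_mono mult_left_mono)
        fix l assume l: "l \<in> B j"
        then have "(\<delta> * real m)\<^sup>2 \<le> \<bar>(\<Sum>x\<leftarrow>l. g j x) - real m * \<mu> j\<bar>\<^sup>2"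
          using d mpos by (intro power_mono) (auto simp: B_def)
        then show "(\<delta> * real m)\<^sup>2 \<le> (\<Sum>x\<leftarrow>l. g j x - \<mu> j)\<^sup>2"
          using l dev[of l j] by (simp add: B_def)
        show "0 \<le> ?P l" using l P0 by (simp add: B_def)
      qed
      also have "\<dots> \<le> (\<Sum>l\<in>?W. ?P l * (\<Sum>x\<leftarrow>l. g j x - \<mu> j)\<^sup>2)"
        using finW P0 by (intro sum_mono2) (auto simp: B_def)
      also have "\<dots> = real m * v j" unfolding v_def by (rule word_moments(3)[OF p cent])
      finally show ?thesis using d mpos by (simp add: field_simps power2_eq_square)
    qed
    have "1 = (\<Sum>l\<in>?W. ?P l)" using word_moments(1)[OF p cent] by simp
    also have "?W = T \<union> (\<Union>j<k. B j)" by (auto simp: T_def B_def not_le)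
    also have "(\<Sum>l\<in>T \<union> (\<Union>j<k. B j). ?P l) \<le> (\<Sum>l\<in>T. ?P l) + (\<Sum>l\<in>(\<Union>j<k. B j). ?P l)"
    proof -
      have fin: "finite T" "finite (\<Union>j<k. B j)" using finW by (auto simp: T_def B_def)
      have "0 \<le> (\<Sum>l\<in>T \<inter> (\<Union>j<k. B j). ?P l)" using P0 by (intro sum_nonneg) (auto simp: T_def)
      then show ?thesis using sum.union_inter[OF fin, of ?P] by linarith
    qed
    also have "(\<Sum>l\<in>(\<Union>j<k. B j). ?P l) \<le> (\<Sum>j<k. \<Sum>l\<in>B j. ?P l)"
    proof (induction k)
      case (Suc k)
      have fin: "finite (\<Union>j<k. B j)" "finite (B k)" using finW by (auto simp: B_def)
      have "0 \<le> (\<Sum>l\<in>(\<Union>j<k. B j) \<inter> B k. ?P l)" using P0 by (intro sum_nonneg) (auto simp: B_def)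
      moreover have "(\<Union>j<Suc k. B j) = (\<Union>j<k. B j) \<union> B k" by (auto simp: less_Suc_eq)
      ultimately show ?case using sum.union_inter[OF fin, of ?P] Suc by simp
    qed simp
    also have "(\<Sum>j<k. \<Sum>l\<in>B j. ?P l) \<le> (\<Sum>j<k. v j / (\<delta>\<^sup>2 * real m))" by (rule sum_mono) (rule bad)
    also have "\<dots> = (\<Sum>j<k. v j) / (\<delta>\<^sup>2 * real m)" by (simp add: sum_divide_distrib)
    also have "\<dots> \<le> 1 / 2"
    proof -
      have "2 * (\<Sum>j<k. v j) < \<delta>\<^sup>2 * real M0" using M0 d by (simp add: field_simps)
      also have "\<dots> \<le> \<delta>\<^sup>2 * real m" using m by (intro mult_left_mono) auto
      finally show ?thesis using d mpos by (simp add: field_simps)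
    qed
    finally have "1 / 2 \<le> (\<Sum>l\<in>T. ?P l)" by simp
    then show "1 / 2 \<le> (\<Sum>l\<in>{l \<in> ?W. \<forall>j<k. \<bar>(\<Sum>x\<leftarrow>l. g j x) - real m * (\<Sum>x\<in>A. p x * g j x)\<bar> \<le> \<delta> * real m}. ?P l)"
      unfolding T_def \<mu>_def .
  qed
qed

section \<open>From invariant measures to typical words\<close>

context expanding_system
begin

text \<open>The condition that involves \<open>ln (p w)\<close> says that the entropy of \<open>p\<close> exceeds \<open>s\<close> times its mean
  negative logarithmic weight.\<close>

lemma typical_words:
  assumes s: "0 < s" and A: "finite A" "\<And>w. w \<in> A \<Longrightarrow> length w = n" and n: "0 < n"
    and p: "\<And>w. w \<in> A \<Longrightarrow> 0 < p w" "(\<Sum>w\<in>A. p w) = 1"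
    and \<kappa>: "0 < (\<Sum>w\<in>A. p w * (- ln (p w) + s * ln (weight w)))" and \<epsilon>: "0 < \<epsilon>"
    and pot: "\<And>i. potential_variations_vanish I f (\<phi> i)"
    and PVn: "\<And>i. i < k \<Longrightarrow> pot_osc (\<phi> i) n \<le> real n * \<epsilon> / 4"
    and mean: "\<And>i. i < k \<Longrightarrow> \<bar>(\<Sum>w\<in>A. p w * birkhoff_sum (\<phi> i) n (periodic_code w)) - real n * \<gamma> i\<bar> \<le> real n * \<epsilon> / 2"
  shows "\<exists>n\<ge>N. \<exists>F. finite F \<and> (\<forall>w\<in>F. near_average \<phi> \<gamma> \<epsilon> k n w) \<and> 1 \<le> (\<Sum>w\<in>F. weight w powr s)"
proof -
  \<comment> \<open>The first \<open>k\<close> test functions are block sums of the potentials;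
    index \<open>k\<close> carries the entropy gap.\<close>
  define g where "g j w = (if j < k then birkhoff_sum (\<phi> j) n (periodic_code w) else - ln (p w) + s * ln (weight w))" for j w
  define m\<kappa> where "m\<kappa> = (\<Sum>w\<in>A. p w * (- ln (p w) + s * ln (weight w)))"
  have mk: "0 < m\<kappa>" using \<kappa> by (simp add: m\<kappa>_def)
  define \<delta> where "\<delta> = min (m\<kappa> / 2) (real n * \<epsilon> / 4)"
  have d: "0 < \<delta>" using mk \<epsilon> n by (simp add: \<delta>_def)
  obtain M0 where M0: "\<And>m. M0 \<le> m \<Longrightarrow> 1 / 2 \<le> (\<Sum>l\<in>{l \<in> words_over A m.
      \<forall>j<Suc k. \<bar>(\<Sum>x\<leftarrow>l. g j x) - real m * (\<Sum>x\<in>A. p x * g j x)\<bar> \<le> \<delta> * real m}. \<Prod>x\<leftarrow>l. p x)"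
    using weak_law[OF A(1) less_imp_le[OF p(1)] p(2) d, of "Suc k" g] by blast
  \<comment> \<open>At length \<open>n * m\<close> the distortion term \<open>2 * s * V\<close> then
    costs at most a constant plus a quarter of \<open>m * m\<kappa>\<close>; \<open>M1\<close> makes
    the constants fit into another quarter.\<close>
  have e: "0 < m\<kappa> / (8 * s * real n)" using mk s n by simp
  obtain K where K: "0 \<le> K" "\<And>m. V m \<le> K + m\<kappa> / (8 * s * real n) * real m" using V_sublinear[OF e] by blast
  obtain M1 :: nat where M1: "4 * (ln 2 + 2 * s * K) / m\<kappa> < real M1" using reals_Archimedean2 by blast
  define m where "m = max (max M0 M1) (Suc N)"
  define Ty where "Ty = {l \<in> words_over A m.
      \<forall>j<Suc k. \<bar>(\<Sum>x\<leftarrow>l. g j x) - real m * (\<Sum>x\<in>A. p x * g j x)\<bar> \<le> \<delta> * real m}"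
  have half: "1 / 2 \<le> (\<Sum>l\<in>Ty. \<Prod>x\<leftarrow>l. p x)" unfolding Ty_def by (rule M0) (simp add: m_def)
  have mpos: "0 < m" by (simp add: m_def)
  have Tyw: "set l \<subseteq> A" "length l = m" if "l \<in> Ty" for l using that by (auto simp: Ty_def words_over_def)
  have finTy: "finite Ty" unfolding Ty_def using finite_words_over[OF A(1)] by simp
  have len: "length (concat l) = n * m" if "l \<in> Ty" for l
  proof -
    have "length (concat l) = (\<Sum>w\<leftarrow>l. length w)" by (simp add: length_concat)
    also have "\<dots> = (\<Sum>w\<leftarrow>l. n)" using Tyw(1)[OF that] A(2) by (intro arg_cong[where f = sum_list] map_cong) auto
    also have "\<dots> = n * m" using Tyw(2)[OF that] by (simp add: sum_list_triv)
    finally show ?thesis .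
  qed
  \<comment> \<open>All blocks have length \<open>n\<close>, so concatenation can be undone and no
    word is counted twice.\<close>
  have inj: "inj_on concat Ty"
  proof (rule inj_onI)
    fix l l' assume l: "l \<in> Ty" "l' \<in> Ty" "concat l = concat l'"
    have "\<forall>(x, y)\<in>set (zip l l'). length x = length y"
    proof (intro ballI)
      fix z assume z: "z \<in> set (zip l l')"
      obtain x y where xy: "z = (x, y)" by (cases z)
      have "x \<in> A" "y \<in> A"
        using set_zip_leftD[OF z[unfolded xy]] set_zip_rightD[OF z[unfolded xy]]
          Tyw(1)[OF l(1)] Tyw(1)[OF l(2)] by blast+
      then show "case z of (x, y) \<Rightarrow> length x = length y" using A(2) by (simp add: xy)
    qed
    then show "l = l'" using concat_eq_concat_iff Tyw(2) l by metis
  qed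
  \<comment> \<open>The error budget per letter is \<open>\<epsilon> / 4\<close> for replacing the
    code by periodic samples, \<open>\<epsilon> / 4\<close> for typicality and
    \<open>\<epsilon> / 2\<close> for the mean.\<close>
  have NA: "near_average \<phi> \<gamma> \<epsilon> k (n * m) (concat l)" if l: "l \<in> Ty" for l
    unfolding near_average_def
  proof (intro conjI allI impI ballI)
    show "length (concat l) = n * m" by (rule len[OF l])
    fix i \<omega> assume i: "i < k" and w: "\<omega> \<in> reg" "prefix_of \<omega> (n * m) = concat l"
    have "\<bar>birkhoff_sum (\<phi> i) (length (concat l)) \<omega> - (\<Sum>w\<leftarrow>l. birkhoff_sum (\<phi> i) n (periodic_code w))\<bar> \<le> real (length l) * pot_osc (\<phi> i) n"
      if "set l \<subseteq> A" "\<omega> \<in> reg" "prefix_of \<omega> (length (concat l)) = concat l" for l \<omega>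
      using that
    proof (induction l arbitrary: \<omega>)
      case (Cons w l)
      have lw: "length w = n" and wA: "w \<in> A" using Cons.prems A(2) by auto
      have wne: "w \<noteq> []" using lw n by auto
      have pre: "prefix_of \<omega> n = w" "prefix_of (shift_code n \<omega>) (length (concat l)) = concat l"
        using Cons.prems(3) prefix_of_append_iff[of \<omega> w "concat l"] lw by auto
      have "\<bar>birkhoff_sum (\<phi> i) n \<omega> - birkhoff_sum (\<phi> i) n (periodic_code w)\<bar> \<le> pot_osc (\<phi> i) n"
        using prefix_periodic_code[OF wne] lw pre(1) by (intro birkhoff_sum_close pot Cons.prems periodic_code_reg wne) simp
      moreover have "\<bar>birkhoff_sum (\<phi> i) (length (concat l)) (shift_code n \<omega>) - (\<Sum>w\<leftarrow>l. birkhoff_sum (\<phi> i) n (periodic_code w))\<bar> \<le> real (length l) * pot_osc (\<phi> i) n"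
        using Cons.prems pre(2) by (intro Cons.IH reg_shift) auto
      ultimately show ?case using lw by (simp add: birkhoff_sum_add algebra_simps abs_le_iff)
    qed simp
    from this[OF Tyw(1)[OF l] w(1)] have
      1: "\<bar>birkhoff_sum (\<phi> i) (n * m) \<omega> - (\<Sum>w\<leftarrow>l. birkhoff_sum (\<phi> i) n (periodic_code w))\<bar> \<le> real m * pot_osc (\<phi> i) n"
      using w(2) len[OF l] Tyw(2)[OF l] by simp
    have "\<bar>(\<Sum>w\<leftarrow>l. g i w) - real m * (\<Sum>w\<in>A. p w * g i w)\<bar> \<le> \<delta> * real m"
      using l i by (simp add: Ty_def)
    then have 2: "\<bar>(\<Sum>w\<leftarrow>l. birkhoff_sum (\<phi> i) n (periodic_code w)) - real m * (\<Sum>w\<in>A. p w * birkhoff_sum (\<phi> i) n (periodic_code w))\<bar> \<le> \<delta> * real m"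
      using i by (simp add: g_def)
    have 3: "\<bar>real m * (\<Sum>w\<in>A. p w * birkhoff_sum (\<phi> i) n (periodic_code w)) - real m * (real n * \<gamma> i)\<bar> \<le> real m * (real n * \<epsilon> / 2)"
      using mult_left_mono[OF mean[OF i], of "real m"] by (simp add: abs_mult flip: right_diff_distrib)
    have 4: "real m * pot_osc (\<phi> i) n \<le> real m * (real n * \<epsilon> / 4)"
      using PVn[OF i] by (intro mult_left_mono) auto
    have 5: "\<delta> * real m \<le> real m * (real n * \<epsilon> / 4)"
      unfolding mult.commute[of \<delta>] by (intro mult_left_mono) (auto simp: \<delta>_def)
    have "\<bar>birkhoff_sum (\<phi> i) (n * m) \<omega> - real m * (real n * \<gamma> i)\<bar> \<le> real m * (real n * \<epsilon> / 4) + real m * (real n * \<epsilon> / 4) + real m * (real n * \<epsilon> / 2)"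
      using 1 2 3 4 5 by linarith
    then show "\<bar>birkhoff_sum (\<phi> i) (n * m) \<omega> - real (n * m) * \<gamma> i\<bar> \<le> real (n * m) * \<epsilon>"
      by (simp add: algebra_simps)
  qed
  \<comment> \<open>Typicality at index \<open>k\<close> makes the probability exponentially smaller
    than the product of weights raised to \<open>s\<close>. The factor 2 compensates for the typical
    words having mass only \<open>1/2\<close>.\<close>
  have tm: "(\<Prod>w\<leftarrow>l. p w) * 2 \<le> weight (concat l) powr s" if l: "l \<in> Ty" for l
  proof -
    have pos: "0 < (\<Prod>w\<leftarrow>l. weight w)" by (induction l) (auto simp: weight_pos)
    have lnp: "ln (\<Prod>w\<leftarrow>l. p w) = (\<Sum>w\<leftarrow>l. ln (p w)) \<and> 0 < (\<Prod>w\<leftarrow>l. p w)" if "set l \<subseteq> A" for l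
      using that
    proof (induction l)
      case (Cons w l)
      then show ?case using p(1)[of w] by (simp add: ln_mult)
    qed simp
    have lnw: "ln (\<Prod>w\<leftarrow>l. weight w) = (\<Sum>w\<leftarrow>l. ln (weight w))"
    proof (induction l)
      case (Cons w l)
      have "0 < (\<Prod>w\<leftarrow>l. weight w)" by (induction l) (auto simp: weight_pos)
      then show ?case using Cons weight_pos[of w] by (simp add: ln_mult)
    qed simp
    have gk: "(\<Sum>w\<leftarrow>l. g k w) = - (\<Sum>w\<leftarrow>l. ln (p w)) + s * (\<Sum>w\<leftarrow>l. ln (weight w))"
      by (induction l) (auto simp: g_def algebra_simps)
    have "\<bar>(\<Sum>w\<leftarrow>l. g k w) - real m * m\<kappa>\<bar> \<le> \<delta> * real m"
      using l by (auto simp: Ty_def g_def m\<kappa>_def)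
    then have "real m * m\<kappa> - \<delta> * real m \<le> (\<Sum>w\<leftarrow>l. g k w)" by (simp add: abs_le_iff)
    moreover have "\<delta> * real m \<le> m\<kappa> / 2 * real m" by (intro mult_right_mono) (auto simp: \<delta>_def)
    ultimately have low: "real m * m\<kappa> / 2 \<le> (\<Sum>w\<leftarrow>l. g k w)" by (simp add: algebra_simps)
    have "s * (2 * V (n * m)) \<le> s * (2 * (K + m\<kappa> / (8 * s * real n) * real (n * m)))"
      using K(2)[of "n * m"] s by (intro mult_left_mono) auto
    also have "\<dots> = 2 * s * K + real m * m\<kappa> / 4" using s n by (simp add: field_simps)
    finally have Vb: "s * (2 * V (n * m)) \<le> 2 * s * K + real m * m\<kappa> / 4" .
    have "4 * (ln 2 + 2 * s * K) < m\<kappa> * real M1" using M1 mk by (simp add: field_simps)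
    also have "\<dots> \<le> m\<kappa> * real m" using mk by (intro mult_left_mono) (auto simp: m_def)
    finally have big: "ln 2 + 2 * s * K \<le> real m * m\<kappa> / 4" by (simp add: mult.commute)
    have "ln ((\<Prod>w\<leftarrow>l. p w) * 2) = (\<Sum>w\<leftarrow>l. ln (p w)) + ln 2"
      using lnp[OF Tyw(1)[OF l]] by (simp add: ln_mult)
    also have "\<dots> \<le> s * (\<Sum>w\<leftarrow>l. ln (weight w)) - s * (2 * V (n * m))"
      using low Vb big gk by linarith
    also have "\<dots> \<le> s * ln (r (concat l)) - s * (2 * V (n * m))"
    proof -
      have "ln (\<Prod>w\<leftarrow>l. weight w) \<le> ln (r (concat l))"
        using r_concat_ge[of l] pos r_pos[of "concat l"] by (subst ln_le_cancel_iff) auto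
      then show ?thesis using s lnw by simp
    qed
    also have "\<dots> = s * ln (weight (concat l))"
      using r_pos[of "concat l"] len[OF l] by (simp add: weight_def ln_mult algebra_simps)
    also have "\<dots> = ln (weight (concat l) powr s)" using weight_pos[of "concat l"] by (simp add: ln_powr)
    finally show ?thesis
      using lnp[OF Tyw(1)[OF l]] weight_pos[of "concat l"] by (subst (asm) ln_le_cancel_iff) auto
  qed
  have "1 \<le> (\<Sum>l\<in>Ty. (\<Prod>x\<leftarrow>l. p x) * 2)" using half by (simp flip: sum_distrib_right)
  also have "\<dots> \<le> (\<Sum>l\<in>Ty. weight (concat l) powr s)" by (rule sum_mono) (rule tm)
  also have "\<dots> = (\<Sum>w\<in>concat ` Ty. weight w powr s)" by (simp add: sum.reindex[OF inj])
  finally have "1 \<le> (\<Sum>w\<in>concat ` Ty. weight w powr s)" .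
  moreover have "N \<le> n * m"
  proof -
    have "N \<le> m" by (simp add: m_def)
    also have "m \<le> n * m" using n by simp
    finally show ?thesis .
  qed
  ultimately show ?thesis using NA finTy by (intro exI[of _ "n * m"] conjI exI[of _ "concat ` Ty"]) auto
qed

end

lemma sublinear_eventually:
  assumes "\<And>\<delta>. 0 < \<delta> \<Longrightarrow> \<exists>K\<ge>0. \<forall>n. a n \<le> K + \<delta> * real n" "0 < \<delta>"
  shows "eventually (\<lambda>n. a n \<le> \<delta> * real n) sequentially"
proof -
  obtain K where K: "\<And>n. a n \<le> K + \<delta> / 2 * real n" using assms(1)[of "\<delta> / 2"] assms(2) by auto
  obtain N :: nat where N: "2 * K / \<delta> < real N" using reals_Archimedean2 by blast
  have "a n \<le> \<delta> * real n" if n: "N \<le> n" for n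
  proof -
    have "2 * K < \<delta> * real N" using N assms(2) by (simp add: field_simps)
    also have "\<dots> \<le> \<delta> * real n" using n assms(2) by simp
    finally show ?thesis using K[of n] by (simp add: field_simps)
  qed
  then show ?thesis by (auto simp: eventually_sequentially)
qed

lemma geometric_tail_bound:
  fixes q :: real
  assumes q: "0 \<le> q" "q < 1" and D: "finite D" "\<And>n. n \<in> D \<Longrightarrow> N \<le> n"
  shows "(\<Sum>n\<in>D. q ^ n) \<le> q ^ N / (1 - q)"
proof -
  have inj: "inj_on (\<lambda>n. n - N) D" using D(2) by (auto simp: inj_on_def) (metis le_add_diff_inverse)
  have "(\<Sum>n\<in>D. q ^ n) = (\<Sum>n\<in>D. q ^ N * q ^ (n - N))"
    using D(2) by (intro sum.cong) (auto simp flip: power_add)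
  also have "\<dots> = q ^ N * (\<Sum>n\<in>(\<lambda>n. n - N) ` D. q ^ n)"
    by (simp add: sum.reindex[OF inj] sum_distrib_left)
  also have "(\<Sum>n\<in>(\<lambda>n. n - N) ` D. q ^ n) \<le> (\<Sum>n. q ^ n)"
    using q D(1) by (intro sum_le_suminf) (auto intro: summable_geometric)
  also have "(\<Sum>n. q ^ n) = 1 / (1 - q)" using q by (intro suminf_geometric) auto
  finally show ?thesis using q by (simp add: mult_left_mono)
qed

context expanding_system
begin

text \<open>Level \<open>n\<close> entropy is at least \<open>n * h\<close>, and invariance makes
  the integral of an \<open>n\<close>-step Birkhoff sum exactly \<open>n\<close> times the integral.
  So the word distribution of one large level already has the required entropy gap and means;
  cutting it down to finitely many words and renormalising barely changes them.\<close>

lemma measure_typical_words: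
  assumes \<mu>: "\<mu> \<in> invariant_measures I f" and s: "0 < s" and \<epsilon>: "0 < \<epsilon>"
    and fin: "entropy_of I f \<mu> < \<infinity>"
    and ratio: "ennreal s < entropy_of I f \<mu> / lyapunov_exponent I f \<mu>"
    and int: "\<And>i. i < k \<Longrightarrow> integrable \<mu> (\<phi> i)"
    and avg: "\<And>i. i < k \<Longrightarrow> \<bar>(\<integral>x. \<phi> i x \<partial>\<mu>) - \<gamma> i\<bar> < \<epsilon> / 4"
    and pot: "\<And>i. potential_variations_vanish I f (\<phi> i)"
  shows "\<exists>n\<ge>N. \<exists>F. finite F \<and> (\<forall>w\<in>F. near_average \<phi> \<gamma> \<epsilon> k n w) \<and> 1 \<le> (\<Sum>w\<in>F. weight w powr s)"
proof -
  interpret prob_space \<mu> by (rule invariantD[OF \<mu>])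
  have sp: "space \<mu> = \<Lambda>" by (rule invariantD[OF \<mu>])
  have "H \<mu> 1 \<noteq> \<infinity>" using entropy_infinite[OF \<mu>] fin by auto
  then have H1: "H \<mu> 1 < \<infinity>" by (simp add: top.not_eq_extremum)
  obtain h where h: "0 \<le> h" "entropy_of I f \<mu> = ennreal h" "\<And>n. H \<mu> n < \<infinity>" "\<And>n. real n * h \<le> enn2real (H \<mu> n)"
    "(\<lambda>n. enn2real (H \<mu> n) / real n) \<longlonglongrightarrow> h"
    by (rule entropy_converges[OF \<mu> H1], rule that)
  \<comment> \<open>A finite entropy divided by an infinite exponent is 0 and cannot exceed
    \<open>s\<close>.\<close>
  have "lyapunov_exponent I f \<mu> \<noteq> \<infinity>"
    using ratio h(2) by (auto simp: ennreal_divide_top)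
  then have lfin: "lyapunov_exponent I f \<mu> < \<infinity>" by (simp add: top.not_eq_extremum)
  note intlog = lyapunov_eq(2)[OF \<mu> lfin]
  define l where "l = (\<integral>x. log_expansion x \<partial>\<mu>)"
  have l: "0 < l" using lyapunov_eq(4)[OF \<mu> intlog] ln_\<xi>_pos by (simp add: l_def)
  have "ennreal s < ennreal (h / l)"
    using ratio h l lyapunov_eq(3)[OF \<mu> intlog] by (simp add: l_def divide_ennreal)
  then have "s < h / l" using s by (simp add: ennreal_less_iff)
  then have sl: "s * l < h" using l by (simp add: field_simps)
  define \<beta> where "\<beta> = h - s * l"
  have \<beta>: "0 < \<beta>" using sl by (simp add: \<beta>_def)
  \<comment> \<open>Distortion enters three times, twice through \<open>weight\<close> and once in
    passing from lengths to the exponent, so at most \<open>3/8\<close> of the gap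
    \<open>\<beta> * n\<close> is spent.\<close>
  have "eventually (\<lambda>n. V n \<le> \<beta> / (8 * s) * real n) sequentially"
    by (rule sublinear_eventually[OF V_sublinear]) (use \<beta> s in auto)
  moreover have "eventually (\<lambda>n. \<forall>i\<in>{..<k}. pot_osc (\<phi> i) n \<le> \<epsilon> / 16 * real n) sequentially"
    using \<epsilon> by (intro eventually_ball_finite ballI sublinear_eventually pot_osc_sublinear pot) auto
  ultimately have "eventually (\<lambda>n. V n \<le> \<beta> / (8 * s) * real n \<and> (\<forall>i\<in>{..<k}. pot_osc (\<phi> i) n \<le> \<epsilon> / 16 * real n) \<and> 1 \<le> n) sequentially"
    using eventually_ge_at_top[of 1] by eventually_elim auto
  then obtain n where n: "1 \<le> n" and Vn: "V n \<le> \<beta> / (8 * s) * real n"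
    and PVn: "\<And>i. i < k \<Longrightarrow> pot_osc (\<phi> i) n \<le> \<epsilon> / 16 * real n"
    by (auto dest!: eventually_happens)
  have npos: "0 < real n" using n by simp
  let ?p = "cyl_prob \<mu>"
  define A where "A M = {w::nat list. length w = n \<and> to_nat w < M \<and> 0 < ?p w}" for M
  have finA: "finite (A M)" for M
    unfolding A_def by (rule finite_subset[OF _ finite_vimageI[of "{..<M}" to_nat]]) auto
  define C where "C M = {x \<in> \<Lambda>. word n x \<in> A M}" for M
  have Cm [measurable]: "C M \<in> sets \<mu>" for M
  proof -
    have "C M = word n -` A M \<inter> space \<mu>" by (auto simp: C_def sp)
    then show ?thesis using measurable_sets[OF word_measurable_0(1)[OF \<mu>], of "A M" n] by simp
  qed
  \<comment> \<open>The finite sets \<open>A M\<close> exhaust the words of positive mass, so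
    dominated convergence recovers every integral from its truncation.\<close>
  have conv: "(\<lambda>M. \<integral>x. indicator (C M) x * g x \<partial>\<mu>) \<longlonglongrightarrow> (\<integral>x. g x \<partial>\<mu>)"
    if g: "integrable \<mu> g" for g :: "real \<Rightarrow> real"
  proof (rule integral_dominated_convergence[where w = "\<lambda>x. \<bar>g x\<bar>"])
    have [measurable]: "g \<in> borel_measurable \<mu>" using g by auto
    show "g \<in> borel_measurable \<mu>" "integrable \<mu> (\<lambda>x. \<bar>g x\<bar>)" using g by auto
    show "(\<lambda>x. indicator (C M) x * g x) \<in> borel_measurable \<mu>" for M by measurable
    show "AE x in \<mu>. (\<lambda>M. indicator (C M) x * g x) \<longlonglongrightarrow> g x"
      using AE_cyl_prob_pos(2)[OF \<mu>, of n] AE_space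
    proof eventually_elim
      case (elim x)
      have "indicator (C M) x * g x = g x" if "Suc (to_nat (word n x)) \<le> M" for M
        using elim that by (simp add: C_def A_def sp)
      then have "eventually (\<lambda>M. g x = indicator (C M) x * g x) sequentially"
        unfolding eventually_sequentially by metis
      then show ?case by (rule Lim_transform_eventually[OF tendsto_const])
    qed
    show "AE x in \<mu>. norm (indicator (C M) x * g x) \<le> \<bar>g x\<bar>" for M
      by (auto simp: indicator_def)
  qed
  have fsum: "integrable \<mu> (\<lambda>x. indicator (C M) x * a (word n x))"
    "(\<integral>x. indicator (C M) x * a (word n x) \<partial>\<mu>) = (\<Sum>w\<in>A M. ?p w * a w)" for M and a :: "nat list \<Rightarrow> real"
  proof -
    let ?E = "\<lambda>w. word n -` {w} \<inter> space \<mu>"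
    have eq: "indicator (C M) x * a (word n x) = (\<Sum>w\<in>A M. a w * indicator (?E w) x)" if x: "x \<in> space \<mu>" for x
    proof -
      have "(\<Sum>w\<in>A M. a w * indicator (?E w) x) = (\<Sum>w\<in>A M. if w = word n x then a w else 0)"
        using x by (intro sum.cong) (auto simp: indicator_def)
      also have "\<dots> = (if word n x \<in> A M then a (word n x) else 0)"
        using finA by (simp add: sum.delta)
      finally show ?thesis using x by (simp add: C_def sp indicator_def)
    qed
    have E: "?E w \<in> sets \<mu>" "measure \<mu> (?E w) = ?p w" if "w \<in> A M" for w
      using cyl_prob_alt[OF \<mu>, of w n] that by (auto simp: A_def)
    have i: "integrable \<mu> (\<lambda>x. a w * indicator (?E w) x)" if "w \<in> A M" for w
      using E[OF that] by (intro integrable_mult_right integrable_real_indicator) (auto simp: emeasure_eq_measure)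
    show "integrable \<mu> (\<lambda>x. indicator (C M) x * a (word n x))"
      using i by (subst Bochner_Integration.integrable_cong[OF refl eq]) auto
    have "(\<integral>x. indicator (C M) x * a (word n x) \<partial>\<mu>) = (\<integral>x. (\<Sum>w\<in>A M. a w * indicator (?E w) x) \<partial>\<mu>)"
      by (rule Bochner_Integration.integral_cong[OF refl eq])
    also have "\<dots> = (\<Sum>w\<in>A M. \<integral>x. a w * indicator (?E w) x \<partial>\<mu>)"
      by (rule Bochner_Integration.integral_sum[OF i])
    also have "\<dots> = (\<Sum>w\<in>A M. ?p w * a w)"
      using E by (intro sum.cong) (auto simp: mult.commute)
    finally show "(\<integral>x. indicator (C M) x * a (word n x) \<partial>\<mu>) = (\<Sum>w\<in>A M. ?p w * a w)" .
  qed
  have icut: "integrable \<mu> (\<lambda>x. indicator (C M) x * g x)" if "integrable \<mu> g" for M and g :: "real \<Rightarrow> real"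
    using integrable_mult_indicator[OF Cm that, of M] by simp
  define Z where "Z M = (\<Sum>w\<in>A M. ?p w)" for M
  have Zlim: "Z \<longlonglongrightarrow> 1"
  proof -
    have "Z M = (\<integral>x. indicator (C M) x * 1 \<partial>\<mu>)" for M
      using fsum(2)[of M "\<lambda>_. 1"] by (simp add: Z_def)
    then have "Z = (\<lambda>M. \<integral>x. indicator (C M) x * 1 \<partial>\<mu>)" by (rule ext)
    moreover have "(\<integral>x. 1 \<partial>\<mu>) = (1::real)" by (simp add: prob_space)
    ultimately show ?thesis using conv[of "\<lambda>_. 1"] by simp
  qed
  define Ai where "Ai i M = (\<integral>x. indicator (C M) x * birkhoff_sum (\<phi> i) n (itinerary x) \<partial>\<mu>)" for i M
  have Alim: "Ai i \<longlonglongrightarrow> real n * (\<integral>x. \<phi> i x \<partial>\<mu>)" if "i < k" for i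
    unfolding Ai_def using conv[OF birkhoff_sum_integral(1)[OF \<mu> int[OF that], of n]] birkhoff_sum_integral(2)[OF \<mu> int[OF that], of n] by simp
  have Aclose: "\<bar>(\<Sum>w\<in>A M. ?p w * birkhoff_sum (\<phi> i) n (periodic_code w)) - Ai i M\<bar> \<le> pot_osc (\<phi> i) n" if i: "i < k" for i M
  proof -
    let ?a = "\<lambda>w. birkhoff_sum (\<phi> i) n (periodic_code w)"
    note i1 = fsum(1)[of M ?a] and i2 = icut[OF birkhoff_sum_integral(1)[OF \<mu> int[OF i], of n], of M]
    have eq: "(\<Sum>w\<in>A M. ?p w * ?a w) - Ai i M = (\<integral>x. indicator (C M) x * ?a (word n x) - indicator (C M) x * birkhoff_sum (\<phi> i) n (itinerary x) \<partial>\<mu>)"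
      unfolding fsum(2)[symmetric] Ai_def using i1 i2 by simp
    have "\<bar>(\<Sum>w\<in>A M. ?p w * ?a w) - Ai i M\<bar> \<le> (\<integral>x. pot_osc (\<phi> i) n \<partial>\<mu>)"
      unfolding eq
    proof (rule integral_abs_bound[THEN order_trans], rule integral_mono_AE)
      show "AE x in \<mu>. \<bar>indicator (C M) x * ?a (word n x) - indicator (C M) x * birkhoff_sum (\<phi> i) n (itinerary x)\<bar> \<le> pot_osc (\<phi> i) n"
        using AE_R[OF \<mu>]
      proof eventually_elim
        case (elim x)
        have ne: "word n x \<noteq> []" using n by (metis length_prefix_of list.size(3) not_one_le_zero)
        have "\<bar>birkhoff_sum (\<phi> i) n (periodic_code (word n x)) - birkhoff_sum (\<phi> i) n (itinerary x)\<bar> \<le> pot_osc (\<phi> i) n"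
          using prefix_periodic_code[OF ne] R_itinerary[OF elim] by (intro birkhoff_sum_close pot periodic_code_reg ne) auto
        then show ?case by (simp add: indicator_def cum_modulus_nonneg)
      qed
    qed (use i1 i2 in auto)
    then show ?thesis by (simp add: prob_space)
  qed
  define En where "En M = (\<Sum>w\<in>A M. ?p w * (- ln (?p w)))" for M
  have Elim: "En \<longlonglongrightarrow> enn2real (H \<mu> n)"
  proof -
    let ?g = "\<lambda>x. - ln (?p (word n x))"
    have g0: "0 \<le> ?g x" for x
    proof (cases "?p (word n x) = 0")
      case False
      then have "0 < ?p (word n x)" using cyl_prob_nonneg by (simp add: less_le)
      then show ?thesis using cyl_prob_le_1[OF \<mu>] by simp
    qed simp
    have gm: "?g \<in> borel_measurable \<mu>" using word_measurable_0(2)[OF \<mu>, of "\<lambda>w. - ln (?p w)" n] .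
    have "(\<integral>\<^sup>+x. ennreal (?g x) \<partial>\<mu>) < \<infinity>" using h(3)[of n] partition_entropy_eq[OF \<mu>, of n] by simp
    then have gi: "integrable \<mu> ?g" using gm g0 by (intro integrableI_nonneg) auto
    have "(\<integral>x. ?g x \<partial>\<mu>) = enn2real (H \<mu> n)"
      unfolding partition_entropy_eq[OF \<mu>] using gm g0 by (intro integral_eq_nn_integral) auto
    moreover have "(\<integral>x. indicator (C M) x * ?g x \<partial>\<mu>) = En M" for M
      unfolding En_def by (rule fsum(2))
    ultimately show ?thesis using conv[OF gi] by simp
  qed
  have Rlow: "- (real n * l + V n) \<le> (\<Sum>w\<in>A M. ?p w * ln (r w))" for M
  proof -
    note bi = birkhoff_sum_integral[OF \<mu> intlog, of n]
    have "- (real n * l + V n) = (\<integral>x. - (birkhoff_sum log_expansion n (itinerary x) + V n) \<partial>\<mu>)"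
      using bi by (simp add: l_def prob_space)
    also have "\<dots> \<le> (\<integral>x. indicator (C M) x * ln (r (word n x)) \<partial>\<mu>)"
    proof (rule integral_mono_AE)
      show "integrable \<mu> (\<lambda>x. - (birkhoff_sum log_expansion n (itinerary x) + V n))" using bi(1) by simp
      show "integrable \<mu> (\<lambda>x. indicator (C M) x * ln (r (word n x)))" by (rule fsum(1))
      show "AE x in \<mu>. - (birkhoff_sum log_expansion n (itinerary x) + V n) \<le> indicator (C M) x * ln (r (word n x))"
        using AE_R[OF \<mu>]
      proof eventually_elim
        case (elim x)
        have "- (birkhoff_sum log_expansion n (itinerary x) + V n) \<le> ln (r (word n x))"
          using birkhoff_sum_log_expansion_r[of "itinerary x" n] R_itinerary[OF elim] by (simp add: abs_le_iff)
        moreover have "ln (r (word n x)) \<le> 0" using r_le_1[of "word n x"] r_pos[of "word n x"] by simp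
        ultimately show ?case by (simp add: indicator_def)
      qed
    qed
    also have "\<dots> = (\<Sum>w\<in>A M. ?p w * ln (r w))" by (rule fsum(2))
    finally show ?thesis .
  qed
  \<comment> \<open>A lower bound for the entropy gap of the renormalised distribution. As
    \<open>M\<close> grows, it tends to the entropy of level \<open>n\<close> minus
    \<open>s * n * l\<close> and three terms \<open>s * V n\<close>.\<close>
  define low where "low M = (En M - s * (real n * l + V n)) / Z M + ln (Z M) - 2 * s * V n" for M
  have "low \<longlonglongrightarrow> (enn2real (H \<mu> n) - s * (real n * l + V n)) / 1 + ln 1 - 2 * s * V n"
    unfolding low_def using Zlim Elim by (intro tendsto_intros) auto
  moreover have "0 < (enn2real (H \<mu> n) - s * (real n * l + V n)) / 1 + ln 1 - 2 * s * V n"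
  proof -
    have "s * V n \<le> s * (\<beta> / (8 * s) * real n)" using Vn s by (intro mult_left_mono) auto
    also have "\<dots> = \<beta> * real n / 8" using s by simp
    finally have "3 * (s * V n) \<le> 3 / 8 * (\<beta> * real n)" by simp
    moreover have "\<beta> * real n = real n * h - s * (real n * l)" by (simp add: \<beta>_def algebra_simps)
    moreover have "0 < \<beta> * real n" using \<beta> npos by simp
    ultimately show ?thesis using h(4)[of n] by (simp add: algebra_simps)
  qed
  ultimately have ev1: "eventually (\<lambda>M. 0 < low M) sequentially"
    by (rule order_tendstoD(1))
  have ev2: "eventually (\<lambda>M. 1 / 2 < Z M) sequentially"
    by (rule order_tendstoD(1)[OF Zlim]) simp
  have ev3: "eventually (\<lambda>M. \<forall>i\<in>{..<k}. \<bar>Ai i M / Z M - real n * (\<integral>x. \<phi> i x \<partial>\<mu>)\<bar> < real n * \<epsilon> / 16) sequentially"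
  proof (intro eventually_ball_finite ballI)
    fix i assume "i \<in> {..<k}"
    then have i: "i < k" by simp
    have "(\<lambda>M. Ai i M / Z M) \<longlonglongrightarrow> real n * (\<integral>x. \<phi> i x \<partial>\<mu>) / 1"
      using Alim[OF i] Zlim by (intro tendsto_divide) auto
    then have "(\<lambda>M. Ai i M / Z M) \<longlonglongrightarrow> real n * (\<integral>x. \<phi> i x \<partial>\<mu>)" by simp
    from tendstoD[OF this, of "real n * \<epsilon> / 16"] npos \<epsilon>
    show "eventually (\<lambda>M. \<bar>Ai i M / Z M - real n * (\<integral>x. \<phi> i x \<partial>\<mu>)\<bar> < real n * \<epsilon> / 16) sequentially"
      by (simp add: dist_real_def)
  qed simp
  from ev1 ev2 ev3 have "eventually (\<lambda>M. 0 < low M \<and> 1 / 2 < Z M \<and>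
      (\<forall>i\<in>{..<k}. \<bar>Ai i M / Z M - real n * (\<integral>x. \<phi> i x \<partial>\<mu>)\<bar> < real n * \<epsilon> / 16)) sequentially"
    by eventually_elim auto
  then obtain M where M: "0 < low M" "1 / 2 < Z M"
    "\<And>i. i < k \<Longrightarrow> \<bar>Ai i M / Z M - real n * (\<integral>x. \<phi> i x \<partial>\<mu>)\<bar> < real n * \<epsilon> / 16"
    by (auto dest!: eventually_happens)
  have Zpos: "0 < Z M" using M(2) by simp
  define q where "q w = ?p w / Z M" for w
  have qsum: "(\<Sum>w\<in>A M. q w) = 1" unfolding q_def using Zpos by (simp add: Z_def flip: sum_divide_distrib)
  have qpos: "0 < q w" if "w \<in> A M" for w using that Zpos by (simp add: q_def A_def)
  have len: "length w = n" if "w \<in> A M" for w using that by (simp add: A_def)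
  show ?thesis
  proof (rule typical_words[OF s finA[of M] len _ qpos qsum _ \<epsilon> pot])
    show "0 < n" using n by simp
    have "(\<Sum>w\<in>A M. q w * (- ln (q w) + s * ln (weight w)))
        = (\<Sum>w\<in>A M. (?p w * (- ln (?p w)) + s * (?p w * ln (r w))) / Z M + q w * (ln (Z M) - 2 * s * V n))"
    proof (rule sum.cong[OF refl])
      fix w assume w: "w \<in> A M"
      have lq: "ln (q w) = ln (?p w) - ln (Z M)" using w Zpos by (simp add: q_def A_def ln_div)
      have lw: "ln (weight w) = ln (r w) - 2 * V n" using r_pos[of w] len[OF w] by (simp add: weight_def ln_mult)
      show "q w * (- ln (q w) + s * ln (weight w))
          = (?p w * (- ln (?p w)) + s * (?p w * ln (r w))) / Z M + q w * (ln (Z M) - 2 * s * V n)"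
        unfolding lq lw unfolding q_def using Zpos by (simp add: field_simps)
    qed
    also have "\<dots> = (En M + s * (\<Sum>w\<in>A M. ?p w * ln (r w))) / Z M + (ln (Z M) - 2 * s * V n)"
    proof -
      have "(\<Sum>w\<in>A M. X w / Z M + q w * c) = (\<Sum>w\<in>A M. X w) / Z M + (\<Sum>w\<in>A M. q w) * c" for X c
        by (simp only: sum.distrib sum_divide_distrib sum_distrib_right)
      moreover have "(\<Sum>w\<in>A M. ?p w * (- ln (?p w)) + s * (?p w * ln (r w))) = En M + s * (\<Sum>w\<in>A M. ?p w * ln (r w))"
        by (simp only: sum.distrib En_def sum_distrib_left)
      ultimately show ?thesis by (simp only: qsum mult_1)
    qed
    also have "\<dots> \<ge> low M"
    proof -
      have "s * - (real n * l + V n) \<le> s * (\<Sum>w\<in>A M. ?p w * ln (r w))"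
        using s by (intro mult_left_mono Rlow) auto
      then have "En M - s * (real n * l + V n) \<le> En M + s * (\<Sum>w\<in>A M. ?p w * ln (r w))"
        unfolding mult_minus_right by linarith
      then have "(En M - s * (real n * l + V n)) / Z M \<le> (En M + s * (\<Sum>w\<in>A M. ?p w * ln (r w))) / Z M"
        using Zpos by (intro divide_right_mono) auto
      then show ?thesis by (simp add: low_def)
    qed
    finally show "0 < (\<Sum>w\<in>A M. q w * (- ln (q w) + s * ln (weight w)))" using M(1) by linarith
    show "pot_osc (\<phi> i) n \<le> real n * \<epsilon> / 4" if "i < k" for i
    proof -
      have "0 \<le> \<epsilon> * real n" using \<epsilon> by simp
      then show ?thesis using PVn[OF that] by (simp add: mult.commute)
    qed
    \<comment> \<open>The three errors are \<open>1/8\<close> for sampling, \<open>1/16\<close> for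
      truncation and \<open>1/4\<close> for the integrals, in units of
      \<open>n * \<epsilon>\<close>.\<close>
    show "\<bar>(\<Sum>w\<in>A M. q w * birkhoff_sum (\<phi> i) n (periodic_code w)) - real n * \<gamma> i\<bar> \<le> real n * \<epsilon> / 2" if i: "i < k" for i
    proof -
      let ?S = "\<Sum>w\<in>A M. ?p w * birkhoff_sum (\<phi> i) n (periodic_code w)"
      have "\<bar>?S / Z M - Ai i M / Z M\<bar> = \<bar>?S - Ai i M\<bar> / Z M"
        using Zpos by (simp flip: diff_divide_distrib)
      also have "\<dots> \<le> (\<epsilon> / 16 * real n) / Z M"
        using Aclose[OF i, of M] PVn[OF i] Zpos by (intro divide_right_mono) auto
      also have "\<dots> \<le> (\<epsilon> / 16 * real n) / (1 / 2)"
        using M(2) \<epsilon> npos by (intro divide_left_mono) auto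
      finally have "\<bar>?S / Z M - Ai i M / Z M\<bar> \<le> real n * \<epsilon> / 8" by (simp add: mult.commute)
      moreover have "\<bar>real n * (\<integral>x. \<phi> i x \<partial>\<mu>) - real n * \<gamma> i\<bar> \<le> real n * \<epsilon> / 4"
        using mult_left_mono[OF less_imp_le[OF avg[OF i]], of "real n"] by (simp add: abs_mult flip: right_diff_distrib)
      moreover have "(\<Sum>w\<in>A M. q w * birkhoff_sum (\<phi> i) n (periodic_code w)) = ?S / Z M"
        by (simp add: q_def sum_divide_distrib)
      moreover have "0 < real n * \<epsilon>" using npos \<epsilon> by simp
      ultimately show ?thesis using M(3)[OF i] by linarith
    qed
  qed
qed

lemma alpha1_rich:
  assumes s: "0 < s" and less: "ennreal s < alpha1 I f \<phi> \<gamma>"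
    and pot: "\<And>i. potential_variations_vanish I f (\<phi> i)"
  shows "rich \<phi> \<gamma> s"
  unfolding rich_def
proof (intro allI impI)
  fix \<epsilon> :: real and k N :: nat assume \<epsilon>: "0 < \<epsilon>"
  have "alpha1 I f \<phi> \<gamma> \<le> spectrum_sup I f \<phi> (invariant_measures I f) \<gamma> (\<epsilon> / 4) k"
    unfolding alpha1_def dim_spectrum_eq_INF
    by (rule order_trans[OF INF_lower[of "\<epsilon> / 4"] INF_lower]) (use \<epsilon> in auto)
  then have "ennreal s < spectrum_sup I f \<phi> (invariant_measures I f) \<gamma> (\<epsilon> / 4) k"
    using less by (rule less_le_trans[rotated])
  then obtain \<mu> where \<mu>: "\<mu> \<in> invariant_measures I f"
    "\<forall>i<k. integrable \<mu> (\<phi> i) \<and> \<bar>(\<integral>x. \<phi> i x \<partial>\<mu>) - \<gamma> i\<bar> < \<epsilon> / 4"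
    "entropy_of I f \<mu> < \<infinity>" "ennreal s < entropy_of I f \<mu> / lyapunov_exponent I f \<mu>"
    unfolding spectrum_sup_def less_SUP_iff by blast
  show "\<exists>n\<ge>N. \<exists>F. finite F \<and> (\<forall>w\<in>F. near_average \<phi> \<gamma> \<epsilon> k n w) \<and> 1 \<le> (\<Sum>w\<in>F. weight w powr s)"
    by (rule measure_typical_words[OF \<mu>(1) s \<epsilon> \<mu>(3,4) _ _ pot]) (use \<mu>(2) in auto)
qed

subsection \<open>The covering argument\<close>

text \<open>Convergence along the itinerary is transferred to all regular codes with the same
  prefix; the constant for ambiguous points and the oscillation are both sublinear.\<close>

lemma level_set_near_average:
  assumes x: "x \<in> birkhoff_level_set I f \<phi> \<gamma>" and \<epsilon>: "0 < \<epsilon>"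
    and pot: "\<And>i. potential_variations_vanish I f (\<phi> i)"
  shows "eventually (\<lambda>n. near_average \<phi> \<gamma> \<epsilon> k n (word n x)) sequentially"
proof -
  have xL: "x \<in> \<Lambda>" using x by (simp add: birkhoff_level_set_def)
  have lim: "(\<lambda>n. birkhoff_sum (\<phi> i) n (itinerary x) / real n) \<longlonglongrightarrow> \<gamma> i" for i
    using x by (simp add: birkhoff_level_set_def birkhoff_sum_itinerary)
  have "eventually (\<lambda>n. \<forall>i\<in>{..<k}. \<forall>\<omega>\<in>reg. prefix_of \<omega> n = word n x \<longrightarrow>
      \<bar>birkhoff_sum (\<phi> i) n \<omega> - real n * \<gamma> i\<bar> \<le> real n * \<epsilon>) sequentially"
  proof (rule eventually_ball_finite[OF finite_lessThan], rule ballI)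
    fix i assume "i \<in> {..<k}"
    obtain C where C: "\<And>n \<tau>. \<tau> \<in> reg \<Longrightarrow> prefix_of \<tau> n = word n x \<Longrightarrow>
        \<bar>birkhoff_sum (\<phi> i) n \<tau> - birkhoff_sum (\<phi> i) n (itinerary x)\<bar> \<le> C + pot_osc (\<phi> i) n"
      using birkhoff_sum_itinerary_close[OF pot xL] by blast
    have "eventually (\<lambda>n. pot_osc (\<phi> i) n \<le> \<epsilon> / 4 * real n) sequentially"
      by (rule sublinear_eventually[OF pot_osc_sublinear[OF pot]]) (use \<epsilon> in auto)
    moreover have "eventually (\<lambda>n. \<bar>birkhoff_sum (\<phi> i) n (itinerary x) / real n - \<gamma> i\<bar> < \<epsilon> / 4) sequentially"
      using tendstoD[OF lim, of "\<epsilon> / 4" i] \<epsilon> by (simp add: dist_real_def)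
    moreover have "eventually (\<lambda>n. C \<le> \<epsilon> / 4 * real n) sequentially"
    proof -
      obtain N :: nat where N: "4 * C / \<epsilon> < real N" using reals_Archimedean2 by blast
      have "C \<le> \<epsilon> / 4 * real n" if "N \<le> n" for n
      proof -
        have "4 * C < \<epsilon> * real N" using N \<epsilon> by (simp add: field_simps)
        also have "\<dots> \<le> \<epsilon> * real n" using that \<epsilon> by simp
        finally show ?thesis by simp
      qed
      then show ?thesis by (auto simp: eventually_sequentially)
    qed
    ultimately show "eventually (\<lambda>n. \<forall>\<omega>\<in>reg. prefix_of \<omega> n = word n x \<longrightarrow>
      \<bar>birkhoff_sum (\<phi> i) n \<omega> - real n * \<gamma> i\<bar> \<le> real n * \<epsilon>) sequentially"
      using eventually_ge_at_top[of 1]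
    proof eventually_elim
      case (elim n)
      have npos: "0 < real n" using elim by simp
      have eq: "birkhoff_sum (\<phi> i) n (itinerary x) - real n * \<gamma> i = real n * (birkhoff_sum (\<phi> i) n (itinerary x) / real n - \<gamma> i)"
        using npos by (simp add: right_diff_distrib)
      have "\<bar>birkhoff_sum (\<phi> i) n (itinerary x) - real n * \<gamma> i\<bar> = real n * \<bar>birkhoff_sum (\<phi> i) n (itinerary x) / real n - \<gamma> i\<bar>"
        unfolding eq abs_mult by simp
      also have "\<dots> \<le> real n * (\<epsilon> / 4)" using elim by (intro mult_left_mono) auto
      finally have 1: "\<bar>birkhoff_sum (\<phi> i) n (itinerary x) - real n * \<gamma> i\<bar> \<le> \<epsilon> / 4 * real n" by (simp add: mult.commute)
      have 2: "0 \<le> \<epsilon> * real n" using \<epsilon> by simp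
      show ?case
      proof (intro ballI impI)
        fix \<omega> assume "\<omega> \<in> reg" "prefix_of \<omega> n = word n x"
        from C[OF this] have "\<bar>birkhoff_sum (\<phi> i) n \<omega> - birkhoff_sum (\<phi> i) n (itinerary x)\<bar> \<le> \<epsilon> / 4 * real n + \<epsilon> / 4 * real n"
          using elim by linarith
        then have "\<bar>birkhoff_sum (\<phi> i) n \<omega> - real n * \<gamma> i\<bar> \<le> \<epsilon> / 4 * real n + \<epsilon> / 4 * real n + \<epsilon> / 4 * real n"
          using 1 by linarith
        also have "\<dots> \<le> real n * \<epsilon>" using 2 by (simp add: algebra_simps)
        finally show "\<bar>birkhoff_sum (\<phi> i) n \<omega> - real n * \<gamma> i\<bar> \<le> real n * \<epsilon>" .
      qed
    qed
  qed
  then show ?thesis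
    by eventually_elim (auto simp: near_average_def)
qed

text \<open>Failure of the condition keeps the weight sum of every late layer below 1. Raising the
  exponent from \<open>s\<close> to \<open>t\<close> makes the layers geometrically small, so covers
  by long words have arbitrarily small \<open>t\<close>-sums.\<close>

lemma not_rich_dim:
  assumes s: "0 < s" "s < t" and not: "\<not> rich \<phi> \<gamma> s"
    and pot: "\<And>i. potential_variations_vanish I f (\<phi> i)"
  shows "hausdorff_dim (birkhoff_level_set I f \<phi> \<gamma>) \<le> ennreal t"
proof -
  let ?L = "birkhoff_level_set I f \<phi> \<gamma>"
  obtain \<epsilon> k N where \<epsilon>: "0 < \<epsilon>"
    and few: "\<And>n F. N \<le> n \<Longrightarrow> finite F \<Longrightarrow> (\<And>w. w \<in> F \<Longrightarrow> near_average \<phi> \<gamma> \<epsilon> k n w) \<Longrightarrow> (\<Sum>w\<in>F. weight w powr s) < 1"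
    using not unfolding rich_def not_all not_imp by (metis not_le)
  \<comment> \<open>Contraction gains \<open>2 * c\<close> per letter when \<open>s\<close> is
    replaced by \<open>t\<close>; half of this pays for the distortion and the other half remains as
    the ratio \<open>q\<close>.\<close>
  define c where "c = (t - s) * ln \<xi> / 2"
  have c: "0 < c" using s ln_\<xi>_pos by (simp add: c_def)
  have "0 < c / (2 * s)" using c s by simp
  then obtain K where K: "\<And>n. V n \<le> K + c / (2 * s) * real n" using V_sublinear by blast
  define q B where "q = exp (- c)" and "B = exp (2 * s * K)"
  have q: "0 < q" "q < 1" using c by (auto simp: q_def)
  have B: "0 < B" by (simp add: B_def)
  have rt: "r w powr t \<le> weight w powr s * (B * q ^ length w)" for w
  proof -
    let ?n = "length w"
    have lw: "ln (weight w) = ln (r w) - 2 * V ?n" using r_pos[of w] by (simp add: weight_def ln_mult)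
    have "t * ln (r w) = s * ln (weight w) + 2 * s * V ?n + (t - s) * ln (r w)"
      unfolding lw by (simp add: algebra_simps)
    also have "\<dots> \<le> s * ln (weight w) + 2 * s * K + c * real ?n - 2 * c * real ?n"
    proof -
      have "2 * s * V ?n \<le> 2 * s * (K + c / (2 * s) * real ?n)" using K[of ?n] s by (intro mult_left_mono) auto
      also have "\<dots> = 2 * s * K + c * real ?n" using s by (simp add: field_simps)
      finally have 1: "2 * s * V ?n \<le> 2 * s * K + c * real ?n" .
      have "(t - s) * ln (r w) \<le> (t - s) * (- (real ?n * ln \<xi>))"
        using ln_r_le[of w] s by (intro mult_left_mono) auto
      also have "\<dots> = - (2 * c * real ?n)" by (simp add: c_def)
      finally show ?thesis using 1 by linarith
    qed
    finally have le: "t * ln (r w) \<le> s * ln (weight w) + (2 * s * K + real ?n * (- c))" by (simp add: algebra_simps)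
    have "r w powr t = exp (t * ln (r w))" using r_pos[of w] by (simp add: powr_def)
    also have "\<dots> \<le> exp (s * ln (weight w) + (2 * s * K + real ?n * (- c)))" using le by simp
    also have "\<dots> = weight w powr s * (B * q ^ ?n)"
      using weight_pos[of w] unfolding q_def B_def exp_of_nat_mult[symmetric] exp_add by (simp add: powr_def)
    finally show ?thesis .
  qed
  have layer: "(\<Sum>w\<in>F. r w powr t) \<le> B * q ^ n"
    if "N \<le> n" "finite F" "\<And>w. w \<in> F \<Longrightarrow> near_average \<phi> \<gamma> \<epsilon> k n w" for n F
  proof -
    have "(\<Sum>w\<in>F. r w powr t) \<le> (\<Sum>w\<in>F. weight w powr s * (B * q ^ n))"
    proof (rule sum_mono)
      fix w assume "w \<in> F"
      then have "length w = n" using that(3) by (simp add: near_average_def)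
      then show "r w powr t \<le> weight w powr s * (B * q ^ n)" using rt[of w] by simp
    qed
    also have "\<dots> = (\<Sum>w\<in>F. weight w powr s) * (B * q ^ n)" by (simp add: sum_distrib_right)
    also have "\<dots> \<le> 1 * (B * q ^ n)"
      using few[OF that] B q by (intro mult_right_mono) auto
    finally show ?thesis by simp
  qed
  have pre: "hausdorff_premeasure t \<delta> ?L \<le> ennreal \<eta>" if \<delta>: "0 < \<delta>" and \<eta>: "0 < \<eta>" for \<delta> \<eta>
  proof -
    have "(\<lambda>n. (1 / \<xi>) ^ n) \<longlonglongrightarrow> 0" using \<xi>_gt_1 by (intro LIMSEQ_realpow_zero) auto
    then have "eventually (\<lambda>n. (1 / \<xi>) ^ n < \<delta>) sequentially" using \<delta> by (rule order_tendstoD(2))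
    moreover have "(\<lambda>n. B * (q ^ n / (1 - q))) \<longlonglongrightarrow> B * (0 / (1 - q))"
      using q by (intro tendsto_mult tendsto_divide tendsto_const LIMSEQ_realpow_zero) auto
    then have "eventually (\<lambda>n. B * (q ^ n / (1 - q)) < \<eta>) sequentially"
      using \<eta> by (intro order_tendstoD(2)) auto
    ultimately have "eventually (\<lambda>n. (1 / \<xi>) ^ n < \<delta> \<and> B * (q ^ n / (1 - q)) < \<eta> \<and> N \<le> n) sequentially"
      using eventually_ge_at_top[of N] by eventually_elim auto
    then obtain N1 where N1: "(1 / \<xi>) ^ N1 < \<delta>" "B * (q ^ N1 / (1 - q)) < \<eta>" "N \<le> N1"
      by (auto dest!: eventually_happens)
    define S where "S = {w. N1 \<le> length w \<and> near_average \<phi> \<gamma> \<epsilon> k (length w) w}"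
    \<comment> \<open>The countable cover is indexed through the enumeration of words; indices not
      in use get the empty set, whose gauge is 0.\<close>
    define U where "U i = (if i \<in> to_nat ` S then W (from_nat i) else {})" for i
    have small: "r w \<le> \<delta>" if "w \<in> S" for w
    proof -
      have "r w \<le> (1 / \<xi>) ^ length w"
        using r_le_power[of w] \<xi>_gt_1 by (simp add: power_divide field_simps)
      also have "\<dots> \<le> (1 / \<xi>) ^ N1" using that \<xi>_gt_1 by (intro power_decreasing) (auto simp: S_def)
      finally show ?thesis using N1(1) by simp
    qed
    have Ucov: "?L \<subseteq> (\<Union>i. U i)"
    proof
      fix x assume x: "x \<in> ?L"
      have "eventually (\<lambda>n. near_average \<phi> \<gamma> \<epsilon> k n (word n x) \<and> N1 \<le> n) sequentially"
        using level_set_near_average[OF x \<epsilon> pot] eventually_ge_at_top[of N1] by eventually_elim auto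
      then obtain n where n: "near_average \<phi> \<gamma> \<epsilon> k n (word n x)" "N1 \<le> n" by (auto dest!: eventually_happens)
      then have S: "word n x \<in> S" by (simp add: S_def)
      have "x \<in> W (word n x)" using cod_in_W[of "itinerary x" n] cod_itinerary[of x] x by (simp add: birkhoff_level_set_def)
      then have "x \<in> U (to_nat (word n x))" using S by (simp add: U_def)
      then show "x \<in> (\<Union>i. U i)" by blast
    qed
    have Ud: "bounded (U i) \<and> diameter (U i) \<le> \<delta>" for i
      using W_diameter small \<delta> by (auto simp: U_def)
    have "hausdorff_premeasure t \<delta> ?L \<le> (\<Sum>i. hausdorff_gauge t (U i))"
      unfolding hausdorff_premeasure_def by (rule INF_lower) (use Ucov Ud in auto)
    also have "\<dots> \<le> ennreal \<eta>"
    proof (rule suminf_le_const)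
      fix m
      define Sm where "Sm = {w \<in> S. to_nat w < m}"
      have finSm: "finite Sm" unfolding Sm_def
        by (rule finite_subset[OF _ finite_vimageI[of "{..<m}" to_nat]]) auto
      have "(\<Sum>i<m. hausdorff_gauge t (U i)) = (\<Sum>i\<in>to_nat ` Sm. hausdorff_gauge t (U i))"
      proof (rule sum.mono_neutral_right)
        show "\<forall>i\<in>{..<m} - to_nat ` Sm. hausdorff_gauge t (U i) = 0"
          by (auto simp: U_def Sm_def hausdorff_gauge_def)
      qed (auto simp: Sm_def)
      also have "\<dots> = (\<Sum>w\<in>Sm. hausdorff_gauge t (U (to_nat w)))"
        by (rule sum.reindex_cong[of to_nat]) auto
      also have "\<dots> = (\<Sum>w\<in>Sm. ennreal (r w powr t))"
        using s W_diameter by (intro sum.cong) (auto simp: U_def Sm_def hausdorff_gauge_def)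
      also have "\<dots> = ennreal (\<Sum>w\<in>Sm. r w powr t)" by (rule sum_ennreal) simp
      also have "(\<Sum>w\<in>Sm. r w powr t) = (\<Sum>n\<in>length ` Sm. \<Sum>w\<in>{w \<in> Sm. length w = n}. r w powr t)"
        by (rule sum.image_gen[OF finSm])
      also have "\<dots> \<le> (\<Sum>n\<in>length ` Sm. B * q ^ n)"
      proof (rule sum_mono)
        fix n assume "n \<in> length ` Sm"
        then have "N \<le> n" using N1(3) by (auto simp: Sm_def S_def)
        then show "(\<Sum>w\<in>{w \<in> Sm. length w = n}. r w powr t) \<le> B * q ^ n"
          by (rule layer) (use finSm in simp, auto simp: Sm_def S_def)
      qed
      also have "\<dots> = B * (\<Sum>n\<in>length ` Sm. q ^ n)" by (simp add: sum_distrib_left)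
      also have "\<dots> \<le> B * (q ^ N1 / (1 - q))"
        using B q finSm by (intro mult_left_mono geometric_tail_bound) (auto simp: Sm_def S_def)
      also have "\<dots> \<le> \<eta>" using N1(2) by simp
      finally show "(\<Sum>i<m. hausdorff_gauge t (U i)) \<le> ennreal \<eta>" by (simp add: ennreal_leI)
    qed auto
    finally show ?thesis .
  qed
  have "hausdorff_measure t ?L \<le> 0"
    unfolding hausdorff_measure_def
  proof (rule SUP_least)
    fix \<delta> :: real assume "\<delta> \<in> {0<..}"
    then have "0 < \<delta>" by simp
    show "hausdorff_premeasure t \<delta> ?L \<le> 0"
      by (rule ennreal_le_epsilon) (use pre \<open>0 < \<delta>\<close> in auto)
  qed
  then show ?thesis
    unfolding hausdorff_dim_def using s by (intro INF_lower) auto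
qed

lemma ennreal_le_by_reals:
  fixes a b :: ennreal
  assumes "\<And>s. 0 < s \<Longrightarrow> ennreal s < a \<Longrightarrow> ennreal s \<le> b"
  shows "a \<le> b"
proof (rule dense_le)
  fix x assume x: "x < a"
  then have "x < top" by (rule less_le_trans) simp
  then obtain y where y: "0 \<le> y" "x = ennreal y" by (cases x) auto
  show "x \<le> b"
  proof (cases "y = 0")
    case False
    then show ?thesis using assms[of y] x y by simp
  qed (simp add: y)
qed

text \<open>A cycle of inequalities closed through the combinatorial condition. A real number is
  inserted by density wherever a strict gap between two exponents is required.\<close>

lemma dimension_formula:
  assumes pot: "\<And>i. potential_variations_vanish I f (\<phi> i)"
  shows "hausdorff_dim (birkhoff_level_set I f \<phi> \<gamma>) = alpha1 I f \<phi> \<gamma>"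
    and "alpha1 I f \<phi> \<gamma> = alpha2 I f \<phi> \<gamma>"
proof -
  let ?d = "hausdorff_dim (birkhoff_level_set I f \<phi> \<gamma>)"
  have 1: "?d \<le> alpha2 I f \<phi> \<gamma>"
  proof (rule ennreal_le_by_reals)
    fix s assume s: "0 < s" "ennreal s < ?d"
    then obtain x where x: "ennreal s < x" "x < ?d" using dense by blast
    then have "x < top" by (meson less_le_trans top_greatest)
    then obtain t where t: "0 \<le> t" "x = ennreal t" by (cases x) auto
    have "s < t" using x(1) t s by (simp add: ennreal_less_iff)
    then have "rich \<phi> \<gamma> s" using not_rich_dim[of s t \<phi> \<gamma>, OF s(1) _ _ pot] x(2) t by (metis leD)
    then show "ennreal s \<le> alpha2 I f \<phi> \<gamma>" by (rule rich_alpha2[of s \<phi> \<gamma>, OF s(1) _ pot])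
  qed
  have 2: "alpha2 I f \<phi> \<gamma> \<le> alpha1 I f \<phi> \<gamma>"
    unfolding alpha1_def alpha2_def by (rule dim_spectrum_mono) (auto simp: ergodic_measures_def)
  have 3: "alpha1 I f \<phi> \<gamma> \<le> ?d"
  proof (rule ennreal_le_by_reals)
    fix t assume t: "0 < t" "ennreal t < alpha1 I f \<phi> \<gamma>"
    then obtain x where x: "ennreal t < x" "x < alpha1 I f \<phi> \<gamma>" using dense by blast
    then have "x < top" by (meson less_le_trans top_greatest)
    then obtain s where s: "0 \<le> s" "x = ennreal s" by (cases x) auto
    have ts: "t < s" using x(1) t s by (simp add: ennreal_less_iff)
    have "rich \<phi> \<gamma> s" using alpha1_rich[of s \<phi> \<gamma>, OF _ _ pot] x(2) s t ts by auto
    then show "ennreal t \<le> ?d" by (rule rich_dim[of t s \<phi> \<gamma>, OF t(1) ts _ pot])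
  qed
  show "?d = alpha1 I f \<phi> \<gamma>" "alpha1 I f \<phi> \<gamma> = alpha2 I f \<phi> \<gamma>"
    using 1 2 3 by (auto intro: antisym order_trans)
qed

end

theorem theorem1p1:
  fixes \<xi> :: real
    and I :: "nat \<Rightarrow> real set"
    and f :: "nat \<Rightarrow> real \<Rightarrow> real"
    and \<phi> :: "nat \<Rightarrow> real \<Rightarrow> real"
    and \<gamma> :: "nat \<Rightarrow> real"
  assumes "expanding_full_branches \<xi> I f"
    and "log_deriv_variations_vanish I f"
    and "\<And>i. potential_variations_vanish I f (\<phi> i)"
  shows "(\<gamma> \<notin> approx_averages I f \<phi> \<longrightarrow> birkhoff_level_set I f \<phi> \<gamma> = {}) \<and>
    (\<gamma> \<in> approx_averages I f \<phi> \<longrightarrow>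
      hausdorff_dim (birkhoff_level_set I f \<phi> \<gamma>) = alpha1 I f \<phi> \<gamma> \<and>
      alpha1 I f \<phi> \<gamma> = alpha2 I f \<phi> \<gamma>)"
proof -
  interpret expanding_system \<xi> I f using assms(1,2) by unfold_locales
  show ?thesis
    using level_set_empty[of \<phi> \<gamma>, OF assms(3)] dimension_formula[of \<phi> \<gamma>, OF assms(3)] by blast
qed

end
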